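(* Let $p(\cdot)\in\mathcal{P}(\mathbb{R}^n)\cap LH(\mathbb{R}^n)$ with $p_->1$ and let $w\in\mathcal{A}_{p(\cdot)}$ be a scalar weight. Then there exists $r>1$ such that for all $s\in[1,r]$, if $q(\cdot)$ is the exponent function defined by $q'(\cdot)=s\,p'(\cdot)$, then $w\in\mathcal{A}_{q(\cdot)}$.
   Context: Cubes in $\mathbb{R}^n$ have sides parallel to the coordinate axes. $\mathcal{P}(\mathbb{R}^n)$ is the set of exponent functions, i.e. Lebesgue measurable $p(\cdot):\mathbb{R}^n\to[1,\infty]$; $p_+=\operatorname{ess\,sup}_{\mathbb{R}^n}p$, $p_-=\operatorname{ess\,inf}_{\mathbb{R}^n}p$. The conjugate exponent $p'(\cdot)$ satisfies $\frac1{p(x)}+\frac1{p'(x)}=1$ (with $1/\infty=0$); likewise $q'(\cdot)$ is the conjugate exponent of $q(\cdot)$. With $\Omega_\infty=\{x:p(x)=\infty\}$, the modular is $\rho_{p(\cdot)}(f)=\int_{\mathbb{R}^n\setminus\Omega_\infty}|f(x)|^{p(x)}dx+\|f\|_{L^\infty(\Omega_\infty)}$ and the norm is $\|f\|_{L^{p(\cdot)}(\mathbb{R}^n)}=\inf\{\lambda>0:\rho_{p(\cdot)}(f/\lambda)\le1\}$. Log-Hölder continuity: $u(\cdot):\mathbb{R}^n\to\mathbb{R}$ is in $LH(\mathbb{R}^n)$ if there is $C_0$ with $|u(x)-u(y)|\le\frac{C_0}{-\log|x-y|}$ whenever $|x-y|<1/2$, and there are constants $C_\infty,u_\infty$ with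 $|u(x)-u_\infty|\le\frac{C_\infty}{\log(e+|x|)}$ for all $x$. A (scalar) weight is a non-negative locally integrable function $w$ with $0<w(x)<\infty$ a.e. For an exponent function $p(\cdot)$, $w\in\mathcal{A}_{p(\cdot)}$ means $[w]_{\mathcal{A}_{p(\cdot)}}=\sup_Q|Q|^{-1}\|w\chi_Q\|_{L^{p(\cdot)}(\mathbb{R}^n)}\|w^{-1}\chi_Q\|_{L^{p'(\cdot)}(\mathbb{R}^n)}<\infty$, the supremum being over all cubes $Q\subset\mathbb{R}^n$. *)

theory Defs
  imports "HOL-Analysis.Analysis" "HOL-Probability.Essential_Supremum"
begin

text \<open>
  Exponents, weights and the functions whose norm is taken have values in \<open>[0,\<infinity>]\<close> and are
  modelled in \<^typ>\<open>ennreal\<close>, where \<open>inverse 0 = \<infinity>\<close>, \<open>inverse \<infinity> = 0\<close> and \<open>0 * \<infinity> = 0\<close>.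
\<close>

definition cubes :: "(real ^ 'n) set set"
  where "cubes = {cbox a (\<chi> i. a $ i + l) | a l. 0 < l}"

definition ess_inf :: "'a measure \<Rightarrow> ('a \<Rightarrow> ennreal) \<Rightarrow> ennreal"
  where "ess_inf M f = Sup {z. AE x in M. z \<le> f x}"

definition exponents :: "(real ^ 'n \<Rightarrow> ennreal) set"
  where "exponents = {p \<in> borel_measurable lebesgue. \<forall>x. 1 \<le> p x}"

definition conj_exponent :: "('a \<Rightarrow> ennreal) \<Rightarrow> 'a \<Rightarrow> ennreal"
  where "conj_exponent p x = inverse (1 - inverse (p x))"

lemma inverse_inverse_ennreal [simp]: "inverse (inverse y) = (y :: ennreal)"
proof (cases y)
  case (real r)
  then show ?thesis
    by (cases "r = 0") (auto simp: inverse_ennreal)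
qed simp

lemma le_imp_inverse_le_ennreal: "a \<le> b \<Longrightarrow> inverse b \<le> inverse (a :: ennreal)"
proof (cases "a = 0 \<or> b = \<infinity>")
  case True
  then show "inverse b \<le> inverse a" by auto
next
  case False
  assume "a \<le> b"
  with False show "inverse b \<le> inverse a"
    by (cases a; cases b) (auto simp: inverse_ennreal ennreal_le_iff top_unique order_less_le)
qed

lemma inverse_add_inverse_conj_exponent:
  assumes "1 \<le> p x"
  shows "inverse (p x) + inverse (conj_exponent p x) = 1"
proof -
  have "inverse (p x) \<le> inverse 1"
    using assms by (intro le_imp_inverse_le_ennreal)
  then show ?thesis
    by (simp add: conj_exponent_def)
qed

text \<open>
  The power of a possibly infinite base to a finite exponent; it is only applied to exponents
  \<open>r \<ge> 1\<close>.
\<close>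

definition ennreal_powr :: "ennreal \<Rightarrow> real \<Rightarrow> ennreal"
  where "ennreal_powr y r = (if y = \<infinity> then \<infinity> else ennreal (enn2real y powr r))"

text \<open>
  The argument \<open>f\<close> plays the role of \<open>|f|\<close>. The essential supremum over a null set is \<open>0\<close>.
\<close>

definition modular :: "(real ^ 'n \<Rightarrow> ennreal) \<Rightarrow> (real ^ 'n \<Rightarrow> ennreal) \<Rightarrow> ennreal"
  where "modular p f =
    (\<integral>\<^sup>+ x \<in> {x. p x \<noteq> \<infinity>}. ennreal_powr (f x) (enn2real (p x)) \<partial>lebesgue)
    + esssup (restrict_space lebesgue {x. p x = \<infinity>}) f"

text \<open>The norm is \<open>\<infinity>\<close> if no \<open>\<lambda>\<close> is admissible.\<close>

definition Lp_norm :: "(real ^ 'n \<Rightarrow> ennreal) \<Rightarrow> (real ^ 'n \<Rightarrow> ennreal) \<Rightarrow> ennreal"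
  where "Lp_norm p f = Inf {ennreal l | l. 0 < l \<and> modular p (\<lambda>x. f x / ennreal l) \<le> 1}"

text \<open>
  For \<open>x = y\<close> the quotient, read as \<open>C / \<infinity>\<close> in the literature, is \<open>C / 0 = 0\<close> here,
  and the inequality is trivial either way.
\<close>

definition LH :: "(real ^ 'n \<Rightarrow> real) set"
  where "LH = {u.
    (\<exists>C. \<forall>x y. norm (x - y) < 1 / 2 \<longrightarrow> \<bar>u x - u y\<bar> \<le> C / - ln (norm (x - y))) \<and>
    (\<exists>C v. \<forall>x. \<bar>u x - v\<bar> \<le> C / ln (exp 1 + norm x))}"

definition weights :: "(real ^ 'n \<Rightarrow> ennreal) set"
  where "weights = {w \<in> borel_measurable lebesgue.
    (\<forall>K. compact K \<longrightarrow> (\<integral>\<^sup>+ x \<in> K. w x \<partial>lebesgue) < \<infinity>) \<and>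
    (AE x in lebesgue. 0 < w x \<and> w x < \<infinity>)}"

definition A_const :: "(real ^ 'n \<Rightarrow> ennreal) \<Rightarrow> (real ^ 'n \<Rightarrow> ennreal) \<Rightarrow> ennreal"
  where "A_const p w = (SUP Q \<in> cubes. inverse (emeasure lebesgue Q) *
    Lp_norm p (\<lambda>x. w x * indicator Q x) *
    Lp_norm (conj_exponent p) (\<lambda>x. inverse (w x) * indicator Q x))"

definition A_class :: "(real ^ 'n \<Rightarrow> ennreal) \<Rightarrow> (real ^ 'n \<Rightarrow> ennreal) set"
  where "A_class p = {w \<in> weights. A_const p w < \<infinity>}"

lemma conj_exponent_conj_exponent:
  assumes "1 \<le> p x"
  shows "conj_exponent (conj_exponent p) x = p x"
proof -
  have "inverse (p x) \<le> inverse 1"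
    using assms by (intro le_imp_inverse_le_ennreal)
  then have "1 - (1 - inverse (p x)) = inverse (p x)"
    by (intro diff_diff_ennreal) auto
  then show ?thesis
    by (simp add: conj_exponent_def)
qed

text \<open>The equation \<open>q' = s p'\<close> has exactly one solution \<open>q\<close> among the exponents.\<close>

lemma ex1_scaled_conj_exponent:
  fixes p :: "real ^ 'n \<Rightarrow> ennreal" and s :: real
  assumes "p \<in> exponents" and "1 \<le> s"
  shows "\<exists>!q. q \<in> exponents \<and> (\<forall>x. conj_exponent q x = ennreal s * conj_exponent p x)"
proof (rule ex1I)
  have conj_ge: "1 \<le> conj_exponent r x" for r :: "real ^ 'n \<Rightarrow> ennreal" and x
  proof -
    have "inverse 1 \<le> inverse (1 - inverse (r x))"
      by (intro le_imp_inverse_le_ennreal) (simp add: diff_le_self_ennreal)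
    then show ?thesis
      by (simp add: conj_exponent_def)
  qed
  define t where "t x = ennreal s * conj_exponent p x" for x
  have t_ge: "1 \<le> t x" for x
  proof -
    have "1 * 1 \<le> ennreal s * conj_exponent p x"
      using assms(2) conj_ge by (intro mult_mono) auto
    then show ?thesis
      by (simp add: t_def)
  qed
  have [measurable]: "p \<in> borel_measurable lebesgue"
    using assms(1) by (simp add: exponents_def)
  have "(\<lambda>x. inverse (1 - inverse (ennreal s * inverse (1 - inverse (p x)))))
      \<in> borel_measurable lebesgue"
    by measurable
  then have "conj_exponent t \<in> borel_measurable lebesgue"
    by (simp add: conj_exponent_def[abs_def] t_def)
  then show "conj_exponent t \<in> exponents \<and>
      (\<forall>x. conj_exponent (conj_exponent t) x = ennreal s * conj_exponent p x)"
    using conj_ge conj_exponent_conj_exponent[of t, OF t_ge] by (simp add: exponents_def t_def)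
next
  fix q
  assume q: "q \<in> exponents \<and> (\<forall>x. conj_exponent q x = ennreal s * conj_exponent p x)"
  then have "q x = conj_exponent (conj_exponent q) x" for x
    by (simp add: conj_exponent_conj_exponent exponents_def)
  moreover have "conj_exponent q = (\<lambda>x. ennreal s * conj_exponent p x)"
    using q by auto
  ultimately show "q = conj_exponent (\<lambda>x. ennreal s * conj_exponent p x)"
    by auto
qed

end

theory Submission
  imports Defs
begin

text \<open>
  Put \<open>u = p'\<close>, \<open>v = 1 / w\<close> and \<open>W = v\<^sup>u\<close>, and let \<open>\<lambda>\<close> and \<open>\<mu>\<close> be the norms of \<open>v\<close> and \<open>w\<close> on a cube \<open>Q\<close> in the
  exponents \<open>u\<close> and \<open>p\<close>; the hypothesis is \<open>\<lambda> \<mu> \<le> K |Q|\<close>. The exponent \<open>q\<close> with \<open>q' = s u\<close> satisfies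
  \<open>1/q = 1/p + (1 - 1/s)/u\<close>. If \<open>u\<close> were constant on \<open>Q\<close>, Hoelder's inequality would bound the norm of \<open>w\<close> in
  \<open>q\<close> by \<open>\<mu> \<alpha>\<close> with \<open>\<alpha> = |Q|\<^bsup>(1 - 1/s)/u\<^esup>\<close>, and the reverse Hoelder inequality for \<open>W\<close> would bound the norm
  of \<open>v\<close> in \<open>s u\<close> by a constant times \<open>\<lambda> / \<alpha>\<close>. The product is then bounded by a multiple of \<open>|Q|\<close>. So there
  are two things to do: prove that \<open>W\<close> satisfies a reverse Hoelder inequality, and justify computing with a
  constant exponent.

  The second point is where log-Hoelder continuity enters. On a cube of side at most \<open>1\<close> the exponent may be
  replaced by its value at the corner, on a larger cube by its value at infinity, in all powers
  \<open>\<beta>\<^bsup>-u(x)\<^esup>\<close> of numbers \<open>\<beta>\<close> that are controlled by powers of the side and of \<open>e + |x|\<close>, at the price of a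
  constant and a remainder \<open>(e + |x|)\<^bsup>-N\<^esup>\<close> (\<open>tame_compare\<close>). The norms \<open>\<lambda>\<close> are controlled in this way
  (\<open>tame_lam\<close>), since the norms of two cubes with a large common part are comparable (\<open>lam_comparable\<close>),
  and the remainder is integrable against \<open>W\<close>, since the norms grow at most polynomially
  (\<open>decay_mass_small\<close>).

  For the first point, Young's inequality and the Muckenhoupt condition show that a subset \<open>E\<close> of at least
  half the volume of \<open>Q\<close> carries a fixed share of the modular of \<open>v / \<lambda>\<close>, which is at most \<open>1\<close> on \<open>Q\<close>
  (\<open>integral_ge_portion\<close>). Replacing \<open>\<lambda>\<^bsup>-u(x)\<^esup>\<close> by a constant, one obtains a fixed share of the mass of
  \<open>W\<close> (\<open>exists_fat\<close>). This is the \<open>A\<^sub>\<infinity>\<close> condition, and the reverse Hoelder inequality follows by a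
  Calderon--Zygmund decomposition into dyadic cells (\<open>reverse_Hoelder\<close>).

  It remains to compute with the constant exponent in powers of \<open>\<lambda> / \<alpha>\<close> as well. For large cubes near the
  origin this requires that \<open>\<lambda>\<close> grows at least like some power of the side, which again follows from the
  \<open>A\<^sub>\<infinity>\<close> condition (\<open>lam_growth\<close>); this and the range of the reverse Hoelder inequality determine \<open>r\<close>.
\<close>

section \<open>Cubes and dyadic cells\<close>

definition cube :: "real ^ 'n \<Rightarrow> real \<Rightarrow> (real ^ 'n) set"
  where "cube a l = cbox a (\<chi> i. a $ i + l)"

lemma cubes_eq: "cubes = {cube a l | a l. 0 < l}"
  by (simp add: cubes_def cube_def)

lemma mem_cube: "x \<in> cube a l \<longleftrightarrow> (\<forall>i. a $ i \<le> x $ i \<and> x $ i \<le> a $ i + l)"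
  by (simp add: cube_def mem_box_cart)

lemma cube_lebesgue [measurable]: "cube a l \<in> sets lebesgue"
  by (simp add: cube_def)

lemma emeasure_cube:
  fixes a :: "real ^ 'n"
  assumes "0 \<le> l"
  shows "emeasure lebesgue (cube a l) = ennreal (l ^ CARD('n))"
proof -
  have "cbox a (\<chi> i. a $ i + l) \<noteq> {}"
    using assms by (auto simp: interval_eq_empty_cart)
  then have "measure lborel (cbox a (\<chi> i. a $ i + l)) = l ^ CARD('n)"
    by (simp add: content_cbox_cart)
  moreover have "emeasure lebesgue (cube a l) = ennreal (measure lborel (cbox a (\<chi> i. a $ i + l)))"
    unfolding cube_def using emeasure_lborel_cbox_finite[of a "\<chi> i. a $ i + l"]
    by (intro emeasure_eq_ennreal_measure[of lborel, simplified] | simp add: emeasure_eq_ennreal_measure)+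
  ultimately show ?thesis by simp
qed

text \<open>
  The cells of level \<open>j\<close> are the half-open cubes of the grid of mesh \<open>l / 2\<^sup>j\<close> anchored at \<open>a\<close>. They are
  given by a point \<open>x\<close> of theirs, and not by a corner, so that a level is a partition by definition and
  nestedness is a property of floors.
\<close>

definition cell :: "real ^ 'n \<Rightarrow> real \<Rightarrow> nat \<Rightarrow> real ^ 'n \<Rightarrow> (real ^ 'n) set"
  where "cell a l j x = {y. \<forall>i. \<lfloor>2 ^ j * ((y $ i - a $ i) / l)\<rfloor> = \<lfloor>2 ^ j * ((x $ i - a $ i) / l)\<rfloor>}"

lemma mem_cell_self [simp]: "x \<in> cell a l j x"
  by (simp add: cell_def)

lemma cell_eq: "y \<in> cell a l j x \<Longrightarrow> cell a l j y = cell a l j x"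
  by (simp add: cell_def)

lemma floor_half: "\<lfloor>t\<rfloor> = \<lfloor>2 * t :: real\<rfloor> div 2"
  using floor_divide_real_eq_div[of 2 "2 * t"] by simp

lemma cell_Suc_subset: "cell a l (Suc j) x \<subseteq> cell a l j x"
proof
  fix y assume y: "y \<in> cell a l (Suc j) x"
  show "y \<in> cell a l j x"
    unfolding cell_def
  proof (intro CollectI allI)
    fix i
    have "\<lfloor>2 * (2 ^ j * ((y $ i - a $ i) / l))\<rfloor> = \<lfloor>2 * (2 ^ j * ((x $ i - a $ i) / l))\<rfloor>"
      using y by (simp add: cell_def mult.assoc)
    then show "\<lfloor>2 ^ j * ((y $ i - a $ i) / l)\<rfloor> = \<lfloor>2 ^ j * ((x $ i - a $ i) / l)\<rfloor>"
      by (metis floor_half)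
  qed
qed

lemma cell_mono: "i \<le> j \<Longrightarrow> cell a l j x \<subseteq> cell a l i x"
  by (rule lift_Suc_antimono_le[of "\<lambda>j. cell a l j x"]) (rule cell_Suc_subset)

text \<open>
  A cell is a cube without its upper faces. The value of the corner \<open>c\<close> matters only for the cell of
  level \<open>0\<close> at \<open>a\<close>, which has to be recognised as \<^term>\<open>cube a l\<close>.
\<close>

lemma cell_cube:
  fixes a :: "real ^ 'n"
  assumes "0 < l"
  obtains c where "c = (\<chi> i. a $ i + \<lfloor>2 ^ j * ((x $ i - a $ i) / l)\<rfloor> * (l / 2 ^ j))"
    and "cell a l j x \<subseteq> cube c (l / 2 ^ j)"
    and "cell a l j x \<in> sets lebesgue"
    and "emeasure lebesgue (cell a l j x) = ennreal ((l / 2 ^ j) ^ CARD('n))"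
    and "emeasure lebesgue (cube c (l / 2 ^ j) - cell a l j x) = 0"
proof -
  define h where "h = l / 2 ^ j"
  have h: "0 < h" using assms by (simp add: h_def)
  define c :: "real ^ 'n" where "c = (\<chi> i. a $ i + \<lfloor>2 ^ j * ((x $ i - a $ i) / l)\<rfloor> * h)"
  have cell: "cell a l j x = (\<Inter>i. {y. c $ i \<le> y $ i} \<inter> {y. y $ i < c $ i + h})"
  proof -
    have "\<lfloor>2 ^ j * ((y $ i - a $ i) / l)\<rfloor> = k \<longleftrightarrow> a $ i + k * h \<le> y $ i \<and> y $ i < a $ i + k * h + h"
      for y :: "real ^ 'n" and i k
    proof -
      have "2 ^ j * ((y $ i - a $ i) / l) = (y $ i - a $ i) / h"
        by (simp add: h_def)
      then show ?thesis
        using h by (simp add: floor_eq_iff pos_le_divide_eq pos_divide_less_eq algebra_simps)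
    qed
    then show ?thesis
      by (auto simp: cell_def c_def)
  qed
  have sets: "cell a l j x \<in> sets lebesgue"
  proof -
    have "{y :: real ^ 'n. c $ i \<le> y $ i} \<in> sets lebesgue"
      "{y :: real ^ 'n. y $ i < c $ i + h} \<in> sets lebesgue" for i
      using closed_halfspace_component_ge_cart[of "c $ i" i] open_halfspace_component_lt_cart[of i "c $ i + h"]
      by (auto intro: lebesgue_closedin)
    then show ?thesis
      unfolding cell by (intro sets.finite_INT sets.Int) auto
  qed
  have sub: "cell a l j x \<subseteq> cube c h"
    unfolding cell by (auto simp: mem_cube less_imp_le)
  have null: "emeasure lebesgue (cube c h - cell a l j x) = 0"
  proof -
    have "cube c h - cell a l j x \<subseteq> cbox c (\<chi> i. c $ i + h) - box c (\<chi> i. c $ i + h)"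
      unfolding cell cube_def by (auto simp: mem_box_cart not_less not_le less_imp_le)
    moreover have "cbox c (\<chi> i. c $ i + h) - box c (\<chi> i. c $ i + h) \<in> null_sets lebesgue"
      using negligible_frontier_interval by (simp add: negligible_iff_null_sets)
    ultimately have "cube c h - cell a l j x \<in> null_sets lebesgue"
      using sets by (intro null_sets_subset[of _ lebesgue "cube c h - cell a l j x"]) auto
    then show ?thesis
      by (rule null_setsD1)
  qed
  have "emeasure lebesgue (cube c h) = emeasure lebesgue (cell a l j x)"
    using sub sets null emeasure_Diff_null_set[of "cube c h - cell a l j x" lebesgue "cube c h"]
    by (auto simp: null_sets_def double_diff)
  then show ?thesis
    using that sub sets null emeasure_cube[of h c] h c_def by (simp add: h_def)
qed

lemma cell_lebesgue [measurable]: "0 < l \<Longrightarrow> cell a l j x \<in> sets lebesgue"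
  by (rule cell_cube[of l a j x])

lemma emeasure_cell:
  fixes a :: "real ^ 'n"
  shows "0 < l \<Longrightarrow> emeasure lebesgue (cell a l j x) = ennreal ((l / 2 ^ j) ^ CARD('n))"
  by (rule cell_cube[of l a j x])

lemma countable_cells:
  fixes a :: "real ^ 'n"
  shows "countable {cell a l j x | j x. True}"
proof -
  have "{cell a l j x | j x. True} \<subseteq>
    (\<lambda>(j, k). {y. \<forall>i. \<lfloor>2 ^ j * ((y $ i - a $ i) / l)\<rfloor> = k i}) ` (UNIV :: (nat \<times> ('n \<Rightarrow> int)) set)"
  proof clarify
    fix j x
    show "cell a l j x \<in> (\<lambda>(j, k). {y. \<forall>i. \<lfloor>2 ^ j * ((y $ i - a $ i) / l)\<rfloor> = k i}) ` UNIV"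
      by (rule image_eqI[of _ _ "(j, \<lambda>i. \<lfloor>2 ^ j * ((x $ i - a $ i) / l)\<rfloor>)"]) (auto simp: cell_def)
  qed
  then show ?thesis
    by (rule countable_subset) simp
qed

lemma cell_subset_open:
  fixes a :: "real ^ 'n"
  assumes l: "0 < l" and U: "open U" "x \<in> U"
  shows "\<exists>j. cell a l j x \<subseteq> U"
proof -
  obtain e where e: "0 < e" "ball x e \<subseteq> U"
    using U openE by blast
  obtain j where j: "real CARD('n) * l / e < 2 ^ j"
    using real_arch_pow[of 2] by auto
  have "cell a l j x \<subseteq> ball x e"
  proof
    fix y assume y: "y \<in> cell a l j x"
    obtain c where c: "cell a l j x \<subseteq> cube c (l / 2 ^ j)"
      by (rule cell_cube[OF l])
    have "\<bar>(x - y) $ i\<bar> \<le> l / 2 ^ j" for i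
    proof -
      have "x \<in> cube c (l / 2 ^ j)" "y \<in> cube c (l / 2 ^ j)"
        using c y by auto
      then have "c $ i \<le> x $ i \<and> x $ i \<le> c $ i + l / 2 ^ j" "c $ i \<le> y $ i \<and> y $ i \<le> c $ i + l / 2 ^ j"
        by (simp_all add: mem_cube)
      then show ?thesis
        unfolding vector_minus_component by linarith
    qed
    then have "norm (x - y) \<le> (\<Sum>i\<in>(UNIV :: 'n set). l / 2 ^ j)"
      using norm_le_l1_cart[of "x - y"] sum_mono[of UNIV "\<lambda>i. \<bar>(x - y) $ i\<bar>" "\<lambda>i. l / 2 ^ j"]
      by (meson order_trans)
    also have "\<dots> < e"
      using j e(1) by (simp add: field_simps)
    finally show "y \<in> ball x e"
      by (simp add: dist_norm)
  qed
  with e show ?thesis by blast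
qed

text \<open>
  Any two cells are nested or disjoint and every chain of cells has a largest member, so
  the union of all the cells with a property is the disjoint union of the maximal ones.
\<close>

lemma maximal_cells:
  fixes a :: "real ^ 'n" and S :: "(real ^ 'n) set \<Rightarrow> bool"
  assumes l: "0 < l"
  obtains \<M> where "countable \<M>" and "disjoint \<M>" and "\<Union>\<M> = {x. \<exists>j. S (cell a l j x)}"
    and "\<forall>M\<in>\<M>. \<exists>x j. M = cell a l j x \<and> S M \<and> (\<forall>i<j. \<not> S (cell a l i x))"
proof -
  define J where "J x = (LEAST j. S (cell a l j x))" for x
  define A where "A = {x. \<exists>j. S (cell a l j x)}"
  have SJ: "S (cell a l (J x) x)" if "x \<in> A" for x
    using that LeastI[of "\<lambda>j. S (cell a l j x)"] by (auto simp: A_def J_def)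
  have J_le: "J x \<le> j" if "S (cell a l j x)" for x j
    using that by (simp add: J_def Least_le)
  have eq: "cell a l (J x) x = cell a l (J y) y"
    if "x \<in> A" "y \<in> A" "J x \<le> J y" and z: "z \<in> cell a l (J x) x" "z \<in> cell a l (J y) y" for x y z
  proof -
    have "z \<in> cell a l (J x) y"
      using z(2) cell_mono[OF \<open>J x \<le> J y\<close>] by blast
    then have "cell a l (J x) y = cell a l (J x) x"
      using z(1) cell_eq by metis
    moreover from this have "J y \<le> J x"
      using SJ[OF \<open>x \<in> A\<close>] by (intro J_le) simp
    ultimately show ?thesis
      using \<open>J x \<le> J y\<close> by (metis le_antisym)
  qed
  define \<M> where "\<M> = (\<lambda>x. cell a l (J x) x) ` A"
  show ?thesis
  proof
    show "countable \<M>"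
      by (rule countable_subset[OF _ countable_cells[of a l]]) (auto simp: \<M>_def)
    show "disjoint \<M>"
    proof (rule disjointI)
      fix M N assume "M \<in> \<M>" "N \<in> \<M>" "M \<noteq> N"
      then obtain x y where "x \<in> A" "y \<in> A" "M = cell a l (J x) x" "N = cell a l (J y) y"
        by (auto simp: \<M>_def)
      with \<open>M \<noteq> N\<close> eq[of x y] eq[of y x] show "M \<inter> N = {}"
        by (cases "J x \<le> J y") auto
    qed
    show "\<Union>\<M> = {x. \<exists>j. S (cell a l j x)}"
    proof
      show "\<Union>\<M> \<subseteq> {x. \<exists>j. S (cell a l j x)}"
        using SJ by (auto simp: \<M>_def) (metis cell_eq)
      show "{x. \<exists>j. S (cell a l j x)} \<subseteq> \<Union>\<M>"
        by (fastforce simp: \<M>_def A_def)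
    qed
    show "\<forall>M\<in>\<M>. \<exists>x j. M = cell a l j x \<and> S M \<and> (\<forall>i<j. \<not> S (cell a l i x))"
    proof
      fix M assume M: "M \<in> \<M>"
      obtain x where "x \<in> A" "M = cell a l (J x) x"
        using M by (auto simp: \<M>_def)
      then show "\<exists>x j. M = cell a l j x \<and> S M \<and> (\<forall>i<j. \<not> S (cell a l i x))"
        using SJ J_le by (metis not_le)
    qed
  qed
qed

lemma Collect_cell_lebesgue:
  fixes a :: "real ^ 'n" and S :: "(real ^ 'n) set \<Rightarrow> bool"
  assumes l: "0 < l"
  shows "{x. \<exists>j. S (cell a l j x)} \<in> sets lebesgue"
proof -
  have eq: "{x. \<exists>j. S (cell a l j x)} = \<Union>{D \<in> {cell a l j x | j x. True}. S D}"
  proof (intro set_eqI iffI)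
    fix x assume "x \<in> {x. \<exists>j. S (cell a l j x)}"
    then show "x \<in> \<Union>{D \<in> {cell a l j x | j x. True}. S D}"
      using mem_cell_self[of x a l] by blast
  next
    fix x assume "x \<in> \<Union>{D \<in> {cell a l j x | j x. True}. S D}"
    then obtain j y where "x \<in> cell a l j y" "S (cell a l j y)"
      by blast
    then show "x \<in> {x. \<exists>j. S (cell a l j x)}"
      using cell_eq[of x a l j y] by (intro CollectI exI[of _ j]) simp
  qed
  have c: "countable {D \<in> {cell a l j x | j x. True}. S D}"
    by (rule countable_subset[OF _ countable_cells[of a l]]) blast
  have "{D \<in> {cell a l j x | j x. True}. S D} \<subseteq> sets lebesgue"
    using l by auto
  then show ?thesis
    unfolding eq by (rule sets.countable_Union[OF c])
qed

declare emeasure_completion [simp del]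

text \<open>
  This is how a bound on every maximal cell is transferred to their union. Each side has its own constant
  because neither \<open>b\<close> nor \<open>c\<close> need be invertible in \<^typ>\<open>ennreal\<close>.
\<close>

lemma emeasure_Union_le:
  assumes \<M>: "countable \<M>" "disjoint \<M>" "\<M> \<subseteq> sets M" and sets: "sets N = sets M"
    and A: "A \<in> sets M" and le: "\<And>D. D \<in> \<M> \<Longrightarrow> b * emeasure M (A \<inter> D) \<le> c * emeasure N D"
  shows "b * emeasure M (A \<inter> \<Union>\<M>) \<le> c * emeasure N (\<Union>\<M>)"
proof -
  have disj: "disjoint_family_on (\<lambda>D. D) \<M>" "disjoint_family_on (\<lambda>D. A \<inter> D) \<M>"
    using \<M>(2) by (auto simp: disjoint_family_on_def disjoint_def)
  have "emeasure M (A \<inter> \<Union>\<M>) = emeasure M (\<Union>D\<in>\<M>. A \<inter> D)"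
    by (rule arg_cong[of _ _ "emeasure M"]) blast
  also have "\<dots> = (\<integral>\<^sup>+D. emeasure M (A \<inter> D) \<partial>count_space \<M>)"
    using \<M> A by (intro emeasure_UN_countable disj) auto
  finally have "b * emeasure M (A \<inter> \<Union>\<M>) = (\<integral>\<^sup>+D. b * emeasure M (A \<inter> D) \<partial>count_space \<M>)"
    by (simp add: nn_integral_cmult)
  also have "\<dots> \<le> (\<integral>\<^sup>+D. c * emeasure N D \<partial>count_space \<M>)"
    using le by (intro nn_integral_mono) auto
  also have "\<dots> = c * (\<integral>\<^sup>+D. emeasure N D \<partial>count_space \<M>)"
    by (rule nn_integral_cmult) simp
  also have "(\<integral>\<^sup>+D. emeasure N D \<partial>count_space \<M>) = emeasure N (\<Union>D\<in>\<M>. D)"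
    using \<M> sets by (intro emeasure_UN_countable[symmetric] disj) auto
  finally show ?thesis by simp
qed

section \<open>Level sets of dyadic averages\<close>

text \<open>
  The weak type \<open>(1, 1)\<close> inequality of the dyadic maximal operator of \<open>\<nu>\<close>: the maximal cells inside \<open>M\<close>
  whose average exceeds \<open>c\<close> are disjoint, so their measures add up to at most \<open>\<nu> M\<close>.
\<close>

lemma weak_type:
  fixes a :: "real ^ 'n"
  assumes l: "0 < l" and \<nu>: "sets \<nu> = sets lebesgue"
    and M: "M \<in> sets lebesgue"
  shows "c * emeasure lebesgue {x. \<exists>j. cell a l j x \<subseteq> M \<and>
      c * emeasure lebesgue (cell a l j x) < emeasure \<nu> (cell a l j x)} \<le> emeasure \<nu> M"
proof -
  define S where "S D \<longleftrightarrow> D \<subseteq> M \<and> c * emeasure lebesgue D < emeasure \<nu> D" for D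
  obtain \<M> where \<M>: "countable \<M>" "disjoint \<M>" "\<Union>\<M> = {x. \<exists>j. S (cell a l j x)}"
    and \<M>D: "\<forall>M\<in>\<M>. \<exists>x j. M = cell a l j x \<and> S M \<and> (\<forall>i<j. \<not> S (cell a l i x))"
    by (rule maximal_cells[OF l, where a = a and S = S])
  have sets: "\<M> \<subseteq> sets lebesgue"
    by (rule subsetI, drule bspec[OF \<M>D]) (use l in auto)
  have "c * emeasure lebesgue (UNIV \<inter> \<Union>\<M>) \<le> 1 * emeasure \<nu> (\<Union>\<M>)"
  proof (rule emeasure_Union_le[OF \<M>(1,2) sets \<nu>])
    fix D assume "D \<in> \<M>"
    then show "c * emeasure lebesgue (UNIV \<inter> D) \<le> 1 * emeasure \<nu> D"
      using \<M>D by (auto simp: S_def)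
  qed simp
  also have "\<dots> \<le> emeasure \<nu> M"
    using M \<nu> \<M>D by (auto simp: S_def intro!: emeasure_mono)
  finally show ?thesis
    using \<M>(3) by (simp add: S_def)
qed

locale weight =
  fixes W :: "real ^ 'n \<Rightarrow> real"
  assumes W_measurable [measurable]: "W \<in> borel_measurable lebesgue"
    and W_pos: "\<And>x. 0 < W x"
begin

definition mass :: "(real ^ 'n) measure"
  where "mass = density lebesgue (\<lambda>x. ennreal (W x))"

lemma sets_mass [simp, measurable_cong]: "sets mass = sets lebesgue"
  by (simp add: mass_def)

lemma mass_eq: "A \<in> sets lebesgue \<Longrightarrow> emeasure mass A = (\<integral>\<^sup>+x\<in>A. ennreal (W x) \<partial>lebesgue)"
  by (simp add: mass_def emeasure_density)

lemma mass_pos: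
  assumes "A \<in> sets lebesgue" "emeasure lebesgue A \<noteq> 0"
  shows "emeasure mass A \<noteq> 0"
proof
  assume "emeasure mass A = 0"
  then have "AE x in lebesgue. ennreal (W x) * indicator A x = 0"
    using assms by (subst (asm) mass_eq) (simp_all add: nn_integral_0_iff_AE)
  then have "AE x in lebesgue. x \<notin> A"
    by (rule AE_mp) (rule AE_I2, auto simp: indicator_def ennreal_eq_0_iff not_le[THEN iffD2, OF W_pos] split: if_splits)
  then show False
    using assms AE_iff_measurable[of A lebesgue "\<lambda>x. x \<notin> A"] by auto
qed

text \<open>
  This replaces Lebesgue's differentiation theorem. The points of \<open>G\<close> where \<open>W > c\<close> lie in an open set of
  hardly larger measure. That set contains disjoint cells that cover those points and have average at
  most \<open>c\<close>, so the mean of \<open>W\<close> over those points is at most \<open>c\<close> as well, which forces them to be a null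
  set.
\<close>

lemma AE_le_of_cell_average_le:
  assumes l: "0 < l" and c: "0 \<le> c" and G: "G \<in> sets lebesgue" "emeasure lebesgue G < \<infinity>"
    and le: "\<And>x j. x \<in> G \<Longrightarrow> emeasure mass (cell a l j x) \<le> ennreal c * emeasure lebesgue (cell a l j x)"
  shows "AE x in lebesgue. x \<in> G \<longrightarrow> W x \<le> c"
proof -
  define A where "A = {x \<in> space lebesgue. x \<in> G \<and> c < W x}"
  have A [measurable]: "A \<in> sets lebesgue"
    unfolding A_def using G by measurable
  have finA: "emeasure lebesgue A < \<infinity>"
    using G emeasure_mono[of A G lebesgue] by (auto simp: A_def intro: le_less_trans)
  have approx: "emeasure mass A \<le> ennreal c * emeasure lebesgue A + ennreal e" if e: "0 < e" for e
  proof -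
    define d where "d = e / (c + 1)"
    have d: "0 < d" "c * d \<le> e"
      using e c by (auto simp: d_def field_simps)
    obtain T where T: "open T" "A \<subseteq> T" "T - A \<in> lmeasurable" "emeasure lebesgue (T - A) < ennreal d"
      using sets_lebesgue_outer_open[OF A d(1)] by blast
    have Ts: "T \<in> sets lebesgue"
      using T(1) by (intro sets_completionI_sets) simp
    define S where "S D \<longleftrightarrow> D \<subseteq> T \<and> D \<inter> A \<noteq> {}" for D
    obtain \<M> where \<M>: "countable \<M>" "disjoint \<M>" "\<Union>\<M> = {x. \<exists>j. S (cell a l j x)}"
      and \<M>D: "\<forall>M\<in>\<M>. \<exists>x j. M = cell a l j x \<and> S M \<and> (\<forall>i<j. \<not> S (cell a l i x))"
      by (rule maximal_cells[OF l, where a = a and S = S])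
    have sets: "\<M> \<subseteq> sets mass"
      by (rule subsetI, drule bspec[OF \<M>D]) (use l in auto)
    have "A \<subseteq> \<Union>\<M>"
    proof
      fix x assume x: "x \<in> A"
      then obtain j where "cell a l j x \<subseteq> T"
        using cell_subset_open[OF l T(1)] T(2) by blast
      then have "S (cell a l j x)"
        using x mem_cell_self unfolding S_def by blast
      then show "x \<in> \<Union>\<M>"
        unfolding \<M>(3) by blast
    qed
    then have "emeasure mass A = 1 * emeasure mass (A \<inter> \<Union>\<M>)"
      by (simp add: Int_absorb2)
    also have "\<dots> \<le> ennreal c * emeasure lebesgue (\<Union>\<M>)"
    proof (rule emeasure_Union_le[OF \<M>(1,2) sets])
      fix D assume "D \<in> \<M>"
      from bspec[OF \<M>D this] obtain x j where D: "D = cell a l j x" "S D"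
        by blast
      then obtain y where y: "y \<in> D" "y \<in> A"
        by (auto simp: S_def)
      then have Dy: "D = cell a l j y"
        using D(1) cell_eq by metis
      have "emeasure mass (A \<inter> D) \<le> emeasure mass D"
        unfolding Dy by (intro emeasure_mono) (auto simp: l)
      also have "\<dots> \<le> ennreal c * emeasure lebesgue D"
        unfolding Dy using y(2) by (intro le) (auto simp: A_def)
      finally show "1 * emeasure mass (A \<inter> D) \<le> ennreal c * emeasure lebesgue D"
        by simp
    qed simp_all
    also have "\<dots> \<le> ennreal c * emeasure lebesgue (A \<union> (T - A))"
    proof (intro mult_left_mono emeasure_mono)
      show "\<Union>\<M> \<subseteq> A \<union> (T - A)"
        unfolding \<M>(3) S_def using mem_cell_self by fastforce
    qed (use sets.Un[OF A Ts] in \<open>simp_all\<close>)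
    also have "\<dots> \<le> ennreal c * (emeasure lebesgue A + emeasure lebesgue (T - A))"
      using T(3) by (intro mult_left_mono emeasure_subadditive) auto
    also have "\<dots> \<le> ennreal c * (emeasure lebesgue A + ennreal d)"
      using T(4) by (intro mult_left_mono add_left_mono) auto
    also have "\<dots> = ennreal c * emeasure lebesgue A + ennreal (c * d)"
      using c d by (simp add: distrib_left ennreal_mult)
    also have "\<dots> \<le> ennreal c * emeasure lebesgue A + ennreal e"
      using d by (intro add_left_mono ennreal_leI)
    finally show ?thesis .
  qed
  have massA: "emeasure mass A \<le> ennreal c * emeasure lebesgue A"
    by (rule ennreal_le_epsilon) (rule approx)
  have "(\<integral>\<^sup>+x\<in>A. ennreal (W x - c) \<partial>lebesgue) + ennreal c * emeasure lebesgue A =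
      (\<integral>\<^sup>+x. ennreal (W x - c) * indicator A x + ennreal c * indicator A x \<partial>lebesgue)"
    by (subst nn_integral_add) (auto simp: nn_integral_cmult_indicator)
  also have "\<dots> = emeasure mass A"
    unfolding mass_eq[OF A]
    by (rule nn_integral_cong)
      (use c in \<open>auto simp: indicator_def A_def ennreal_plus[symmetric] simp del: ennreal_plus\<close>)
  finally have "ennreal c * emeasure lebesgue A + (\<integral>\<^sup>+x\<in>A. ennreal (W x - c) \<partial>lebesgue)
      \<le> ennreal c * emeasure lebesgue A + 0"
    using massA by (simp add: add.commute)
  moreover have "ennreal c * emeasure lebesgue A \<noteq> \<infinity>"
    using finA by (simp add: ennreal_mult_eq_top_iff)
  ultimately have "(\<integral>\<^sup>+x\<in>A. ennreal (W x - c) \<partial>lebesgue) = 0"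
    by (simp only: ennreal_add_left_cancel_le) simp
  then have "AE x in lebesgue. ennreal (W x - c) * indicator A x = 0"
    by (subst (asm) nn_integral_0_iff_AE) simp_all
  then show ?thesis
    by (rule AE_mp) (rule AE_I2, auto simp: A_def indicator_def ennreal_eq_0_iff split: if_splits)
qed

end

text \<open>
  The \<open>A\<^sub>\<infinity>\<close> condition in its weakest form, with a single threshold for the relative volume.
\<close>

locale fat_weight = weight W for W :: "real ^ 'n \<Rightarrow> real" +
  fixes \<epsilon> :: real
  assumes mass_finite: "\<And>a l. 0 < l \<Longrightarrow> emeasure mass (cube a l) < \<infinity>"
    and \<epsilon>: "0 < \<epsilon>" "\<epsilon> < 1"
    and fat: "\<And>a l E. 0 < l \<Longrightarrow> E \<in> sets lebesgue \<Longrightarrow> E \<subseteq> cube a l \<Longrightarrow>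
      ennreal (l ^ CARD('n) / 2) \<le> emeasure lebesgue E \<Longrightarrow>
      ennreal \<epsilon> * emeasure mass (cube a l) \<le> emeasure mass E"
begin

text \<open>
  The geometric scale of thresholds at which the weight is cut. It starts at the average over the base
  cell. The ratio \<open>2\<^sup>n\<^sup>+\<^sup>1\<close> exceeds by a factor \<open>2\<close> what one step of subdivision can add to an average.
\<close>

definition level :: "real ^ 'n \<Rightarrow> real \<Rightarrow> nat \<Rightarrow> real"
  where "level a l k = (2 ^ Suc CARD('n)) ^ k * (measure mass (cell a l 0 a) / l ^ CARD('n))"

definition selected :: "real ^ 'n \<Rightarrow> real \<Rightarrow> nat \<Rightarrow> (real ^ 'n) set \<Rightarrow> bool"
  where "selected a l k D \<longleftrightarrow>
    D \<subseteq> cell a l 0 a \<and> ennreal (level a l k) * emeasure lebesgue D < emeasure mass D"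

definition high :: "real ^ 'n \<Rightarrow> real \<Rightarrow> nat \<Rightarrow> (real ^ 'n) set"
  where "high a l k = {x. \<exists>j. selected a l k (cell a l j x)}"

lemma cell_finite: "0 < l \<Longrightarrow> emeasure mass (cell a l j x) < \<infinity>"
proof -
  assume l: "0 < l"
  obtain c where "cell a l j x \<subseteq> cube c (l / 2 ^ j)"
    by (rule cell_cube[OF l])
  then show ?thesis
    using mass_finite[of "l / 2 ^ j" c] l emeasure_mono[of "cell a l j x" "cube c (l / 2 ^ j)" mass]
    by (auto intro: le_less_trans)
qed

lemma mass_cell: "0 < l \<Longrightarrow> emeasure mass (cell a l j x) = ennreal (measure mass (cell a l j x))"
  using cell_finite[of l a j x] by (intro emeasure_eq_ennreal_measure) auto

lemma level_pos: "0 < l \<Longrightarrow> 0 < level a l k"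
proof -
  assume l: "0 < l"
  have "emeasure mass (cell a l 0 a) \<noteq> 0"
    using l by (intro mass_pos) (simp_all add: emeasure_cell)
  then have "0 < measure mass (cell a l 0 a)"
    using cell_finite[OF l, of a 0 a] by (simp add: measure_def enn2real_positive_iff zero_less_iff_neq_zero)
  then show ?thesis
    using l by (simp add: level_def)
qed

text \<open>
  The Calderon--Zygmund cells. The base cell itself is never selected, since its average does not exceed
  any level; hence a maximal cell has an unselected parent, which bounds its average by \<open>2\<^sup>n\<close> times the
  level.
\<close>

lemma high_maximal_cells:
  assumes l: "0 < l"
  obtains \<M> where "countable \<M>" and "disjoint \<M>" and "\<Union>\<M> = high a l k" and "\<M> \<subseteq> sets lebesgue"
    and "\<forall>M\<in>\<M>. \<exists>x j. M = cell a l j x \<and> M \<subseteq> cell a l 0 a \<and>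
      emeasure mass M \<le> ennreal (2 ^ CARD('n) * level a l k) * emeasure lebesgue M \<and>
      (\<forall>i<j. \<not> selected a l k (cell a l i x))"
proof -
  let ?S = "selected a l k"
  obtain \<M> where \<M>: "countable \<M>" "disjoint \<M>" "\<Union>\<M> = {x. \<exists>j. ?S (cell a l j x)}"
    and \<M>D: "\<forall>M\<in>\<M>. \<exists>x j. M = cell a l j x \<and> ?S M \<and> (\<forall>i<j. \<not> ?S (cell a l i x))"
    by (rule maximal_cells[OF l, where a = a and S = ?S])
  show ?thesis
  proof (rule that[of \<M>])
    show "\<Union>\<M> = high a l k"
      using \<M>(3) by (simp add: high_def)
    show "\<M> \<subseteq> sets lebesgue"
      by (rule subsetI, drule bspec[OF \<M>D]) (use l in auto)
    show "\<forall>M\<in>\<M>. \<exists>x j. M = cell a l j x \<and> M \<subseteq> cell a l 0 a \<and>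
      emeasure mass M \<le> ennreal (2 ^ CARD('n) * level a l k) * emeasure lebesgue M \<and>
      (\<forall>i<j. \<not> selected a l k (cell a l i x))"
    proof
      fix M assume "M \<in> \<M>"
      from bspec[OF \<M>D this] obtain x j where M: "M = cell a l j x" "?S M" "\<forall>i<j. \<not> ?S (cell a l i x)"
        by blast
      have "x \<in> cell a l 0 a"
        using M(1,2) mem_cell_self unfolding selected_def by blast
      then have Q: "cell a l 0 x = cell a l 0 a"
        by (rule cell_eq)
      have "j \<noteq> 0"
      proof
        assume "j = 0"
        then have "ennreal (level a l k) * ennreal (l ^ CARD('n)) < emeasure mass (cell a l 0 a)"
          using M(1,2) l Q by (simp add: selected_def emeasure_cell)
        also have "\<dots> = ennreal (measure mass (cell a l 0 a))"
          by (rule mass_cell[OF l])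
        finally have "level a l k * l ^ CARD('n) < measure mass (cell a l 0 a)"
          using l level_pos[OF l, of a k] by (simp add: ennreal_mult[symmetric] ennreal_less_iff less_imp_le)
        moreover have "level a l k * l ^ CARD('n) = (2 ^ Suc CARD('n)) ^ k * measure mass (cell a l 0 a)"
          using l by (simp add: level_def)
        moreover have "1 * measure mass (cell a l 0 a) \<le> (2 ^ Suc CARD('n)) ^ k * measure mass (cell a l 0 a)"
          by (intro mult_right_mono one_le_power) simp_all
        ultimately show False by linarith
      qed
      then obtain i where i: "j = Suc i"
        by (cases j) auto
      have "\<not> ?S (cell a l i x)"
        using M(3) i by simp
      moreover have "cell a l i x \<subseteq> cell a l 0 a"
        using cell_mono[of 0 i a l x] Q by simp
      ultimately have "emeasure mass (cell a l i x) \<le> ennreal (level a l k) * emeasure lebesgue (cell a l i x)"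
        by (simp add: selected_def)
      moreover have "emeasure mass M \<le> emeasure mass (cell a l i x)"
        unfolding M(1) i using l by (intro emeasure_mono cell_Suc_subset) simp
      moreover have "ennreal (level a l k) * emeasure lebesgue (cell a l i x)
          = ennreal (2 ^ CARD('n) * level a l k) * emeasure lebesgue M"
        unfolding M(1) i using l level_pos[OF l, of a k]
        by (simp add: emeasure_cell ennreal_mult[symmetric] power_divide power_mult_distrib)
      ultimately have "emeasure mass M \<le> ennreal (2 ^ CARD('n) * level a l k) * emeasure lebesgue M"
        by simp
      then show "\<exists>x j. M = cell a l j x \<and> M \<subseteq> cell a l 0 a \<and>
        emeasure mass M \<le> ennreal (2 ^ CARD('n) * level a l k) * emeasure lebesgue M \<and>
        (\<forall>i<j. \<not> selected a l k (cell a l i x))"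
        using M unfolding selected_def by blast
    qed
  qed (use \<M> in auto)
qed

lemma high_lebesgue [measurable]: "0 < l \<Longrightarrow> high a l k \<in> sets lebesgue"
  unfolding high_def by (rule Collect_cell_lebesgue)

lemma level_Suc: "level a l (Suc k) = 2 ^ Suc CARD('n) * level a l k"
  by (simp add: level_def)

lemma level_le_Suc: "0 < l \<Longrightarrow> level a l k \<le> level a l (Suc k)"
  unfolding level_Suc using level_pos[of l a k] one_le_power[of "2 :: real" "Suc CARD('n)"]
    mult_right_mono[of 1 "2 ^ Suc CARD('n)" "level a l k"]
  by (simp del: power_Suc)

lemma selected_Suc:
  assumes l: "0 < l" and D: "selected a l (Suc k) D"
  shows "selected a l k D"
proof -
  have "ennreal (level a l k) * emeasure lebesgue D \<le> ennreal (level a l (Suc k)) * emeasure lebesgue D"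
    using level_le_Suc[OF l] by (intro mult_right_mono ennreal_leI) simp_all
  then show ?thesis
    using D unfolding selected_def by (meson le_less_trans)
qed

lemma high_Suc_subset: "0 < l \<Longrightarrow> high a l (Suc k) \<subseteq> high a l k"
  unfolding high_def using selected_Suc by blast

text \<open>
  A maximal cell \<open>M\<close> of one level has average at most \<open>2\<^sup>n\<close> times that level, since its parent was
  not selected; as the levels grow by \<open>2\<^sup>n\<^sup>+\<^sup>1\<close>, the next level set fills at most half of \<open>M\<close>.
\<close>

lemma mass_high_Suc:
  fixes a :: "real ^ 'n"
  assumes l: "0 < l"
  shows "emeasure mass (high a l (Suc k)) \<le> ennreal (1 - \<epsilon>) * emeasure mass (high a l k)"
proof -
  obtain \<M> where \<M>: "countable \<M>" "disjoint \<M>" "\<Union>\<M> = high a l k" "\<M> \<subseteq> sets lebesgue"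
    and \<M>D: "\<forall>M\<in>\<M>. \<exists>x j. M = cell a l j x \<and> M \<subseteq> cell a l 0 a \<and>
      emeasure mass M \<le> ennreal (2 ^ CARD('n) * level a l k) * emeasure lebesgue M \<and>
      (\<forall>i<j. \<not> selected a l k (cell a l i x))"
    by (rule high_maximal_cells[OF l, of a k])
  let ?H = "high a l (Suc k)"
  have H: "?H \<in> sets lebesgue"
    using l by (rule high_lebesgue)
  have "1 * emeasure mass (?H \<inter> \<Union>\<M>) \<le> ennreal (1 - \<epsilon>) * emeasure mass (\<Union>\<M>)"
  proof (rule emeasure_Union_le[OF \<M>(1,2)])
    fix M assume "M \<in> \<M>"
    from bspec[OF \<M>D this] obtain x j where M: "M = cell a l j x" "M \<subseteq> cell a l 0 a"
      and up: "emeasure mass M \<le> ennreal (2 ^ CARD('n) * level a l k) * emeasure lebesgue M"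
      and max: "\<forall>i<j. \<not> selected a l k (cell a l i x)"
      by blast
    have Ms: "M \<in> sets lebesgue"
      using M l by simp
    define h where "h = l / 2 ^ j"
    have h: "0 < h" using l by (simp add: h_def)
    have volM: "emeasure lebesgue M = ennreal (h ^ CARD('n))"
      using M l by (simp add: emeasure_cell h_def)
    define Z where "Z = {y. \<exists>j. cell a l j y \<subseteq> M \<and>
      ennreal (level a l (Suc k)) * emeasure lebesgue (cell a l j y) < emeasure mass (cell a l j y)}"
    have HZ: "?H \<inter> M \<subseteq> Z"
    proof
      fix y assume y: "y \<in> ?H \<inter> M"
      then obtain i where i: "selected a l (Suc k) (cell a l i y)"
        by (auto simp: high_def)
      have My: "M = cell a l j y"
        using y M cell_eq by blast
      have "j \<le> i"
      proof (rule ccontr)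
        assume "\<not> j \<le> i"
        then have "i < j" by simp
        have "cell a l i y = cell a l i x"
          using y M(1) cell_mono[of i j a l x] \<open>i < j\<close> by (intro cell_eq) auto
        then show False
          using max \<open>i < j\<close> selected_Suc[OF l i] by simp
      qed
      then have "cell a l i y \<subseteq> M"
        unfolding My by (rule cell_mono)
      then show "y \<in> Z"
        using i unfolding Z_def selected_def by blast
    qed
    have Zle: "ennreal (level a l (Suc k)) * emeasure lebesgue Z \<le> emeasure mass M"
      unfolding Z_def by (rule weak_type[OF l _ Ms]) simp
    have "emeasure lebesgue (?H \<inter> M) \<le> ennreal (h ^ CARD('n) / 2)"
    proof (cases "emeasure lebesgue (?H \<inter> M)")
      case (real z)
      have "ennreal (level a l (Suc k)) * emeasure lebesgue (?H \<inter> M) \<le> ennreal (level a l (Suc k)) * emeasure lebesgue Z"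
        using HZ Collect_cell_lebesgue[OF l, of "\<lambda>D. D \<subseteq> M \<and>
            ennreal (level a l (Suc k)) * emeasure lebesgue D < emeasure mass D" a]
        by (intro mult_left_mono emeasure_mono) (simp_all add: Z_def)
      then have "ennreal (level a l (Suc k)) * ennreal z \<le> ennreal (2 ^ CARD('n) * level a l k) * ennreal (h ^ CARD('n))"
        using Zle up volM real by (metis order_trans)
      then have "2 ^ Suc CARD('n) * level a l k * z \<le> 2 ^ CARD('n) * level a l k * h ^ CARD('n)"
        using real h level_pos[OF l, of a k]
        by (simp add: level_Suc ennreal_mult[symmetric] less_imp_le del: power_Suc)
      then have "2 * z \<le> h ^ CARD('n)"
        using level_pos[OF l, of a k] by (simp add: mult.assoc mult.left_commute[of 2])
      then show ?thesis
        using real by (simp add: ennreal_leI)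
    next
      case top
      then have "emeasure lebesgue M = top"
        using Ms emeasure_mono[of "?H \<inter> M" M lebesgue] by (simp add: top_unique)
      then show ?thesis
        using volM by simp
    qed
    then have "ennreal (h ^ CARD('n)) - ennreal (h ^ CARD('n) / 2) \<le> emeasure lebesgue M - emeasure lebesgue (?H \<inter> M)"
      unfolding volM by (rule ennreal_mono_minus)
    also have "\<dots> = emeasure lebesgue (M - ?H \<inter> M)"
    proof (rule emeasure_Diff[symmetric])
      show "emeasure lebesgue (?H \<inter> M) \<noteq> \<infinity>"
        using \<open>emeasure lebesgue (?H \<inter> M) \<le> _\<close> by (auto simp: top_unique)
    qed (use Ms H in auto)
    finally have half: "ennreal (h ^ CARD('n) / 2) \<le> emeasure lebesgue (M - ?H \<inter> M)"
      using h by (simp add: ennreal_minus)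
    obtain c where c: "M \<subseteq> cube c h"
      unfolding M(1) h_def by (rule cell_cube[OF l])
    have "ennreal \<epsilon> * emeasure mass M \<le> ennreal \<epsilon> * emeasure mass (cube c h)"
      using c by (intro mult_left_mono emeasure_mono) auto
    also have "\<dots> \<le> emeasure mass (M - ?H \<inter> M)"
      using h Ms H half c by (intro fat) auto
    finally have fatM: "ennreal \<epsilon> * emeasure mass M \<le> emeasure mass (M - ?H \<inter> M)" .
    have finM: "emeasure mass M \<noteq> \<infinity>"
      using cell_finite[OF l, of a j x] M(1) by simp
    have sum: "emeasure mass M = emeasure mass (M - ?H \<inter> M) + emeasure mass (?H \<inter> M)"
      using Ms H by (subst plus_emeasure) (auto simp: Un_commute Un_Diff_Int intro!: arg_cong[of _ _ "emeasure mass"])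
    obtain m where m: "emeasure mass M = ennreal m" "0 \<le> m"
      using finM by (cases "emeasure mass M") auto
    obtain m1 where m1: "emeasure mass (M - ?H \<inter> M) = ennreal m1" "0 \<le> m1"
      using sum finM by (cases "emeasure mass (M - ?H \<inter> M)") auto
    obtain m2 where m2: "emeasure mass (?H \<inter> M) = ennreal m2" "0 \<le> m2"
      using sum finM by (cases "emeasure mass (?H \<inter> M)") auto
    have "m = m1 + m2"
      using sum m m1 m2 by (simp add: ennreal_plus[symmetric] del: ennreal_plus)
    moreover have "\<epsilon> * m \<le> m1"
      using fatM m m1 \<epsilon> by (simp add: ennreal_mult[symmetric])
    ultimately have "m2 \<le> (1 - \<epsilon>) * m"
      by (simp add: algebra_simps)
    then show "1 * emeasure mass (?H \<inter> M) \<le> ennreal (1 - \<epsilon>) * emeasure mass M"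
      using m m2 \<epsilon> by (simp add: ennreal_mult[symmetric] ennreal_leI)
  qed (use \<M> H in auto)
  moreover have "?H \<inter> \<Union>\<M> = ?H"
    using high_Suc_subset[OF l] \<M>(3) by blast
  ultimately show ?thesis
    using \<M>(3) by simp
qed

end

section \<open>The reverse Hoelder inequality for \<open>A\<^sub>\<infinity>\<close> weights\<close>

lemma cube_minus_cell_null:
  assumes "0 < l"
  shows "cell a l 0 a \<subseteq> cube a l" and "cube a l - cell a l 0 a \<in> null_sets lebesgue"
proof -
  obtain c where c: "c = (\<chi> i. a $ i + \<lfloor>2 ^ 0 * ((a $ i - a $ i) / l)\<rfloor> * (l / 2 ^ 0))"
    "cell a l 0 a \<subseteq> cube c (l / 2 ^ 0)" "cell a l 0 a \<in> sets lebesgue"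
    "emeasure lebesgue (cube c (l / 2 ^ 0) - cell a l 0 a) = 0"
    by (rule cell_cube[OF assms])
  have "c = a"
    using c(1) by (simp add: vec_eq_iff)
  then show "cell a l 0 a \<subseteq> cube a l" "cube a l - cell a l 0 a \<in> null_sets lebesgue"
    using c by (auto intro!: null_setsI)
qed

lemma set_nn_integral_cube_eq_cell:
  assumes l: "0 < l"
  shows "(\<integral>\<^sup>+x\<in>cube a l. f x \<partial>lebesgue) = (\<integral>\<^sup>+x\<in>cell a l 0 a. f x \<partial>lebesgue)"
proof (rule nn_integral_null_delta)
  have "(cube a l - cell a l 0 a) \<union> (cell a l 0 a - cube a l) = cube a l - cell a l 0 a"
    using cube_minus_cell_null(1)[OF l, of a] by blast
  then show "cube a l - cell a l 0 a \<union> (cell a l 0 a - cube a l) \<in> null_sets lebesgue"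
    using cube_minus_cell_null(2)[OF l, of a] by simp
qed (simp_all add: l)

context fat_weight
begin

lemma mass_high_le:
  assumes l: "0 < l"
  shows "emeasure mass (high a l k) \<le> ennreal ((1 - \<epsilon>) ^ k * measure mass (cell a l 0 a))"
proof (induction k)
  case 0
  have "emeasure mass (high a l 0) \<le> emeasure mass (cell a l 0 a)"
  proof (rule emeasure_mono)
    show "high a l 0 \<subseteq> cell a l 0 a"
      unfolding high_def selected_def using mem_cell_self by blast
  qed (use l in simp)
  also have "\<dots> = ennreal (measure mass (cell a l 0 a))"
    by (rule mass_cell[OF l])
  finally show ?case by simp
next
  case (Suc k)
  have "emeasure mass (high a l (Suc k)) \<le> ennreal (1 - \<epsilon>) * emeasure mass (high a l k)"
    by (rule mass_high_Suc[OF l])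
  also have "\<dots> \<le> ennreal (1 - \<epsilon>) * ennreal ((1 - \<epsilon>) ^ k * measure mass (cell a l 0 a))"
    by (intro mult_left_mono Suc) simp
  also have "\<dots> = ennreal ((1 - \<epsilon>) ^ Suc k * measure mass (cell a l 0 a))"
    using \<epsilon> by (simp add: ennreal_mult[symmetric] mult.assoc)
  finally show ?case .
qed

lemma AE_not_all_high:
  assumes l: "0 < l"
  shows "AE x in lebesgue. \<exists>k. x \<notin> high a l k"
proof -
  define I where "I = (\<Inter>k. high a l k)"
  have I: "I \<in> sets lebesgue"
    unfolding I_def using l by (intro sets.countable_INT) auto
  have "(\<lambda>k. ennreal ((1 - \<epsilon>) ^ k * measure mass (cell a l 0 a))) \<longlonglongrightarrow> ennreal (0 * measure mass (cell a l 0 a))"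
    using \<epsilon> by (intro tendsto_ennrealI tendsto_mult LIMSEQ_power_zero tendsto_const) simp
  moreover have "emeasure mass I \<le> ennreal ((1 - \<epsilon>) ^ k * measure mass (cell a l 0 a))" for k
    using mass_high_le[OF l, of a k] emeasure_mono[of I "high a l k" mass] l
    by (auto simp: I_def intro: order_trans)
  ultimately have "emeasure mass I \<le> ennreal (0 * measure mass (cell a l 0 a))"
    by (intro LIMSEQ_le_const) auto
  then have "emeasure lebesgue I = 0"
    using mass_pos[OF I] by auto
  then have "I \<in> null_sets lebesgue"
    using I by (intro null_setsI)
  then have "AE x in lebesgue. x \<notin> I"
    by (rule AE_not_in)
  then show ?thesis
    by (simp add: I_def)
qed

lemma AE_le_level:
  assumes l: "0 < l"
  shows "AE x in lebesgue. x \<in> cell a l 0 a - high a l k \<longrightarrow> W x \<le> level a l k"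
proof (rule AE_le_of_cell_average_le[OF l])
  show "0 \<le> level a l k"
    using level_pos[OF l] by (rule less_imp_le)
  show "emeasure lebesgue (cell a l 0 a - high a l k) < \<infinity>"
    using l emeasure_mono[of "cell a l 0 a - high a l k" "cell a l 0 a" lebesgue]
    by (auto simp: emeasure_cell intro: le_less_trans)
  fix x j assume x: "x \<in> cell a l 0 a - high a l k"
  then have "cell a l 0 x = cell a l 0 a"
    by (intro cell_eq) simp
  then have "cell a l j x \<subseteq> cell a l 0 a"
    using cell_mono[of 0 j a l x] by simp
  then show "emeasure mass (cell a l j x) \<le> ennreal (level a l k) * emeasure lebesgue (cell a l j x)"
    using x unfolding high_def selected_def by (auto simp: not_less)
qed (use l in simp)

text \<open>
  If \<open>k\<close> is the first level that is not high at \<open>x\<close>, then \<open>W x\<close> is at most \<open>level a l k\<close>, and either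
  \<open>k = 0\<close> or \<open>x\<close> lies in the previous high set; so one summand on the right dominates.
\<close>

lemma AE_powr_le:
  assumes l: "0 < l" and \<delta>: "0 \<le> \<delta>"
  shows "AE x in lebesgue. ennreal (W x powr (1 + \<delta>)) * indicator (cell a l 0 a) x \<le>
    ennreal (level a l 0 powr \<delta>) * (ennreal (W x) * indicator (cell a l 0 a) x) +
    (\<Sum>k. ennreal (level a l (Suc k) powr \<delta>) * (ennreal (W x) * indicator (high a l k) x))"
    (is "AE x in _. ?L x \<le> ?A x + (\<Sum>k. ?B k x)")
proof -
  have "AE x in lebesgue. \<forall>k. x \<in> cell a l 0 a - high a l k \<longrightarrow> W x \<le> level a l k"
    unfolding AE_all_countable using AE_le_level[OF l] by blast
  with AE_not_all_high[OF l, of a] show ?thesis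
  proof eventually_elim
    case (elim x)
    show ?case
    proof (cases "x \<in> cell a l 0 a")
      case True
      define k where "k = (LEAST k. x \<notin> high a l k)"
      have k: "x \<notin> high a l k"
        using elim(1) unfolding k_def by (rule LeastI_ex)
      have "W x \<le> level a l k"
        using elim(2) True k by blast
      then have "W x powr (1 + \<delta>) \<le> level a l k powr \<delta> * W x"
        using W_pos[of x] \<delta> by (simp add: powr_add mult.commute powr_mono2)
      then have L: "?L x \<le> ennreal (level a l k powr \<delta>) * ennreal (W x)"
        using True W_pos[of x] by (simp add: ennreal_mult[symmetric] less_imp_le ennreal_leI)
      show ?thesis
      proof (cases k)
        case 0
        then have "?L x \<le> ?A x"
          using L True by simp
        then show ?thesis
          by (simp add: add_increasing2)
      next
        case (Suc i)
        have "x \<in> high a l i"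
          using not_less_Least[of i "\<lambda>k. x \<notin> high a l k"] Suc unfolding k_def by auto
        then have "?L x \<le> ?B i x"
          using L Suc by simp
        also have "\<dots> \<le> (\<Sum>k. ?B k x)"
          using sum_le_suminf[of "\<lambda>k. ?B k x" "{i}"] by simp
        finally show ?thesis
          by (simp add: add_increasing)
      qed
    qed simp
  qed
qed

text \<open>
  Passing to the next level multiplies the threshold, raised to \<open>\<delta>\<close>, by \<open>b\<close> and the mass by at most
  \<open>1 - \<epsilon>\<close>. For \<open>b * (1 - \<epsilon>) < 1\<close> the contributions of the levels form a convergent geometric series.
\<close>

lemma nn_integral_powr_le:
  assumes l: "0 < l" and \<delta>: "0 \<le> \<delta>" and b: "b = (2 ^ Suc CARD('n)) powr \<delta>" "b * (1 - \<epsilon>) < 1"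
  shows "(\<integral>\<^sup>+x\<in>cell a l 0 a. ennreal (W x powr (1 + \<delta>)) \<partial>lebesgue) \<le>
    ennreal ((1 + b / (1 - b * (1 - \<epsilon>))) * (level a l 0 powr \<delta> * measure mass (cell a l 0 a)))"
proof -
  define m where "m = measure mass (cell a l 0 a)"
  have m: "emeasure mass (cell a l 0 a) = ennreal m"
    unfolding m_def by (rule mass_cell[OF l])
  have [measurable]: "high a l k \<in> sets lebesgue" "cell a l 0 a \<in> sets lebesgue" for k
    using l by auto
  have b0: "0 < b" using b(1) by simp
  have lev: "level a l (Suc k) powr \<delta> = b * b ^ k * level a l 0 powr \<delta>" for k
  proof -
    have "level a l (Suc k) = (2 ^ Suc CARD('n)) ^ Suc k * level a l 0"
      by (simp add: level_def)
    then have "level a l (Suc k) powr \<delta> = ((2 ^ Suc CARD('n)) ^ Suc k) powr \<delta> * level a l 0 powr \<delta>"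
      using level_pos[OF l, of a 0] by (simp add: powr_mult del: power_Suc)
    also have "((2 ^ Suc CARD('n)) ^ Suc k :: real) powr \<delta> = b ^ Suc k"
      unfolding b(1) by (simp add: powr_powr powr_realpow[symmetric] mult_ac del: power_Suc)
    finally show ?thesis by simp
  qed
  have "(\<integral>\<^sup>+x\<in>cell a l 0 a. ennreal (W x powr (1 + \<delta>)) \<partial>lebesgue) \<le>
    (\<integral>\<^sup>+x. ennreal (level a l 0 powr \<delta>) * (ennreal (W x) * indicator (cell a l 0 a) x) +
      (\<Sum>k. ennreal (level a l (Suc k) powr \<delta>) * (ennreal (W x) * indicator (high a l k) x)) \<partial>lebesgue)"
    by (rule nn_integral_mono_AE) (rule AE_powr_le[OF l \<delta>])
  also have "\<dots> = ennreal (level a l 0 powr \<delta>) * emeasure mass (cell a l 0 a) +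
      (\<Sum>k. ennreal (level a l (Suc k) powr \<delta>) * emeasure mass (high a l k))"
    by (subst nn_integral_add, measurable)
      (simp add: nn_integral_cmult nn_integral_suminf mass_eq)
  also have "\<dots> \<le> ennreal (level a l 0 powr \<delta>) * ennreal m +
      (\<Sum>k. ennreal (b * b ^ k * level a l 0 powr \<delta>) * ennreal ((1 - \<epsilon>) ^ k * m))"
    unfolding lev m m_def by (intro add_left_mono suminf_le mult_left_mono mass_high_le[OF l]) auto
  also have "(\<Sum>k. ennreal (b * b ^ k * level a l 0 powr \<delta>) * ennreal ((1 - \<epsilon>) ^ k * m))
      = (\<Sum>k. ennreal ((b * level a l 0 powr \<delta> * m) * (b * (1 - \<epsilon>)) ^ k))"
    using b0 \<epsilon> by (intro suminf_cong)
      (simp add: ennreal_mult[symmetric] m_def power_mult_distrib mult_ac)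
  also have "\<dots> = ennreal ((b * level a l 0 powr \<delta> * m) * (1 / (1 - b * (1 - \<epsilon>))))"
    using b0 b(2) \<epsilon>
    by (intro suminf_ennreal_eq sums_mult geometric_sums) (auto simp: m_def intro!: mult_nonneg_nonneg)
  also have "ennreal (level a l 0 powr \<delta>) * ennreal m + \<dots> =
      ennreal ((1 + b / (1 - b * (1 - \<epsilon>))) * (level a l 0 powr \<delta> * m))"
  proof -
    define q where "q = 1 - b * (1 - \<epsilon>)"
    have "level a l 0 powr \<delta> * m + (b * level a l 0 powr \<delta> * m) * (1 / q) =
        (1 + b / q) * (level a l 0 powr \<delta> * m)"
      by (simp add: algebra_simps)
    moreover have "0 < q" "0 \<le> m"
      using b(2) by (simp_all add: q_def m_def)
    ultimately show ?thesis
      unfolding q_def[symmetric] using b0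
      by (simp add: ennreal_mult[symmetric] ennreal_plus[symmetric] del: ennreal_plus)
  qed
  finally show ?thesis
    by (simp add: m_def)
qed

text \<open>
  The constant does not depend on \<open>s\<close>: \<open>b / (1 - b * (1 - \<epsilon>))\<close> increases with \<open>b\<close>, hence with \<open>s\<close>.
\<close>

theorem reverse_Hoelder:
  "\<exists>r>1. \<exists>C>0. \<forall>s\<in>{1..r}. \<forall>a l. 0 < l \<longrightarrow> (\<integral>\<^sup>+x\<in>cube a l. ennreal (W x powr s) \<partial>lebesgue) \<le>
    ennreal (C * (l ^ CARD('n)) powr (1 - s) * measure mass (cube a l) powr s)"
proof -
  define B :: real where "B = 2 ^ Suc CARD('n)"
  have B: "1 < B"
    unfolding B_def by (rule one_less_power) simp_all
  \<comment> \<open>With this choice \<open>b0 * (1 - \<epsilon>)\<close> is the square root of \<open>1 - \<epsilon>\<close>.\<close>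
  define \<delta>0 where "\<delta>0 = - ln (1 - \<epsilon>) / (2 * ln B)"
  define b0 where "b0 = B powr \<delta>0"
  have lneg: "ln (1 - \<epsilon>) < 0"
    using \<epsilon> by (simp add: ln_less_zero)
  then have \<delta>0: "0 < \<delta>0"
    using B unfolding \<delta>0_def by (intro divide_pos_pos) simp_all
  have "b0 = exp (- ln (1 - \<epsilon>) / 2)"
    using B by (simp add: b0_def powr_def \<delta>0_def)
  moreover have "1 - \<epsilon> = exp (ln (1 - \<epsilon>))"
    using \<epsilon> by simp
  ultimately have "b0 * (1 - \<epsilon>) = exp (- ln (1 - \<epsilon>) / 2 + ln (1 - \<epsilon>))"
    by (metis exp_add)
  also have "\<dots> < 1"
    using lneg by simp
  finally have b01: "b0 * (1 - \<epsilon>) < 1" .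
  have b0pos: "0 < b0" using B by (simp add: b0_def)
  define C where "C = 1 + b0 / (1 - b0 * (1 - \<epsilon>))"
  have C: "0 < C"
    using b01 b0pos by (simp add: C_def add_pos_pos)
  show ?thesis
  proof (rule exI[of _ "1 + \<delta>0"], intro conjI, goal_cases)
    case 2
    show ?case
    proof (rule exI[of _ C], intro conjI ballI allI impI)
      fix s l :: real and a :: "real ^ 'n"
      assume s: "s \<in> {1..1 + \<delta>0}" and l: "0 < l"
      define \<delta> where "\<delta> = s - 1"
      have \<delta>: "0 \<le> \<delta>" "\<delta> \<le> \<delta>0" and s_eq: "s = 1 + \<delta>"
        using s by (auto simp: \<delta>_def)
      define b where "b = B powr \<delta>"
      have bb: "b \<le> b0" "0 < b"
        using \<delta> B by (auto simp: b_def b0_def intro: powr_mono)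
      have b1: "b * (1 - \<epsilon>) \<le> b0 * (1 - \<epsilon>)"
        using bb \<epsilon> by (intro mult_right_mono) auto
      define m where "m = measure mass (cell a l 0 a)"
      have m: "0 < m"
        using level_pos[OF l, of a 0] l by (simp add: level_def m_def zero_less_divide_iff)
      have mcube: "measure mass (cube a l) = m"
        unfolding m_def measure_def using l
        by (simp add: mass_eq set_nn_integral_cube_eq_cell)
      have "(\<integral>\<^sup>+x\<in>cube a l. ennreal (W x powr s) \<partial>lebesgue) =
          (\<integral>\<^sup>+x\<in>cell a l 0 a. ennreal (W x powr (1 + \<delta>)) \<partial>lebesgue)"
        unfolding s_eq by (rule set_nn_integral_cube_eq_cell[OF l])
      also have "\<dots> \<le> ennreal ((1 + b / (1 - b * (1 - \<epsilon>))) * (level a l 0 powr \<delta> * m))"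
        unfolding m_def
      proof (rule nn_integral_powr_le[OF l \<delta>(1)])
        show "b * (1 - \<epsilon>) < 1"
          using b1 b01 by linarith
      qed (simp add: b_def B_def)
      also have "\<dots> \<le> ennreal (C * (level a l 0 powr \<delta> * m))"
        unfolding C_def using m bb b1 b01 by (intro ennreal_leI mult_right_mono add_left_mono frac_le) auto
      also have "level a l 0 powr \<delta> * m = (l ^ CARD('n)) powr (1 - s) * m powr s"
      proof -
        have "level a l 0 powr \<delta> = m powr \<delta> / (l ^ CARD('n)) powr \<delta>"
          using m l by (simp add: level_def m_def powr_divide)
        moreover have "(l ^ CARD('n)) powr (1 - s) = 1 / (l ^ CARD('n)) powr \<delta>"
          unfolding s_eq by (simp add: powr_minus divide_inverse)
        moreover have "m powr s = m powr \<delta> * m"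
          unfolding s_eq using m by (simp add: powr_add)
        ultimately show ?thesis by simp
      qed
      finally show "(\<integral>\<^sup>+x\<in>cube a l. ennreal (W x powr s) \<partial>lebesgue) \<le>
          ennreal (C * (l ^ CARD('n)) powr (1 - s) * measure mass (cube a l) powr s)"
        unfolding mcube by (simp add: mult.assoc)
    qed (use C in auto)
  qed (use \<delta>0 in auto)
qed

end

section \<open>Decaying remainders\<close>

lemma one_le_ln_exp_1_add: "0 \<le> r \<Longrightarrow> 1 \<le> ln (exp 1 + r :: real)"
  using ln_mono[of "exp 1" "exp 1 + r"] by (simp add: add_pos_nonneg)

definition ccube :: "real \<Rightarrow> (real ^ 'n) set"
  where "ccube R = cube (\<chi> i. - R) (2 * R)"

lemma mem_ccube: "x \<in> ccube R \<longleftrightarrow> (\<forall>i. \<bar>x $ i\<bar> \<le> R)"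
  by (auto simp: ccube_def mem_cube abs_le_iff) (metis minus_le_iff)+

lemma ccube_mono: "R \<le> R' \<Longrightarrow> ccube R \<subseteq> ccube R'"
  by (rule subsetI) (unfold mem_ccube, meson order_trans)

lemma mem_ccube_norm: "norm x \<le> R \<Longrightarrow> x \<in> ccube R"
  by (auto simp: mem_ccube intro: order_trans[OF component_le_norm_cart])

lemma cube_subset_ccube:
  assumes "x \<in> cube a l"
  shows "cube a l \<subseteq> ccube (l + 1 + norm x)"
proof
  fix y assume y: "y \<in> cube a l"
  show "y \<in> ccube (l + 1 + norm x)"
    unfolding mem_ccube
  proof
    fix i
    have "a $ i \<le> x $ i \<and> x $ i \<le> a $ i + l" "a $ i \<le> y $ i \<and> y $ i \<le> a $ i + l"
      using assms y by (simp_all add: mem_cube)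
    then show "\<bar>y $ i\<bar> \<le> l + 1 + norm x"
      using component_le_norm_cart[of x i] by linarith
  qed
qed

lemma ccube_lebesgue [measurable]: "ccube R \<in> sets lebesgue"
  by (simp add: ccube_def)

lemma emeasure_ccube:
  "0 \<le> R \<Longrightarrow> emeasure lebesgue (ccube R :: (real ^ 'n) set) = ennreal ((2 * R) ^ CARD('n))"
  by (simp add: ccube_def emeasure_cube)

text \<open>
  The remainders that appear when a variable exponent is replaced by its value at infinity.
\<close>

definition decay :: "real \<Rightarrow> real ^ 'n \<Rightarrow> real"
  where "decay N x = (exp 1 + norm x) powr - N"

lemma decay_measurable [measurable]: "decay N \<in> borel_measurable lebesgue"
proof -
  have "decay N \<in> borel_measurable borel"
    unfolding decay_def by measurable
  then show ?thesis
    by (intro measurable_completion) simp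
qed

lemma decay_nonneg [simp]: "0 \<le> decay N x"
  by (simp add: decay_def)

text \<open>
  Where \<open>norm x\<close> lies between \<open>k\<close> and \<open>k + 1\<close>, the factor is at most \<open>(k + 1) powr - (m + 2)\<close> and the integral
  of \<open>f\<close> grows like \<open>k powr m\<close>, so the sum over \<open>k\<close> converges like that of the inverse squares.
\<close>

lemma decay_integral_finite:
  fixes f :: "real ^ 'n \<Rightarrow> ennreal"
  assumes [measurable]: "f \<in> borel_measurable lebesgue" and A: "0 \<le> A" and "0 \<le> m"
    and growth: "\<And>k. 1 \<le> k \<Longrightarrow> (\<integral>\<^sup>+x\<in>ccube (real k). f x \<partial>lebesgue) \<le> ennreal (A * real k powr m)"
  shows "(\<integral>\<^sup>+x. ennreal (decay (m + 2) x) * f x \<partial>lebesgue) < \<infinity>"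
proof -
  have "ennreal (decay (m + 2) x) * f x \<le>
      (\<Sum>k. ennreal (real (Suc k) powr - (m + 2)) * (f x * indicator (ccube (real (Suc k))) x))" for x
  proof -
    define k where "k = nat \<lfloor>norm x\<rfloor>"
    have k: "real k \<le> norm x" "norm x \<le> real (Suc k)"
      unfolding k_def by (auto simp: of_nat_nat) linarith+
    have "(exp 1 + norm x) powr - (m + 2) \<le> real (Suc k) powr - (m + 2)"
      using k exp_ge_add_one_self[of 1] \<open>0 \<le> m\<close> by (intro powr_mono2') auto
    then have "ennreal (decay (m + 2) x) * f x \<le>
        ennreal (real (Suc k) powr - (m + 2)) * (f x * indicator (ccube (real (Suc k))) x)"
      using mem_ccube_norm[OF k(2)] by (auto simp: decay_def intro!: mult_right_mono ennreal_leI)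
    also have "\<dots> \<le> (\<Sum>k. ennreal (real (Suc k) powr - (m + 2)) * (f x * indicator (ccube (real (Suc k))) x))"
      using sum_le_suminf[of "\<lambda>k. ennreal (real (Suc k) powr - (m + 2)) * (f x * indicator (ccube (real (Suc k))) x)" "{k}"]
      by simp
    finally show ?thesis .
  qed
  then have "(\<integral>\<^sup>+x. ennreal (decay (m + 2) x) * f x \<partial>lebesgue) \<le>
      (\<integral>\<^sup>+x. (\<Sum>k. ennreal (real (Suc k) powr - (m + 2)) * (f x * indicator (ccube (real (Suc k))) x)) \<partial>lebesgue)"
    by (rule nn_integral_mono)
  also have "\<dots> = (\<Sum>k. ennreal (real (Suc k) powr - (m + 2)) * (\<integral>\<^sup>+x\<in>ccube (real (Suc k)). f x \<partial>lebesgue))"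
    by (simp add: nn_integral_suminf nn_integral_cmult)
  also have "\<dots> \<le> (\<Sum>k. ennreal (A * inverse (real (Suc k) ^ 2)))"
  proof (rule suminf_le)
    fix k
    have "ennreal (real (Suc k) powr - (m + 2)) * (\<integral>\<^sup>+x\<in>ccube (real (Suc k)). f x \<partial>lebesgue)
        \<le> ennreal (real (Suc k) powr - (m + 2)) * ennreal (A * real (Suc k) powr m)"
      by (intro mult_left_mono growth) auto
    also have "\<dots> = ennreal (A * (real (Suc k) powr - (m + 2) * real (Suc k) powr m))"
      using A by (simp add: ennreal_mult[symmetric] mult_ac)
    also have "real (Suc k) powr - (m + 2) * real (Suc k) powr m = real (Suc k) powr - 2"
      by (subst powr_add[symmetric]) simp
    also have "\<dots> = inverse (real (Suc k) ^ 2)"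
      by (simp add: powr_minus powr_numeral)
    finally show "ennreal (real (Suc k) powr - (m + 2)) * (\<integral>\<^sup>+x\<in>ccube (real (Suc k)). f x \<partial>lebesgue)
        \<le> ennreal (A * inverse (real (Suc k) ^ 2))" .
  qed auto
  also have "\<dots> < \<infinity>"
  proof -
    have "summable (\<lambda>k. inverse (real (Suc k) ^ 2))"
      using inverse_power_summable[of 2, where ?'a = real] by (subst summable_Suc_iff) simp
    then have "summable (\<lambda>k. A * inverse (real (Suc k) ^ 2))"
      by (rule summable_mult)
    then show ?thesis
      using A by (subst suminf_ennreal2) auto
  qed
  finally show ?thesis .
qed

lemma decay_add: "decay (N + t) x \<le> exp (- t) * decay N x" if "0 \<le> t"
proof -
  have "(exp 1 + norm x) powr - t \<le> exp 1 powr - t"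
    using that by (intro powr_mono2') auto
  moreover have "decay (N + t) x = (exp 1 + norm x) powr - t * (exp 1 + norm x) powr - N"
    by (simp add: decay_def powr_add[symmetric] algebra_simps)
  ultimately show ?thesis
    by (simp add: decay_def mult_right_mono powr_def)
qed

text \<open>
  As \<open>decay (N + t)\<close> is at most \<open>exp (- t) * decay N\<close>, an integrable remainder becomes as small as one
  likes.
\<close>

lemma decay_integral_small:
  fixes f :: "real ^ 'n \<Rightarrow> ennreal"
  assumes [measurable]: "f \<in> borel_measurable lebesgue"
    and fin: "(\<integral>\<^sup>+x. ennreal (decay N x) * f x \<partial>lebesgue) < \<infinity>" and c: "0 < c" and N: "0 \<le> N"
  shows "\<exists>N'\<ge>0. (\<integral>\<^sup>+x. ennreal (decay N' x) * f x \<partial>lebesgue) \<le> ennreal c"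
proof -
  obtain I where I: "(\<integral>\<^sup>+x. ennreal (decay N x) * f x \<partial>lebesgue) = ennreal I" "0 \<le> I"
    using fin by (cases "\<integral>\<^sup>+x. ennreal (decay N x) * f x \<partial>lebesgue") auto
  define t where "t = ln (1 + I / c)"
  have t: "0 \<le> t" using I c by (simp add: t_def)
  have "exp (- t) * I = I / (1 + I / c)"
    using I c by (simp add: t_def exp_minus add_pos_nonneg inverse_eq_divide)
  also have "\<dots> \<le> c"
    using I c by (simp add: divide_le_eq add_pos_nonneg) (simp add: algebra_simps)
  finally have tc: "exp (- t) * I \<le> c" .
  have "(\<integral>\<^sup>+x. ennreal (decay (N + t) x) * f x \<partial>lebesgue) \<le>
      (\<integral>\<^sup>+x. ennreal (exp (- t)) * (ennreal (decay N x) * f x) \<partial>lebesgue)"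
    using decay_add[OF t, of N]
    by (intro nn_integral_mono) (auto simp: mult.assoc[symmetric] ennreal_mult[symmetric] intro!: mult_right_mono ennreal_leI)
  also have "\<dots> = ennreal (exp (- t) * I)"
    by (subst nn_integral_cmult) (use I in \<open>auto simp: ennreal_mult\<close>)
  also have "\<dots> \<le> ennreal c"
    using tc by (rule ennreal_leI)
  finally show ?thesis
    using N t by (intro exI[of _ "N + t"]) simp
qed

text \<open>
  Here \<open>y\<close> is \<open>exp 1 + norm x\<close>, and \<open>a\<close>, \<open>b\<close> are the exponent at \<open>x\<close> and at infinity. If \<open>\<beta>\<close> lies between two
  powers of \<open>y\<close>, log-Hoelder decay makes \<open>\<beta> powr (a - b)\<close> bounded. A lower bound of this form is assumed; if
  the upper bound \<open>\<beta> \<le> y powr N\<close> fails, then \<open>\<beta> powr - a\<close> is below the remainder \<open>y powr - N\<close> already.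
\<close>

lemma powr_compare:
  fixes y a b :: real
  assumes \<beta>: "0 < \<beta>" and ab: "1 \<le> a" "1 \<le> b" and y: "1 \<le> ln y" "0 < y" and D: "\<bar>a - b\<bar> * ln y \<le> D"
    and A: "0 \<le> A" "- A * ln y \<le> ln \<beta>" and N: "0 \<le> N"
  shows "\<beta> powr - a \<le> exp (D * (A + N)) * \<beta> powr - b + y powr - N"
proof (cases "y powr - N \<ge> \<beta> powr - a")
  case True
  then show ?thesis
    by (simp add: add_increasing)
next
  case False
  then have "- N * ln y < - a * ln \<beta>"
    using \<beta> y by (simp add: powr_def)
  then have aN: "a * ln \<beta> \<le> N * ln y"
    by simp
  have "ln \<beta> \<le> N * ln y"
  proof (cases "0 \<le> ln \<beta>")
    case True
    then have "1 * ln \<beta> \<le> a * ln \<beta>"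
      using ab by (intro mult_right_mono) auto
    then show ?thesis using aN by linarith
  next
    case False
    moreover have "0 \<le> N * ln y"
      by (rule mult_nonneg_nonneg[OF N]) (use y(1) in linarith)
    ultimately show ?thesis by linarith
  qed
  moreover have "0 \<le> A * ln y" "0 \<le> N * ln y"
    using mult_nonneg_nonneg[OF A(1), of "ln y"] mult_nonneg_nonneg[OF N, of "ln y"] y(1) by linarith+
  ultimately have "\<bar>ln \<beta>\<bar> \<le> (A + N) * ln y"
    using A(2) unfolding abs_le_iff distrib_right by linarith
  then have "\<bar>a - b\<bar> * \<bar>ln \<beta>\<bar> \<le> \<bar>a - b\<bar> * ((A + N) * ln y)"
    by (rule mult_left_mono) simp
  also have "\<dots> = (\<bar>a - b\<bar> * ln y) * (A + N)"
    by simp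
  also have "\<dots> \<le> D * (A + N)"
    using D A N by (intro mult_right_mono) auto
  finally have "\<bar>(a - b) * ln \<beta>\<bar> \<le> D * (A + N)"
    by (simp add: abs_mult)
  then have "- a * ln \<beta> \<le> D * (A + N) + - b * ln \<beta>"
    by (simp add: abs_le_iff algebra_simps)
  then have "\<beta> powr - a \<le> exp (D * (A + N)) * \<beta> powr - b"
    using \<beta> by (simp add: powr_def exp_add[symmetric])
  then show ?thesis
    by (simp add: add_increasing2)
qed

lemma powr_compare_abs:
  fixes a b :: real
  assumes \<beta>: "0 < \<beta>" and D: "\<bar>a - b\<bar> * \<bar>ln \<beta>\<bar> \<le> D"
  shows "\<beta> powr - a \<le> exp D * \<beta> powr - b"
proof -
  have "\<bar>(a - b) * ln \<beta>\<bar> \<le> D"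
    using D by (simp add: abs_mult)
  then have "- a * ln \<beta> \<le> D + - b * ln \<beta>"
    by (simp add: abs_le_iff algebra_simps)
  then show ?thesis
    using \<beta> by (simp add: powr_def exp_add[symmetric])
qed

section \<open>Norms of the weight and of its inverse on cubes\<close>

text \<open>
  The Muckenhoupt condition for a pair of conjugate exponents, freed from infima: \<open>lam a l\<close> and \<open>mu a l\<close> are
  admissible values for the norms of \<open>v\<close> and \<open>1 / v\<close> on the cube. For an exponent \<open>p\<close> and a weight \<open>w\<close> the
  roles are \<open>u = p'\<close> and \<open>v = 1 / w\<close>.
\<close>

locale dual_norms =
  fixes u p v :: "real ^ 'n \<Rightarrow> real" and U K :: real and lam mu :: "real ^ 'n \<Rightarrow> real \<Rightarrow> real"
  assumes u_measurable [measurable]: "u \<in> borel_measurable lebesgue"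
    and v_measurable [measurable]: "v \<in> borel_measurable lebesgue"
    and u: "\<And>x. 1 < u x" "\<And>x. u x \<le> U"
    and p: "\<And>x. 1 < p x" "\<And>x. 1 / u x + 1 / p x = 1"
    and v: "\<And>x. 0 < v x"
    and K: "1 \<le> K"
    and lam: "\<And>a l. 0 < l \<Longrightarrow> 0 < lam a l" and mu: "\<And>a l. 0 < l \<Longrightarrow> 0 < mu a l"
    and int_v: "\<And>a l. 0 < l \<Longrightarrow> (\<integral>\<^sup>+x\<in>cube a l. ennreal ((v x / lam a l) powr u x) \<partial>lebesgue) \<le> 1"
    and int_w: "\<And>a l. 0 < l \<Longrightarrow> (\<integral>\<^sup>+x\<in>cube a l. ennreal ((1 / (v x * mu a l)) powr p x) \<partial>lebesgue) \<le> 1"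
    and lam_mu: "\<And>a l. 0 < l \<Longrightarrow> lam a l * mu a l \<le> K * l ^ CARD('n)"
begin

lemma U: "1 < U"
  using u[of undefined] by linarith

lemma p_eq: "p x = u x / (u x - 1)"
proof -
  have "1 / p x = 1 - 1 / u x"
    using p(2)[of x] by linarith
  also have "\<dots> = (u x - 1) / u x"
    using u(1)[of x] by (simp add: field_simps)
  finally have "1 / (1 / p x) = u x / (u x - 1)"
    by simp
  then show ?thesis by simp
qed

lemma p_measurable [measurable]: "p \<in> borel_measurable lebesgue"
proof -
  have "(\<lambda>x. u x / (u x - 1)) \<in> borel_measurable lebesgue"
    by measurable
  then show ?thesis
    by (simp add: p_eq[abs_def])
qed

text \<open>
  The share of the modular of \<open>v / lam a l\<close> that a subset of relative volume \<open>\<eta>\<close> certainly carries.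
\<close>

definition portion :: "real \<Rightarrow> real"
  where "portion \<eta> = (\<eta> / (2 * K)) powr (U + 1)"

lemma portion_pos: "0 < \<eta> \<Longrightarrow> 0 < portion \<eta>"
  using K by (simp add: portion_def)

lemma portion_le_1: "0 < \<eta> \<Longrightarrow> \<eta> \<le> 1 \<Longrightarrow> portion \<eta> \<le> 1"
  using K U by (auto simp: portion_def intro!: powr_le1)

text \<open>
  Young's inequality for \<open>1 = (v / lam) * (1 / (v * mu)) * (lam * mu)\<close>, with a small factor \<open>\<delta>\<close> on the second
  term at the price of a large one on the first.
\<close>

lemma young_weighted:
  assumes l: "0 < l" and \<delta>: "0 < \<delta>" "\<delta> \<le> 1"
  shows "1 \<le> K * l ^ CARD('n) *
    (\<delta> powr - U * (v x / lam a l) powr u x + \<delta> * (1 / (v x * mu a l)) powr p x)"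
proof -
  define A where "A = v x / lam a l"
  define B where "B = 1 / (v x * mu a l)"
  have AB: "0 < A" "0 < B"
    using v[of x] lam[OF l] mu[OF l] by (auto simp: A_def B_def)
  have "A * B * (lam a l * mu a l) = 1"
    using v[of x] lam[OF l] mu[OF l] less_imp_neq[OF v[of x]] less_imp_neq[OF lam[OF l, of a]] less_imp_neq[OF mu[OF l, of a]]
    by (simp add: A_def B_def)
  moreover have "A * B * (lam a l * mu a l) \<le> A * B * (K * l ^ CARD('n))"
    using lam_mu[OF l] AB by (intro mult_left_mono) auto
  ultimately have 1: "1 \<le> K * l ^ CARD('n) * (A * B)"
    by (simp add: mult_ac)
  have "A * B = (A / \<delta>) * (\<delta> * B)"
    using \<delta> by simp
  also have "\<dots> \<le> (A / \<delta>) powr u x / u x + (\<delta> * B) powr p x / p x"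
    using u(1) p AB \<delta> by (intro Youngs_inequality) auto
  also have "\<dots> \<le> (A / \<delta>) powr u x / 1 + (\<delta> * B) powr p x / 1"
    using u(1)[of x] p(1)[of x] by (intro add_mono divide_left_mono) auto
  also have "(A / \<delta>) powr u x = \<delta> powr - u x * A powr u x"
    using AB \<delta> by (simp add: powr_divide powr_minus_divide)
  also have "\<delta> powr - u x * A powr u x \<le> \<delta> powr - U * A powr u x"
    using u[of x] \<delta> by (intro mult_right_mono powr_mono') auto
  also have "(\<delta> * B) powr p x = \<delta> powr p x * B powr p x"
    using AB \<delta> by (simp add: powr_mult)
  also have "\<delta> powr p x * B powr p x \<le> \<delta> powr 1 * B powr p x"
    using p(1)[of x] \<delta> by (intro mult_right_mono powr_mono') auto
  finally have "A * B \<le> \<delta> powr - U * A powr u x + \<delta> * B powr p x"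
    using \<delta> by simp
  then have "K * l ^ CARD('n) * (A * B) \<le> K * l ^ CARD('n) * (\<delta> powr - U * A powr u x + \<delta> * B powr p x)"
    using K l by (intro mult_left_mono) auto
  then show ?thesis
    using 1 unfolding A_def B_def by linarith
qed

text \<open>
  Integrating \<open>young_weighted\<close> over \<open>E\<close> bounds the volume of \<open>E\<close> by the modular of \<open>v\<close> on \<open>E\<close> and a term
  that is at most half of that volume if \<open>\<delta>\<close> is proportional to \<open>\<eta>\<close>.
\<close>

lemma integral_ge_portion:
  assumes l: "0 < l" and E [measurable]: "E \<in> sets lebesgue" and sub: "E \<subseteq> cube a l"
    and \<eta>: "0 < \<eta>" "\<eta> \<le> 1" and vol: "ennreal (\<eta> * l ^ CARD('n)) \<le> emeasure lebesgue E"
  shows "ennreal (portion \<eta>) \<le> (\<integral>\<^sup>+x\<in>E. ennreal ((v x / lam a l) powr u x) \<partial>lebesgue)"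
proof -
  \<comment> \<open>Then \<open>K * \<delta>\<close>, the part due to \<open>1 / v\<close>, is half of \<open>\<eta>\<close>.\<close>
  define \<delta> where "\<delta> = \<eta> / (2 * K)"
  have \<delta>: "0 < \<delta>" "\<delta> \<le> 1"
    using \<eta> K by (auto simp: \<delta>_def)
  define L where "L = l ^ CARD('n)"
  have L: "0 < L" using l by (simp add: L_def)
  let ?F = "\<lambda>x. ennreal ((v x / lam a l) powr u x)" and ?G = "\<lambda>x. ennreal ((1 / (v x * mu a l)) powr p x)"
  have intF: "(\<integral>\<^sup>+x\<in>E. ?F x \<partial>lebesgue) \<le> 1"
    using sub by (intro order_trans[OF _ int_v[OF l, of a]] nn_integral_mono) (auto simp: indicator_def)
  have intG: "(\<integral>\<^sup>+x\<in>E. ?G x \<partial>lebesgue) \<le> 1"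
    using sub by (intro order_trans[OF _ int_w[OF l, of a]] nn_integral_mono) (auto simp: indicator_def)
  obtain Y where Y: "(\<integral>\<^sup>+x\<in>E. ?F x \<partial>lebesgue) = ennreal Y" "0 \<le> Y"
    using intF by (cases "\<integral>\<^sup>+x\<in>E. ?F x \<partial>lebesgue") (auto simp: top_unique)
  have "ennreal (\<eta> * L) \<le> (\<integral>\<^sup>+x. indicator E x \<partial>lebesgue)"
    using vol by (simp add: L_def)
  also have "\<dots> \<le> (\<integral>\<^sup>+x. ennreal (K * L * \<delta> powr - U) * (?F x * indicator E x) +
      ennreal (K * L * \<delta>) * (?G x * indicator E x) \<partial>lebesgue)"
  proof (rule nn_integral_mono)
    fix x
    have "1 \<le> K * L * \<delta> powr - U * (v x / lam a l) powr u x + K * L * \<delta> * (1 / (v x * mu a l)) powr p x"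
      using young_weighted[OF l \<delta>, of x a] by (simp add: L_def distrib_left mult_ac)
    then have "1 \<le> ennreal (K * L * \<delta> powr - U * (v x / lam a l) powr u x + K * L * \<delta> * (1 / (v x * mu a l)) powr p x)"
      by simp
    also have "\<dots> = ennreal (K * L * \<delta> powr - U) * ?F x + ennreal (K * L * \<delta>) * ?G x"
      using K L \<delta> by (simp add: ennreal_mult[symmetric] ennreal_plus[symmetric] del: ennreal_plus)
    finally show "indicator E x \<le> ennreal (K * L * \<delta> powr - U) * (?F x * indicator E x) +
      ennreal (K * L * \<delta>) * (?G x * indicator E x)"
      by (auto simp: indicator_def)
  qed
  also have "\<dots> = ennreal (K * L * \<delta> powr - U) * ennreal Y + ennreal (K * L * \<delta>) * (\<integral>\<^sup>+x\<in>E. ?G x \<partial>lebesgue)"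
    by (subst nn_integral_add, measurable) (simp add: nn_integral_cmult Y)
  also have "\<dots> \<le> ennreal (K * L * \<delta> powr - U) * ennreal Y + ennreal (K * L * \<delta>) * 1"
    by (intro add_left_mono mult_left_mono intG) simp
  also have "\<dots> = ennreal (K * L * \<delta> powr - U * Y + K * L * \<delta>)"
    using K L \<delta> Y by (simp add: ennreal_mult[symmetric] ennreal_plus[symmetric] del: ennreal_plus)
  finally have "\<eta> * L \<le> K * L * \<delta> powr - U * Y + K * L * \<delta>"
    using K L \<delta> Y by (subst (asm) ennreal_le_iff) auto
  then have "L * \<eta> \<le> L * (K * \<delta> powr - U * Y + K * \<delta>)"
    by (simp add: algebra_simps)
  then have "\<eta> \<le> K * \<delta> powr - U * Y + K * \<delta>"
    using L by simp
  then have "K * \<delta> \<le> K * (\<delta> powr - U * Y)"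
    using K by (simp add: \<delta>_def field_simps)
  then have "\<delta> \<le> \<delta> powr - U * Y"
    using K by simp
  then have "\<delta> powr U * \<delta> \<le> \<delta> powr U * (\<delta> powr - U * Y)"
    by (intro mult_left_mono) auto
  also have "\<dots> = Y"
    using \<delta> by (simp add: powr_minus)
  finally have "portion \<eta> \<le> Y"
    using \<delta> by (simp add: portion_def \<delta>_def[symmetric] powr_add)
  then show ?thesis
    using Y by (simp add: ennreal_leI)
qed

text \<open>
  Two cubes with a large common part \<open>E\<close> have comparable norms: on \<open>E\<close> the modular normalised by the first
  cube is at least \<open>portion \<eta>\<close>, the one normalised by the second is at most \<open>1\<close>. As \<open>u \<ge> 1\<close>, the second
  exceeds the first at least by the factor \<open>lam a l / lam a' l'\<close> when that ratio is more than \<open>1\<close>.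
\<close>

lemma lam_comparable:
  assumes l: "0 < l" "0 < l'" and E [measurable]: "E \<in> sets lebesgue"
    and sub: "E \<subseteq> cube a l" "E \<subseteq> cube a' l'"
    and \<eta>: "0 < \<eta>" "\<eta> \<le> 1" and vol: "ennreal (\<eta> * l ^ CARD('n)) \<le> emeasure lebesgue E"
  shows "portion \<eta> * lam a l \<le> lam a' l'"
proof -
  define \<tau> where "\<tau> = lam a' l' / lam a l"
  have \<tau>: "0 < \<tau>" "lam a' l' = \<tau> * lam a l"
    using lam[OF l(1), of a] lam[OF l(2), of a'] by (auto simp: \<tau>_def)
  have "portion \<eta> \<le> \<tau>"
  proof (cases "1 \<le> \<tau>")
    case True
    then show ?thesis using portion_le_1[OF \<eta>] by linarith
  next
    case False
    let ?F = "\<lambda>a l x. ennreal ((v x / lam a l) powr u x)"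
    have "ennreal (1 / \<tau>) * ennreal (portion \<eta>) \<le> ennreal (1 / \<tau>) * (\<integral>\<^sup>+x\<in>E. ?F a l x \<partial>lebesgue)"
      by (intro mult_left_mono integral_ge_portion[OF l(1) E sub(1) \<eta> vol]) simp
    also have "\<dots> = (\<integral>\<^sup>+x. ennreal (1 / \<tau>) * (?F a l x * indicator E x) \<partial>lebesgue)"
      by (simp add: nn_integral_cmult)
    also have "\<dots> \<le> (\<integral>\<^sup>+x\<in>cube a' l'. ?F a' l' x \<partial>lebesgue)"
    proof (rule nn_integral_mono)
      fix x
      have "(1 / \<tau>) powr 1 \<le> (1 / \<tau>) powr u x"
        using False \<tau>(1) u(1)[of x] by (intro powr_mono) auto
      moreover have "(v x / lam a' l') powr u x = (1 / \<tau>) powr u x * (v x / lam a l) powr u x"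
        using \<tau> v[of x] lam[OF l(1), of a] by (simp add: powr_mult[symmetric])
      ultimately have "1 / \<tau> * (v x / lam a l) powr u x \<le> (v x / lam a' l') powr u x"
        using \<tau>(1) mult_right_mono[of "1 / \<tau>" "(1 / \<tau>) powr u x" "(v x / lam a l) powr u x"] by simp
      then have "ennreal (1 / \<tau>) * ?F a l x \<le> ?F a' l' x"
        using \<tau>(1) by (simp add: ennreal_mult[symmetric] ennreal_leI)
      then show "ennreal (1 / \<tau>) * (?F a l x * indicator E x) \<le> ?F a' l' x * indicator (cube a' l') x"
        using sub(2) by (auto simp: indicator_def)
    qed
    also have "\<dots> \<le> 1"
      by (rule int_v[OF l(2)])
    finally have "1 / \<tau> * portion \<eta> \<le> 1"
      using \<tau>(1) portion_pos[OF \<eta>(1)] by (simp add: ennreal_mult[symmetric] less_imp_le)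
    then show ?thesis
      using \<tau>(1) by (simp add: field_simps)
  qed
  then show ?thesis
    using \<tau>(2) lam[OF l(1), of a] by (simp add: mult_right_mono)
qed

definition cnorm :: "real \<Rightarrow> real"
  where "cnorm R = lam (\<chi> i. - R) (2 * R)"

lemma cnorm_pos: "0 < R \<Longrightarrow> 0 < cnorm R"
  by (simp add: cnorm_def lam)

lemma cnorm_ge_cnorm:
  assumes "0 < r" "r \<le> R"
  shows "portion 1 * cnorm r \<le> cnorm R"
proof -
  have "ccube r \<subseteq> (ccube R :: (real ^ 'n) set)"
    using assms by (intro ccube_mono)
  then show ?thesis
    unfolding cnorm_def using assms
    by (intro lam_comparable[of _ _ "ccube r"]) (auto simp: ccube_def[symmetric] emeasure_ccube)
qed

lemma cnorm_le_cnorm: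
  assumes R: "1 \<le> R"
  shows "portion (1 / R ^ CARD('n)) * cnorm R \<le> cnorm 1"
proof -
  have "ccube 1 \<subseteq> (ccube R :: (real ^ 'n) set)"
    using assms by (intro ccube_mono)
  moreover have "ccube 1 = (cube (\<chi> i. - 1) 2 :: (real ^ 'n) set)"
    by (simp add: ccube_def)
  moreover have "1 / R ^ CARD('n) * (2 * R) ^ CARD('n) = 2 ^ CARD('n)"
    using R by (simp add: power_mult_distrib)
  ultimately show ?thesis
    unfolding cnorm_def using R
    by (intro lam_comparable[of _ _ "ccube 1"])
      (auto simp: ccube_def[symmetric] one_le_power emeasure_cube[of 2 "\<chi> i. - 1 :: real ^ 'n"])
qed

lemma lam_le_cnorm:
  assumes "0 < l" "x \<in> cube a l"
  shows "portion 1 * lam a l \<le> cnorm (l + 1 + norm x)"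
  unfolding cnorm_def using assms cube_subset_ccube[OF assms(2)]
  by (intro lam_comparable[of _ _ "cube a l"]) (auto simp: ccube_def emeasure_cube add_pos_nonneg)

lemma lam_ge_cnorm:
  assumes l: "0 < l" and x: "x \<in> cube a l"
  defines "R \<equiv> l + 1 + norm x"
  shows "portion ((l / (2 * R)) ^ CARD('n)) * cnorm R \<le> lam a l"
proof -
  have R: "0 < R" "l \<le> R"
    using l by (simp_all add: R_def add_pos_nonneg)
  have "(l / (2 * R)) ^ CARD('n) * (2 * R) ^ CARD('n) = l ^ CARD('n)"
    using R by (simp add: power_divide)
  moreover have "(l / (2 * R)) ^ CARD('n) \<le> 1"
    using R l by (intro power_le_one) auto
  ultimately show ?thesis
    unfolding cnorm_def using l R cube_subset_ccube[OF x]
    by (intro lam_comparable[of _ _ "cube a l"]) (auto simp: ccube_def emeasure_cube R_def)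
qed

definition growth_exp :: real
  where "growth_exp = real CARD('n) * (U + 1)"

lemma growth_exp_pos: "0 < growth_exp"
  using U by (simp add: growth_exp_def)

lemma portion_power: "0 < t \<Longrightarrow> portion (t ^ CARD('n)) = portion 1 * t powr growth_exp"
  using K U by (simp add: portion_def growth_exp_def powr_divide powr_powr[symmetric] powr_realpow)

text \<open>
  Compare the cube with a centred cube that contains it, and that one with the centred cube of radius \<open>1\<close>.
  A crude polynomial bound is all that log-Hoelder continuity requires.
\<close>

lemma lam_upper: "\<exists>C>0. \<forall>a l x. 0 < l \<longrightarrow> x \<in> cube a l \<longrightarrow> lam a l \<le> C * (l + 1 + norm x) powr growth_exp"
proof (intro exI[of _ "cnorm 1 / (portion 1 * portion 1)"] conjI allI impI)
  have X1: "0 < portion 1" by (rule portion_pos) simp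
  then show "0 < cnorm 1 / (portion 1 * portion 1)"
    by (simp add: cnorm_pos)
  fix a :: "real ^ 'n" and l x assume l: "0 < l" and x: "x \<in> cube a l"
  define R where "R = l + 1 + norm x"
  have R: "1 \<le> R" using l by (simp add: R_def)
  have "1 / R ^ CARD('n) = (1 / R) ^ CARD('n)"
    by (simp add: power_divide)
  then have "portion (1 / R ^ CARD('n)) = portion 1 * R powr - growth_exp"
    using R portion_power[of "1 / R"] by (simp add: powr_divide powr_minus_divide)
  then have "portion 1 * R powr - growth_exp * cnorm R \<le> cnorm 1"
    using cnorm_le_cnorm[OF R] by simp
  moreover have "portion 1 * R powr - growth_exp * (portion 1 * lam a l) \<le> portion 1 * R powr - growth_exp * cnorm R"
    using lam_le_cnorm[OF l x] X1 by (intro mult_left_mono) (auto simp: R_def)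
  ultimately have "portion 1 * R powr - growth_exp * (portion 1 * lam a l) \<le> cnorm 1"
    by linarith
  then have "lam a l * R powr - growth_exp \<le> cnorm 1 / (portion 1 * portion 1)"
    using X1 by (simp add: pos_le_divide_eq mult_ac)
  then have "lam a l * R powr - growth_exp * R powr growth_exp \<le> cnorm 1 / (portion 1 * portion 1) * R powr growth_exp"
    by (rule mult_right_mono) simp
  moreover have "lam a l * R powr - growth_exp * R powr growth_exp = lam a l"
    using R by (simp add: mult.assoc powr_add[symmetric])
  ultimately show "lam a l \<le> cnorm 1 / (portion 1 * portion 1) * (l + 1 + norm x) powr growth_exp"
    unfolding R_def by simp
qed

lemma lam_lower:
  "\<exists>c>0. \<forall>a l x. 0 < l \<longrightarrow> x \<in> cube a l \<longrightarrow>
    c * (l / (l + 1 + norm x)) powr growth_exp * cnorm (l + 1 + norm x) \<le> lam a l"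
proof (intro exI[of _ "portion 1 * (1 / 2) powr growth_exp"] conjI allI impI)
  show "0 < portion 1 * (1 / 2) powr growth_exp"
    using portion_pos[of 1] by simp
  fix a :: "real ^ 'n" and l x assume l: "0 < l" and x: "x \<in> cube a l"
  define R where "R = l + 1 + norm x"
  have "0 < R" using l by (simp add: R_def add_pos_nonneg)
  then have "portion ((l / (2 * R)) ^ CARD('n)) = portion 1 * (1 / 2) powr growth_exp * (l / R) powr growth_exp"
    using l by (simp add: portion_power powr_mult[symmetric])
  then show "portion 1 * (1 / 2) powr growth_exp * (l / (l + 1 + norm x)) powr growth_exp * cnorm (l + 1 + norm x) \<le> lam a l"
    using lam_ge_cnorm[OF l x] by (simp add: R_def)
qed

end

section \<open>Growth of the mass of centred cubes\<close>

context fat_weight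
begin

text \<open>
  The shell between the two cubes occupies at least half of the larger one, so it carries the share \<open>\<epsilon>\<close> of
  its mass. Iteration gives the polynomial lower bound that follows.
\<close>

lemma mass_ccube_double:
  assumes R: "0 < R"
  shows "measure mass (ccube R) \<le> (1 - \<epsilon>) * measure mass (ccube (2 * R))"
proof -
  let ?A = "ccube R :: (real ^ 'n) set" and ?B = "ccube (2 * R) :: (real ^ 'n) set"
  have sub: "?A \<subseteq> ?B"
    using R by (intro ccube_mono) simp
  have fin: "emeasure mass ?B < \<infinity>"
    unfolding ccube_def using R by (intro mass_finite) simp
  then have finA: "emeasure mass ?A < \<infinity>"
    using sub emeasure_mono[of ?A ?B mass] by (auto intro: le_less_trans)
  have "ennreal \<epsilon> * emeasure mass ?B \<le> emeasure mass (?B - ?A)"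
  proof -
    have "(2 :: real) ^ 1 \<le> 2 ^ CARD('n)"
      by (intro power_increasing) (simp_all add: Suc_leI)
    then have "2 * (2 * R) ^ CARD('n) \<le> 2 ^ CARD('n) * (2 * R) ^ CARD('n)"
      using R by (intro mult_right_mono) auto
    then have "(2 * (2 * R)) ^ CARD('n) / 2 \<le> (2 * (2 * R)) ^ CARD('n) - (2 * R) ^ CARD('n)"
      unfolding power_mult_distrib[of 2 "2 * R"] by linarith
    then have "ennreal ((2 * (2 * R)) ^ CARD('n) / 2) \<le> ennreal ((2 * (2 * R)) ^ CARD('n)) - ennreal ((2 * R) ^ CARD('n))"
      using R by (subst ennreal_minus) (auto intro: ennreal_leI)
    also have "\<dots> = emeasure lebesgue (?B - ?A)"
      using R sub by (subst emeasure_Diff) (auto simp: emeasure_ccube)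
    finally have "ennreal \<epsilon> * emeasure mass (cube (\<chi> i. - (2 * R)) (2 * (2 * R)) :: (real ^ 'n) set) \<le> emeasure mass (?B - ?A)"
      using R by (intro fat) (auto simp: ccube_def)
    then show ?thesis
      by (simp add: ccube_def)
  qed
  also have "\<dots> = emeasure mass ?B - emeasure mass ?A"
    using sub finA by (intro emeasure_Diff) auto
  finally have "ennreal \<epsilon> * ennreal (measure mass ?B) \<le> ennreal (measure mass ?B) - ennreal (measure mass ?A)"
    using fin finA by (simp add: emeasure_eq_ennreal_measure)
  then have "\<epsilon> * measure mass ?B \<le> measure mass ?B - measure mass ?A"
    using \<epsilon> sub fin measure_mono_fmeasurable[of ?A ?B mass]
    by (simp add: ennreal_mult[symmetric] ennreal_minus fmeasurable_def)
  then show ?thesis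
    by (simp add: algebra_simps)
qed

lemma mass_ccube_pos: "0 < R \<Longrightarrow> 0 < measure mass (ccube R)"
proof -
  assume R: "0 < R"
  have "emeasure mass (ccube R) \<noteq> 0"
    using R by (intro mass_pos) (simp_all add: emeasure_ccube)
  moreover have "emeasure mass (ccube R) < \<infinity>"
    unfolding ccube_def using R by (intro mass_finite) simp
  ultimately show ?thesis
    by (simp add: measure_def enn2real_positive_iff zero_less_iff_neq_zero)
qed

lemma mass_ccube_growth:
  "\<exists>\<gamma>>0. \<exists>c>0. \<forall>R\<ge>1. c * R powr \<gamma> \<le> measure mass (ccube R)"
proof -
  define g where "g = 1 / (1 - \<epsilon>)"
  have g: "1 < g"
    using \<epsilon> by (simp add: g_def)
  define \<gamma> where "\<gamma> = log 2 g"
  have \<gamma>: "0 < \<gamma>" "2 powr \<gamma> = g"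
    using g by (simp_all add: \<gamma>_def)
  define m where "m R = measure mass (ccube R)" for R
  have double: "g * m R \<le> m (2 * R)" if "0 < R" for R
    using mass_ccube_double[OF that] \<epsilon> by (simp add: g_def m_def field_simps)
  have iter: "g ^ k * m 1 \<le> m (2 ^ k)" for k
  proof (induction k)
    case (Suc k)
    have "g ^ Suc k * m 1 = g * (g ^ k * m 1)"
      by simp
    also have "\<dots> \<le> g * m (2 ^ k)"
      using g Suc by (intro mult_left_mono) auto
    also have "\<dots> \<le> m (2 ^ Suc k)"
      using double[of "2 ^ k"] by simp
    finally show ?case .
  qed simp
  have "m 1 / g * R powr \<gamma> \<le> m R" if R: "1 \<le> R" for R
  proof -
    define k where "k = nat \<lfloor>log 2 R\<rfloor>"
    have "0 \<le> log 2 R" using R by simp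
    then have k: "real k \<le> log 2 R" "log 2 R \<le> real k + 1"
      unfolding k_def by linarith+
    have "2 ^ k \<le> R"
      using k(1) R by (simp add: le_log_iff powr_realpow)
    then have "m (2 ^ k) \<le> m R"
      unfolding m_def using mass_finite[of "2 * R" "\<chi> i. - R"] R
      by (intro measure_mono_fmeasurable ccube_mono) (auto simp: fmeasurable_def ccube_def)
    moreover have "R powr \<gamma> \<le> g ^ k * g"
    proof -
      have "R powr \<gamma> = (2 powr log 2 R) powr \<gamma>"
        using R by simp
      also have "\<dots> \<le> (2 powr (real k + 1)) powr \<gamma>"
        using k \<gamma> by (intro powr_mono2 powr_mono) auto
      also have "\<dots> = (2 powr \<gamma>) powr (real k + 1)"
        by (simp add: powr_powr mult.commute)
      also have "\<dots> = g ^ k * g"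
        using g by (simp add: \<gamma>(2) powr_add powr_realpow)
      finally show ?thesis .
    qed
    then have "m 1 / g * R powr \<gamma> \<le> m 1 / g * (g ^ k * g)"
      using g by (intro mult_left_mono) (auto simp: m_def)
    moreover have "m 1 / g * (g ^ k * g) = g ^ k * m 1"
      using g by simp
    ultimately show ?thesis
      using iter[of k] by linarith
  qed
  moreover have "0 < m 1 / g"
    using mass_ccube_pos[of 1] g by (simp add: m_def)
  ultimately show ?thesis
    using \<gamma>(1) unfolding m_def by blast
qed

end

context dual_norms
begin

sublocale weight "\<lambda>x. v x powr u x"
  by standard (use v less_imp_neq[OF v] in \<open>simp_all add: less_le\<close>)

lemma powr_u_eq: "0 < l \<Longrightarrow> (v x / lam a l) powr u x = v x powr u x * lam a l powr - u x"
  using v[of x] lam[of l a] by (simp add: powr_divide powr_minus_divide)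

lemma mass_cube_le:
  assumes l: "0 < l"
  shows "emeasure mass (cube a l) \<le> ennreal (max 1 (lam a l) powr U)"
proof -
  have "emeasure mass (cube a l) = (\<integral>\<^sup>+x\<in>cube a l. ennreal (v x powr u x) \<partial>lebesgue)"
    by (simp add: mass_eq)
  also have "\<dots> \<le> (\<integral>\<^sup>+x. ennreal (max 1 (lam a l) powr U) *
      (ennreal ((v x / lam a l) powr u x) * indicator (cube a l) x) \<partial>lebesgue)"
  proof (rule nn_integral_mono)
    fix x
    have "lam a l powr u x \<le> max 1 (lam a l) powr u x"
      using u(1)[of x] lam[OF l, of a] by (intro powr_mono2) auto
    also have "\<dots> \<le> max 1 (lam a l) powr U"
      using u[of x] by (intro powr_mono) auto
    finally have "lam a l powr u x * (v x / lam a l) powr u x \<le> max 1 (lam a l) powr U * (v x / lam a l) powr u x"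
      by (rule mult_right_mono) simp
    moreover have "lam a l powr u x * (v x / lam a l) powr u x = v x powr u x"
      using lam[OF l, of a] v[of x] by (simp add: powr_mult[symmetric])
    ultimately have "ennreal (v x powr u x) \<le> ennreal (max 1 (lam a l) powr U) * ennreal ((v x / lam a l) powr u x)"
      by (simp add: ennreal_mult[symmetric] ennreal_leI)
    then show "ennreal (v x powr u x) * indicator (cube a l) x \<le> ennreal (max 1 (lam a l) powr U) *
      (ennreal ((v x / lam a l) powr u x) * indicator (cube a l) x)"
      by (auto simp: indicator_def)
  qed
  also have "\<dots> = ennreal (max 1 (lam a l) powr U) * (\<integral>\<^sup>+x\<in>cube a l. ennreal ((v x / lam a l) powr u x) \<partial>lebesgue)"
    by (rule nn_integral_cmult) measurable
  also have "\<dots> \<le> ennreal (max 1 (lam a l) powr U) * 1"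
    by (intro mult_left_mono int_v l) simp
  finally show ?thesis by simp
qed

lemma mass_ccube_le_powr:
  "\<exists>A\<ge>0. \<exists>m\<ge>0. \<forall>k\<ge>1. emeasure mass (ccube (real k)) \<le> ennreal (A * real k powr m)"
proof -
  obtain C where C: "0 < C"
    "\<forall>a l x. 0 < l \<longrightarrow> x \<in> cube a l \<longrightarrow> lam a l \<le> C * (l + 1 + norm x) powr growth_exp"
    using lam_upper by blast
  have "emeasure mass (ccube (real k)) \<le> ennreal ((max 1 C * 3 powr growth_exp) powr U * real k powr (growth_exp * U))"
    if k: "1 \<le> k" for k
  proof -
    let ?a = "(\<chi> i. - real k) :: real ^ 'n" and ?l = "2 * real k"
    have "0 \<in> cube ?a ?l"
      by (simp add: mem_cube)
    then have "lam ?a ?l \<le> C * (?l + 1) powr growth_exp"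
      using C(2)[rule_format, of ?l 0 ?a] k by simp
    also have "\<dots> \<le> max 1 C * (3 * real k) powr growth_exp"
      using k growth_exp_pos C(1) by (intro mult_mono powr_mono2) auto
    finally have "lam ?a ?l \<le> max 1 C * 3 powr growth_exp * real k powr growth_exp"
      by (simp add: powr_mult mult_ac)
    moreover have "1 * (1 * 1) \<le> max 1 C * (3 powr growth_exp * real k powr growth_exp)"
      using k growth_exp_pos by (intro mult_mono ge_one_powr_ge_zero) auto
    ultimately have "max 1 (lam ?a ?l) \<le> max 1 C * 3 powr growth_exp * real k powr growth_exp"
      by simp
    then have "max 1 (lam ?a ?l) powr U \<le> (max 1 C * 3 powr growth_exp * real k powr growth_exp) powr U"
      using U by (intro powr_mono2) auto
    also have "\<dots> = (max 1 C * 3 powr growth_exp) powr U * real k powr (growth_exp * U)"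
      using k C by (simp add: powr_mult powr_powr)
    finally show ?thesis
      using mass_cube_le[of ?l ?a] k unfolding ccube_def
      by (auto intro: order_trans ennreal_leI)
  qed
  moreover have "0 \<le> growth_exp * U"
    using growth_exp_pos U by simp
  ultimately show ?thesis
    by (intro exI[of _ "(max 1 C * 3 powr growth_exp) powr U"] conjI exI[of _ "growth_exp * U"]) auto
qed

text \<open>
  The mass of centred cubes grows at most polynomially because the norms do.
\<close>

lemma decay_mass_small:
  assumes "0 < c"
  shows "\<exists>N\<ge>0. (\<integral>\<^sup>+x. ennreal (decay N x) * ennreal (v x powr u x) \<partial>lebesgue) \<le> ennreal c"
proof -
  obtain A m where "0 \<le> A" "0 \<le> m"
    and growth: "\<forall>k\<ge>1. emeasure mass (ccube (real k)) \<le> ennreal (A * real k powr m)"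
    using mass_ccube_le_powr by blast
  then have "(\<integral>\<^sup>+x. ennreal (decay (m + 2) x) * ennreal (v x powr u x) \<partial>lebesgue) < \<infinity>"
    by (intro decay_integral_finite[of _ A]) (auto simp: mass_eq)
  then show ?thesis
    using assms \<open>0 \<le> m\<close> by (intro decay_integral_small[of _ "m + 2"]) auto
qed

end

section \<open>Freezing a log-Hoelder continuous exponent\<close>

lemma inverse_position_le_ratio:
  fixes l t :: real
  assumes l: "1 \<le> l" and t: "0 \<le> t"
  shows "1 / (exp 1 + t) \<le> l / (l + 1 + t)"
proof -
  have "l * (1 + 1) \<le> l * exp 1"
    using l exp_ge_add_one_self[of 1] by (intro mult_left_mono) auto
  moreover have "1 * t \<le> l * t"
    using l t by (intro mult_right_mono) auto
  ultimately have "l + 1 + t \<le> l * (exp 1 + t)"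
    using l unfolding distrib_left by linarith
  moreover have "0 < exp 1 + t" "0 < l + 1 + t"
    using l t by (simp_all add: add_pos_nonneg)
  ultimately show ?thesis
    by (simp only: pos_le_divide_eq times_divide_eq_left mult_1 pos_divide_le_eq)
qed

locale log_Hoelder_norms = dual_norms u p v U K lam mu
  for u p v :: "real ^ 'n \<Rightarrow> real" and U K :: real and lam mu :: "real ^ 'n \<Rightarrow> real \<Rightarrow> real" +
  fixes uinf C0 Cinf :: real
  assumes uinf: "1 \<le> uinf"
    and LH_local: "\<And>x y. norm (x - y) < 1 / 2 \<Longrightarrow> \<bar>u x - u y\<bar> \<le> C0 / - ln (norm (x - y))"
    and LH_infinity: "\<And>x. \<bar>u x - uinf\<bar> \<le> Cinf / ln (exp 1 + norm x)"
begin

text \<open>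
  The constant that replaces \<open>u\<close> on a cube: local continuity makes the value at the corner good enough for
  small cubes, while large cubes only allow the value at infinity.
\<close>

definition ref_exp :: "real ^ 'n \<Rightarrow> real \<Rightarrow> real"
  where "ref_exp a l = (if l \<le> 1 then u a else uinf)"

lemma ref_exp_ge_1: "1 \<le> ref_exp a l"
  using uinf u(1)[of a] by (simp add: ref_exp_def)

lemma osc_infinity: "\<bar>u x - uinf\<bar> * ln (exp 1 + norm x) \<le> Cinf"
proof -
  have "0 < ln (exp 1 + norm x)"
    using one_le_ln_exp_1_add[of "norm x"] by simp
  then show ?thesis
    using LH_infinity[of x] by (simp add: pos_le_divide_eq)
qed

lemma Cinf: "0 \<le> Cinf"
  using osc_infinity[of 0] by (intro order_trans[OF _ osc_infinity[of 0]]) simp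

lemma norm_diff_cube:
  fixes a :: "real ^ 'n"
  assumes "0 < l" "x \<in> cube a l"
  shows "norm (x - a) \<le> real CARD('n) * l"
proof -
  have comp: "\<bar>(x - a) $ i\<bar> \<le> l" for i
  proof -
    have "a $ i \<le> x $ i \<and> x $ i \<le> a $ i + l"
      using assms by (simp add: mem_cube)
    then show ?thesis
      unfolding vector_minus_component by linarith
  qed
  have "(\<Sum>i\<in>UNIV. \<bar>(x - a) $ i\<bar>) \<le> (\<Sum>i\<in>(UNIV :: 'n set). l)"
    by (rule sum_mono) (rule comp)
  then show ?thesis
    using norm_le_l1_cart[of "x - a"] by simp
qed

text \<open>
  If \<open>l\<close> is at most \<open>1 / (4 * n\<^sup>2)\<close>, the distance \<open>d\<close> of \<open>x\<close> from the corner satisfies \<open>d\<^sup>2 \<le> l / 4\<close>, so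
  \<open>- ln l\<close> is at most twice \<open>- ln d\<close>, which the local condition controls. For the other cubes \<open>ln l\<close> is
  bounded.
\<close>

lemma osc_small_cube_side:
  assumes l: "0 < l" "l \<le> 1" and x: "x \<in> cube a l"
  shows "\<bar>u x - u a\<bar> * \<bar>ln l\<bar> \<le> 2 * \<bar>C0\<bar> + 2 * U * ln (4 * (real CARD('n))\<^sup>2)"
proof -
  define n where "n = real CARD('n)"
  have n: "1 \<le> n"
    by (simp add: n_def Suc_leI)
  have "1 \<le> n\<^sup>2"
    using n by simp
  then have n4: "1 \<le> 4 * n\<^sup>2" by linarith
  have lnn: "0 \<le> 2 * U * ln (4 * n\<^sup>2)"
    using n4 U by simp
  have "\<bar>u x - u a\<bar> * \<bar>ln l\<bar> \<le> 2 * \<bar>C0\<bar> + 2 * U * ln (4 * n\<^sup>2)"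
  proof (cases "l \<le> 1 / (4 * n\<^sup>2)")
    case True
    define d where "d = norm (x - a)"
    have dn: "d \<le> n * l" "0 \<le> d"
      using norm_diff_cube[OF l(1) x] by (simp_all add: d_def n_def)
    have "d\<^sup>2 \<le> (n * l)\<^sup>2"
      using dn by (intro power_mono)
    also have "\<dots> = (n\<^sup>2 * l) * l"
      by (simp add: power2_eq_square)
    also have "\<dots> \<le> (1 / 4) * l"
      using True l n by (intro mult_right_mono) (simp_all add: field_simps)
    finally have d2: "d\<^sup>2 \<le> l / 4"
      by simp
    have "1 / (4 * n\<^sup>2) \<le> 1 / 4"
      using \<open>1 \<le> n\<^sup>2\<close> by (intro divide_left_mono) auto
    then have "l \<le> 1 / 4"
      using True by linarith
    then have "d\<^sup>2 < (1 / 2)\<^sup>2"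
      using d2 by (simp add: power2_eq_square)
    then have d12: "d < 1 / 2"
      by (rule power_less_imp_less_base) simp
    show ?thesis
    proof (cases "d = 0")
      case True
      then show ?thesis
        using lnn by (simp add: d_def)
    next
      case False
      then have dpos: "0 < d" using dn by simp
      have "ln (d\<^sup>2) \<le> ln l"
        using d2 l dpos by (intro ln_mono) auto
      then have lnl: "- ln l \<le> 2 * - ln d"
        using dpos by (simp add: ln_realpow)
      have lnd: "0 < - ln d"
        using dpos d12 by simp
      have "\<bar>u x - u a\<bar> \<le> C0 / - ln d"
        using LH_local[of x a] d12 by (simp add: d_def)
      then have "\<bar>u x - u a\<bar> * - ln d \<le> C0"
        using pos_le_divide_eq[OF lnd] by blast
      moreover have "\<bar>u x - u a\<bar> * \<bar>ln l\<bar> \<le> \<bar>u x - u a\<bar> * (2 * - ln d)"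
        using lnl l by (intro mult_left_mono) auto
      ultimately have "\<bar>u x - u a\<bar> * \<bar>ln l\<bar> \<le> 2 * C0"
        by linarith
      then show ?thesis
        using lnn by linarith
    qed
  next
    case False
    have "\<bar>ln l\<bar> = ln (1 / l)"
      using l by (simp add: ln_div)
    also have "\<dots> \<le> ln (4 * n\<^sup>2)"
    proof (rule ln_mono)
      have "0 < 4 * n\<^sup>2" using n4 by linarith
      then have "1 < l * (4 * n\<^sup>2)"
        using False by (simp only: not_le pos_divide_less_eq)
      then show "1 / l \<le> 4 * n\<^sup>2"
        using l by (simp add: pos_divide_le_eq mult.commute)
    qed (use l in simp)
    finally have "\<bar>u x - u a\<bar> * \<bar>ln l\<bar> \<le> (2 * U) * ln (4 * n\<^sup>2)"
      using u[of x] u[of a] by (intro mult_mono) auto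
    then show ?thesis by simp
  qed
  then show ?thesis
    by (simp add: n_def)
qed

text \<open>
  For a small cube far from the origin the corner and \<open>x\<close> are about equally far away, and both values of the
  exponent are close to \<open>uinf\<close>.
\<close>

lemma osc_small_cube_position:
  assumes l: "0 < l" "l \<le> 1" and x: "x \<in> cube a l"
  shows "\<bar>u x - u a\<bar> * ln (exp 1 + norm x) \<le> Cinf * (2 + ln (1 + real CARD('n)))"
proof -
  define n where "n = real CARD('n)"
  have n: "0 \<le> n" by (simp add: n_def)
  have "norm (x - a) \<le> n"
    using norm_diff_cube[OF l(1) x] mult_left_mono[OF l(2) n] unfolding n_def by linarith
  then have "norm x \<le> n + norm a"
    using norm_triangle_ineq2[of x a] by linarith
  moreover have "n * 1 \<le> n * exp 1" "0 \<le> n * norm a"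
    using n by (intro mult_left_mono mult_nonneg_nonneg; simp)+
  ultimately have "exp 1 + norm x \<le> (1 + n) * (exp 1 + norm a)"
    by (simp add: algebra_simps)
  then have "ln (exp 1 + norm x) \<le> ln ((1 + n) * (exp 1 + norm a))"
    by (intro ln_mono) (auto intro: add_pos_nonneg)
  also have "\<dots> = ln (1 + n) + ln (exp 1 + norm a)"
    using n by (intro ln_mult_pos) (auto intro: add_pos_nonneg)
  also have "\<dots> \<le> (1 + ln (1 + n)) * ln (exp 1 + norm a)"
    using mult_left_mono[OF one_le_ln_exp_1_add[of "norm a"], of "ln (1 + n)"] n
    by (simp add: distrib_right)
  finally have la: "ln (exp 1 + norm x) \<le> (1 + ln (1 + n)) * ln (exp 1 + norm a)" .
  have "\<bar>u x - u a\<bar> * ln (exp 1 + norm x) \<le> (\<bar>u x - uinf\<bar> + \<bar>u a - uinf\<bar>) * ln (exp 1 + norm x)"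
    using one_le_ln_exp_1_add[of "norm x"] by (intro mult_right_mono) auto
  also have "\<dots> \<le> \<bar>u x - uinf\<bar> * ln (exp 1 + norm x) + \<bar>u a - uinf\<bar> * ((1 + ln (1 + n)) * ln (exp 1 + norm a))"
    using la by (simp add: distrib_right mult_left_mono)
  also have "\<dots> = \<bar>u x - uinf\<bar> * ln (exp 1 + norm x) + (1 + ln (1 + n)) * (\<bar>u a - uinf\<bar> * ln (exp 1 + norm a))"
    by simp
  also have "\<dots> \<le> Cinf + (1 + ln (1 + n)) * Cinf"
    using n by (intro add_mono mult_left_mono osc_infinity) auto
  finally show ?thesis
    by (simp add: n_def algebra_simps)
qed

lemma osc_small_cube:
  "\<exists>D\<ge>0. \<forall>a l x. 0 < l \<longrightarrow> l \<le> 1 \<longrightarrow> x \<in> cube a l \<longrightarrow>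
    \<bar>u x - u a\<bar> * (\<bar>ln l\<bar> + ln (exp 1 + norm x)) \<le> D"
proof (intro exI[of _ "\<bar>2 * \<bar>C0\<bar> + 2 * U * ln (4 * (real CARD('n))\<^sup>2)\<bar> + \<bar>Cinf * (2 + ln (1 + real CARD('n)))\<bar>"]
    conjI allI impI)
  fix a :: "real ^ 'n" and l x assume *: "0 < l" "l \<le> 1" "x \<in> cube a l"
  show "\<bar>u x - u a\<bar> * (\<bar>ln l\<bar> + ln (exp 1 + norm x)) \<le>
      \<bar>2 * \<bar>C0\<bar> + 2 * U * ln (4 * (real CARD('n))\<^sup>2)\<bar> + \<bar>Cinf * (2 + ln (1 + real CARD('n)))\<bar>"
    using osc_small_cube_side[OF *] osc_small_cube_position[OF *] unfolding distrib_left by linarith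
qed simp

text \<open>
  The numbers \<open>\<beta>\<close> whose powers may be taken with the constant exponent. A large cube needs no upper bound: an
  exceedingly large \<open>\<beta>\<close> makes \<open>\<beta> powr - u x\<close> smaller than the remainder.
\<close>

definition tame :: "real \<Rightarrow> real ^ 'n \<Rightarrow> real \<Rightarrow> real \<Rightarrow> bool"
  where "tame A a l \<beta> \<longleftrightarrow> 0 < \<beta> \<and> (\<forall>x\<in>cube a l.
    if l \<le> 1 then \<bar>ln \<beta>\<bar> \<le> A * (\<bar>ln l\<bar> + ln (exp 1 + norm x)) else - A * ln (exp 1 + norm x) \<le> ln \<beta>)"

lemma tame_compare:
  assumes A: "0 \<le> A" and N: "0 \<le> N" and s: "1 \<le> s"
  shows "\<exists>C\<ge>1. \<forall>a l \<beta> x. 0 < l \<longrightarrow> tame A a l \<beta> \<longrightarrow> x \<in> cube a l \<longrightarrow>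
    \<beta> powr - (s * u x) \<le> C * \<beta> powr - (s * ref_exp a l) + decay N x \<and>
    \<beta> powr - (s * ref_exp a l) \<le> C * \<beta> powr - (s * u x) + decay N x"
proof -
  obtain D where D: "0 \<le> D" "\<forall>a l x. 0 < l \<longrightarrow> l \<le> 1 \<longrightarrow> x \<in> cube a l \<longrightarrow>
    \<bar>u x - u a\<bar> * (\<bar>ln l\<bar> + ln (exp 1 + norm x)) \<le> D"
    using osc_small_cube by blast
  define E where "E = s * (D * A) + s * Cinf * (A + N)"
  have sDA: "0 \<le> s * (D * A)" and sCN: "0 \<le> s * Cinf * (A + N)"
    using D(1) A N s Cinf by auto
  have goal: "\<beta> powr - (s * u x) \<le> exp E * \<beta> powr - (s * ref_exp a l) + decay N x \<and>
      \<beta> powr - (s * ref_exp a l) \<le> exp E * \<beta> powr - (s * u x) + decay N x"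
    if l: "0 < l" and t: "tame A a l \<beta>" and x: "x \<in> cube a l" for a l \<beta> x
  proof (cases "l \<le> 1")
    case True
    have \<beta>: "0 < \<beta>" "\<bar>ln \<beta>\<bar> \<le> A * (\<bar>ln l\<bar> + ln (exp 1 + norm x))"
      using t x True by (auto simp: tame_def)
    have e: "ref_exp a l = u a" using True by (simp add: ref_exp_def)
    have "\<bar>s * u x - s * u a\<bar> * \<bar>ln \<beta>\<bar> = s * \<bar>u x - u a\<bar> * \<bar>ln \<beta>\<bar>"
      using s by (simp add: right_diff_distrib[symmetric] abs_mult)
    also have "\<dots> \<le> s * \<bar>u x - u a\<bar> * (A * (\<bar>ln l\<bar> + ln (exp 1 + norm x)))"
      using s \<beta> by (intro mult_left_mono) auto
    also have "\<dots> = s * A * (\<bar>u x - u a\<bar> * (\<bar>ln l\<bar> + ln (exp 1 + norm x)))"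
      by simp
    also have "\<dots> \<le> s * A * D"
      using D(2) l True x s A by (intro mult_left_mono) auto
    also have "\<dots> \<le> E"
      using sCN by (simp add: E_def mult_ac)
    finally have *: "\<bar>s * u x - s * u a\<bar> * \<bar>ln \<beta>\<bar> \<le> E" .
    then have "\<bar>s * u a - s * u x\<bar> * \<bar>ln \<beta>\<bar> \<le> E"
      by (simp add: abs_minus_commute)
    with * show ?thesis
      using powr_compare_abs[OF \<beta>(1)] by (simp add: e add_increasing2)
  next
    case False
    have \<beta>: "0 < \<beta>" "- A * ln (exp 1 + norm x) \<le> ln \<beta>"
      using t x False by (auto simp: tame_def)
    have e: "ref_exp a l = uinf" using False by (simp add: ref_exp_def)
    have "1 * 1 \<le> s * u x" "1 * 1 \<le> s * uinf"
      using s u(1)[of x] uinf by (intro mult_mono; simp)+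
    then have su: "1 \<le> s * u x" "1 \<le> s * uinf" by simp_all
    have "\<bar>s * u x - s * uinf\<bar> * ln (exp 1 + norm x) = s * (\<bar>u x - uinf\<bar> * ln (exp 1 + norm x))"
      using s by (simp add: right_diff_distrib[symmetric] abs_mult)
    also have "\<dots> \<le> s * Cinf"
      using s by (intro mult_left_mono osc_infinity) auto
    finally have *: "\<bar>s * u x - s * uinf\<bar> * ln (exp 1 + norm x) \<le> s * Cinf" .
    then have **: "\<bar>s * uinf - s * u x\<bar> * ln (exp 1 + norm x) \<le> s * Cinf"
      by (simp add: abs_minus_commute)
    have ln1: "1 \<le> ln (exp 1 + norm x)" "0 < exp 1 + norm x"
      by (auto intro: one_le_ln_exp_1_add add_pos_nonneg)
    have "exp (s * Cinf * (A + N)) \<le> exp E"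
      using sDA by (simp add: E_def)
    then have up: "exp (s * Cinf * (A + N)) * \<beta> powr - b \<le> exp E * \<beta> powr - b" for b
      by (intro mult_right_mono) auto
    show ?thesis
      using powr_compare[OF \<beta>(1) su ln1 * A \<beta>(2) N] powr_compare[OF \<beta>(1) su(2,1) ln1 ** A \<beta>(2) N]
        up[of "s * uinf"] up[of "s * u x"]
      unfolding e decay_def by linarith
  qed
  moreover have "1 \<le> exp E"
    using sDA sCN by (simp add: E_def)
  ultimately show ?thesis
    by blast
qed

text \<open>
  The polynomial bounds on \<open>lam\<close> in terms of \<open>l\<close> and \<open>norm x\<close> are linear bounds for its logarithm.
\<close>

lemma tame_lam: "\<exists>A\<ge>0. \<forall>a l. 0 < l \<longrightarrow> tame A a l (lam a l)"
proof -
  obtain C where C: "0 < C"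
    "\<forall>a l x. 0 < l \<longrightarrow> x \<in> cube a l \<longrightarrow> lam a l \<le> C * (l + 1 + norm x) powr growth_exp"
    using lam_upper by blast
  obtain c where c: "0 < c" "\<forall>a l x. 0 < l \<longrightarrow> x \<in> cube a l \<longrightarrow>
    c * (l / (l + 1 + norm x)) powr growth_exp * cnorm (l + 1 + norm x) \<le> lam a l"
    using lam_lower by blast
  define c' where "c' = c * (portion 1 * cnorm 1)"
  have c': "0 < c'"
    using c portion_pos[of 1] cnorm_pos[of 1] by (simp add: c'_def)
  define A where "A = \<bar>ln C\<bar> + \<bar>ln c'\<bar> + growth_exp"
  have A: "0 \<le> A" "\<bar>ln C\<bar> + growth_exp \<le> A" "\<bar>ln c'\<bar> + growth_exp \<le> A"
    using growth_exp_pos by (auto simp: A_def)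
  have "tame A a l (lam a l)" if l: "0 < l" for a l
    unfolding tame_def
  proof (intro conjI ballI)
    show pos: "0 < lam a l" using lam[OF l] .
    fix x assume x: "x \<in> cube a l"
    define R where "R = l + 1 + norm x"
    define y where "y = ln (exp 1 + norm x)"
    have R: "1 \<le> R" "0 < l / R" using l by (simp_all add: R_def add_pos_nonneg)
    have y: "1 \<le> y" by (simp add: y_def one_le_ln_exp_1_add)
    have low: "ln c' + growth_exp * ln (l / R) \<le> ln (lam a l)"
    proof -
      have "c' * (l / R) powr growth_exp = c * (l / R) powr growth_exp * (portion 1 * cnorm 1)"
        by (simp add: c'_def)
      also have "\<dots> \<le> c * (l / R) powr growth_exp * cnorm R"
        using c R by (intro mult_left_mono cnorm_ge_cnorm) auto
      also have "\<dots> \<le> lam a l"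
        using c l x by (simp add: R_def)
      finally have "ln (c' * (l / R) powr growth_exp) \<le> ln (lam a l)"
        using c' R l by (intro ln_mono mult_pos_pos) auto
      moreover have "ln (c' * (l / R) powr growth_exp) = ln c' + ln ((l / R) powr growth_exp)"
        using c' R l by (intro ln_mult_pos) auto
      moreover have "ln ((l / R) powr growth_exp) = growth_exp * ln (l / R)"
        using R l by (intro ln_powr)
      ultimately show ?thesis
        by linarith
    qed
    have y1: "\<bar>ln c'\<bar> * 1 \<le> \<bar>ln c'\<bar> * y" "\<bar>ln C\<bar> * 1 \<le> \<bar>ln C\<bar> * y"
      using y by (intro mult_left_mono; simp)+
    show "if l \<le> 1 then \<bar>ln (lam a l)\<bar> \<le> A * (\<bar>ln l\<bar> + ln (exp 1 + norm x))
        else - A * ln (exp 1 + norm x) \<le> ln (lam a l)"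
    proof (cases "l \<le> 1")
      case True
      have "R \<le> exp 1 + norm x"
        using True exp_ge_add_one_self[of 1] by (simp add: R_def)
      then have lnR: "ln R \<le> y" "0 \<le> ln R"
        using R by (auto simp: y_def intro: ln_mono)
      have "ln (lam a l) \<le> ln (C * R powr growth_exp)"
        using C(2) l x pos by (intro ln_mono) (auto simp: R_def)
      also have "\<dots> = ln C + growth_exp * ln R"
        using C(1) R by (simp add: ln_mult_pos ln_powr)
      also have "\<dots> \<le> \<bar>ln C\<bar> * y + growth_exp * y"
        using y1 lnR growth_exp_pos mult_left_mono[of "ln R" y growth_exp] by linarith
      also have "\<dots> \<le> A * y"
        using A y by (simp add: distrib_right[symmetric] mult_right_mono)
      also have "\<dots> \<le> A * (\<bar>ln l\<bar> + y)"
        using A by (intro mult_left_mono) auto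
      finally have up: "ln (lam a l) \<le> A * (\<bar>ln l\<bar> + y)" .
      have "ln (l / R) = - \<bar>ln l\<bar> - ln R"
        using l True R by (simp add: ln_div)
      then have "- (\<bar>ln l\<bar> + y) \<le> ln (l / R)"
        using lnR by linarith
      then have "growth_exp * - (\<bar>ln l\<bar> + y) \<le> growth_exp * ln (l / R)"
        using growth_exp_pos by (intro mult_left_mono) auto
      moreover have "\<bar>ln c'\<bar> * 1 \<le> \<bar>ln c'\<bar> * (\<bar>ln l\<bar> + y)"
        using y by (intro mult_left_mono) auto
      moreover have "(\<bar>ln c'\<bar> + growth_exp) * (\<bar>ln l\<bar> + y) \<le> A * (\<bar>ln l\<bar> + y)"
        using A y by (intro mult_right_mono) auto
      ultimately have "- (A * (\<bar>ln l\<bar> + y)) \<le> ln (lam a l)"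
        using low unfolding distrib_right mult_minus_right by linarith
      with up True show ?thesis
        by (simp add: y_def abs_le_iff)
    next
      case False
      have "1 / (exp 1 + norm x) \<le> l / R"
        using False unfolding R_def by (intro inverse_position_le_ratio) auto
      then have "ln (1 / (exp 1 + norm x)) \<le> ln (l / R)"
        by (intro ln_mono) (auto intro: add_pos_nonneg)
      moreover have "ln (1 / (exp 1 + norm x)) = - y"
        unfolding y_def inverse_eq_divide[symmetric] by (rule ln_inverse)
      ultimately have "- y \<le> ln (l / R)"
        by linarith
      then have "growth_exp * - y \<le> growth_exp * ln (l / R)"
        using growth_exp_pos by (intro mult_left_mono) auto
      moreover have "(\<bar>ln c'\<bar> + growth_exp) * y \<le> A * y"
        using A y by (intro mult_right_mono) auto
      ultimately have "- (A * y) \<le> ln (lam a l)"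
        using low y1 unfolding distrib_right mult_minus_right by linarith
      with False show ?thesis
        by (simp add: y_def)
    qed
  qed
  then show ?thesis
    using A(1) by blast
qed

end

section \<open>The \<open>A\<^sub>\<infinity>\<close> condition and its consequences for the norms\<close>

lemma set_nn_integral_compare:
  fixes f :: "real ^ 'n \<Rightarrow> ennreal" and g h :: "real ^ 'n \<Rightarrow> real"
  assumes [measurable]: "f \<in> borel_measurable lebesgue" "g \<in> borel_measurable lebesgue"
    "h \<in> borel_measurable lebesgue" "E \<in> sets lebesgue"
    and C: "0 \<le> C" and h: "\<And>x. 0 \<le> h x"
    and le: "\<And>x. x \<in> E \<Longrightarrow> g x \<le> C * h x + decay N x"
  shows "(\<integral>\<^sup>+x\<in>E. ennreal (g x) * f x \<partial>lebesgue) \<le>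
    ennreal C * (\<integral>\<^sup>+x\<in>E. ennreal (h x) * f x \<partial>lebesgue) + (\<integral>\<^sup>+x. ennreal (decay N x) * f x \<partial>lebesgue)"
proof -
  have "(\<integral>\<^sup>+x\<in>E. ennreal (g x) * f x \<partial>lebesgue) \<le>
    (\<integral>\<^sup>+x. ennreal C * (ennreal (h x) * f x * indicator E x) + ennreal (decay N x) * f x \<partial>lebesgue)"
  proof (rule nn_integral_mono)
    fix x
    show "ennreal (g x) * f x * indicator E x \<le>
        ennreal C * (ennreal (h x) * f x * indicator E x) + ennreal (decay N x) * f x"
    proof (cases "x \<in> E")
      case True
      have "ennreal (g x) \<le> ennreal (C * h x + decay N x)"
        using le[OF True] by (rule ennreal_leI)
      also have "\<dots> = ennreal C * ennreal (h x) + ennreal (decay N x)"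
        using C h by (simp add: ennreal_mult)
      finally have "ennreal (g x) * f x \<le> (ennreal C * ennreal (h x) + ennreal (decay N x)) * f x"
        by (rule mult_right_mono) simp
      then show ?thesis
        using True by (simp add: distrib_right mult.assoc)
    qed simp
  qed
  also have "\<dots> = ennreal C * (\<integral>\<^sup>+x\<in>E. ennreal (h x) * f x \<partial>lebesgue) + (\<integral>\<^sup>+x. ennreal (decay N x) * f x \<partial>lebesgue)"
    by (subst nn_integral_add, measurable) (simp add: nn_integral_cmult)
  finally show ?thesis .
qed

context log_Hoelder_norms
begin

lemma ref_exp_mass_compare:
  assumes c: "0 < c"
  shows "\<exists>C\<ge>1. \<forall>a l E. 0 < l \<longrightarrow> E \<in> sets lebesgue \<longrightarrow> E \<subseteq> cube a l \<longrightarrow>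
    (\<integral>\<^sup>+x\<in>E. ennreal ((v x / lam a l) powr u x) \<partial>lebesgue) \<le>
      ennreal C * (ennreal (lam a l powr - ref_exp a l) * emeasure mass E) + ennreal c \<and>
    ennreal (lam a l powr - ref_exp a l) * emeasure mass E \<le>
      ennreal C * (\<integral>\<^sup>+x\<in>E. ennreal ((v x / lam a l) powr u x) \<partial>lebesgue) + ennreal c"
proof -
  obtain A where A: "0 \<le> A" "\<And>a l. 0 < l \<Longrightarrow> tame A a l (lam a l)"
    using tame_lam by blast
  obtain N where N: "0 \<le> N"
    "(\<integral>\<^sup>+x. ennreal (decay N x) * ennreal (v x powr u x) \<partial>lebesgue) \<le> ennreal c"
    using decay_mass_small[OF c] by blast
  obtain C where C: "1 \<le> C" and compare: "\<forall>a l \<beta> x. 0 < l \<longrightarrow> tame A a l \<beta> \<longrightarrow> x \<in> cube a l \<longrightarrow>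
    \<beta> powr - (1 * u x) \<le> C * \<beta> powr - (1 * ref_exp a l) + decay N x \<and>
    \<beta> powr - (1 * ref_exp a l) \<le> C * \<beta> powr - (1 * u x) + decay N x"
    using tame_compare[OF A(1) N(1), of 1] by auto
  have "(\<integral>\<^sup>+x\<in>E. ennreal ((v x / lam a l) powr u x) \<partial>lebesgue) \<le>
      ennreal C * (ennreal (lam a l powr - ref_exp a l) * emeasure mass E) + ennreal c \<and>
    ennreal (lam a l powr - ref_exp a l) * emeasure mass E \<le>
      ennreal C * (\<integral>\<^sup>+x\<in>E. ennreal ((v x / lam a l) powr u x) \<partial>lebesgue) + ennreal c"
    if l: "0 < l" and E [measurable]: "E \<in> sets lebesgue" and sub: "E \<subseteq> cube a l" for a l E
  proof -
    have eq1: "(\<integral>\<^sup>+x\<in>E. ennreal ((v x / lam a l) powr u x) \<partial>lebesgue) =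
        (\<integral>\<^sup>+x\<in>E. ennreal (lam a l powr - u x) * ennreal (v x powr u x) \<partial>lebesgue)"
      by (simp add: powr_u_eq[OF l] ennreal_mult mult.commute)
    have eq2: "ennreal (lam a l powr - ref_exp a l) * emeasure mass E =
        (\<integral>\<^sup>+x\<in>E. ennreal (lam a l powr - ref_exp a l) * ennreal (v x powr u x) \<partial>lebesgue)"
      by (simp add: mass_eq nn_integral_cmult mult.assoc)
    have cmp: "lam a l powr - u x \<le> C * lam a l powr - ref_exp a l + decay N x"
      "lam a l powr - ref_exp a l \<le> C * lam a l powr - u x + decay N x" if "x \<in> E" for x
      using compare[rule_format, OF l A(2)[OF l], of x] that sub by auto
    have C0: "0 \<le> C" using C by simp
    let ?I = "\<lambda>g. \<integral>\<^sup>+x\<in>E. ennreal (g x) * ennreal (v x powr u x) \<partial>lebesgue"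
    have "?I (\<lambda>x. lam a l powr - u x) \<le> ennreal C * ?I (\<lambda>x. lam a l powr - ref_exp a l) +
        (\<integral>\<^sup>+x. ennreal (decay N x) * ennreal (v x powr u x) \<partial>lebesgue)"
      by (rule set_nn_integral_compare) (use cmp C0 in auto)
    moreover have "?I (\<lambda>x. lam a l powr - ref_exp a l) \<le> ennreal C * ?I (\<lambda>x. lam a l powr - u x) +
        (\<integral>\<^sup>+x. ennreal (decay N x) * ennreal (v x powr u x) \<partial>lebesgue)"
      by (rule set_nn_integral_compare) (use cmp C0 in auto)
    ultimately show ?thesis
      unfolding eq1 eq2 using N(2) by (meson add_left_mono order_trans)
  qed
  with C show ?thesis
    by blast
qed

text \<open>
  On a cube the modular of \<open>v / lam\<close> is, up to a constant and a small error, a multiple of the mass of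
  \<open>W = v\<^sup>u\<close>. A half of the cube carries at least \<open>c0\<close> of the modular, and the whole cube at most \<open>1\<close>. With
  an error of at most \<open>c0 / 2\<close> both facts pass to the mass.
\<close>

lemma exists_fat: "\<exists>\<epsilon>. fat_weight (\<lambda>x. v x powr u x) \<epsilon>"
proof -
  define c0 where "c0 = portion (1 / 2)"
  have c0: "0 < c0" "c0 \<le> 1"
    unfolding c0_def by (intro portion_pos portion_le_1; simp)+
  obtain C where C: "1 \<le> C" and compare: "\<forall>a l E. 0 < l \<longrightarrow> E \<in> sets lebesgue \<longrightarrow> E \<subseteq> cube a l \<longrightarrow>
    (\<integral>\<^sup>+x\<in>E. ennreal ((v x / lam a l) powr u x) \<partial>lebesgue) \<le>
      ennreal C * (ennreal (lam a l powr - ref_exp a l) * emeasure mass E) + ennreal (c0 / 2) \<and>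
    ennreal (lam a l powr - ref_exp a l) * emeasure mass E \<le>
      ennreal C * (\<integral>\<^sup>+x\<in>E. ennreal ((v x / lam a l) powr u x) \<partial>lebesgue) + ennreal (c0 / 2)"
    using ref_exp_mass_compare[of "c0 / 2"] c0 by auto
  define \<epsilon> where "\<epsilon> = c0 / (4 * C\<^sup>2)"
  have C2: "1 \<le> C\<^sup>2"
    using C by simp
  have \<epsilon>: "0 < \<epsilon>" "\<epsilon> < 1"
  proof -
    have "c0 < 4 * C\<^sup>2" "0 < 4 * C\<^sup>2" using c0 C2 by linarith+
    then show "0 < \<epsilon>" "\<epsilon> < 1"
      unfolding \<epsilon>_def using c0 by (simp_all only: divide_less_eq_1_pos divide_pos_pos)
  qed
  have fin: "emeasure mass (cube a l) < \<infinity>" if "0 < l" for a l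
    using mass_cube_le[OF that, of a] by (auto intro: le_less_trans)
  have "fat_weight (\<lambda>x. v x powr u x) \<epsilon>"
  proof (unfold_locales; (rule \<epsilon>)?)
    fix a :: "real ^ 'n" and l :: real assume l: "0 < l"
    show "emeasure mass (cube a l) < \<infinity>" by (rule fin[OF l])
    fix E assume E: "E \<in> sets lebesgue" "E \<subseteq> cube a l" "ennreal (l ^ CARD('n) / 2) \<le> emeasure lebesgue E"
    define \<kappa> where "\<kappa> = lam a l powr - ref_exp a l"
    have \<kappa>: "0 < \<kappa>" using lam[OF l, of a] by (simp add: \<kappa>_def)
    obtain m where m: "emeasure mass (cube a l) = ennreal m" "0 \<le> m"
      using fin[OF l, of a] by (cases "emeasure mass (cube a l)") auto
    have "emeasure mass E \<le> ennreal m"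
      using E m(1) emeasure_mono[of E "cube a l" mass] by simp
    then obtain e where e: "emeasure mass E = ennreal e" "0 \<le> e"
      by (cases "emeasure mass E") (auto simp: top_unique)
    have "ennreal c0 \<le> (\<integral>\<^sup>+x\<in>E. ennreal ((v x / lam a l) powr u x) \<partial>lebesgue)"
      unfolding c0_def using E by (intro integral_ge_portion l) auto
    also have "\<dots> \<le> ennreal C * (ennreal \<kappa> * ennreal e) + ennreal (c0 / 2)"
      using compare[rule_format, OF l E(1,2)] unfolding \<kappa>_def e(1)[symmetric] by (rule conjunct1)
    also have "\<dots> = ennreal (C * (\<kappa> * e) + c0 / 2)"
      using C \<kappa> e c0 by (simp add: ennreal_mult[symmetric] ennreal_plus[symmetric] del: ennreal_plus)
    finally have "c0 \<le> C * (\<kappa> * e) + c0 / 2"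
      using C \<kappa> e c0 by (subst (asm) ennreal_le_iff) auto
    then have lower: "c0 / 2 \<le> C * \<kappa> * e"
      by simp
    have "ennreal \<kappa> * ennreal m \<le>
        ennreal C * (\<integral>\<^sup>+x\<in>cube a l. ennreal ((v x / lam a l) powr u x) \<partial>lebesgue) + ennreal (c0 / 2)"
      using compare[rule_format, OF l cube_lebesgue order_refl] unfolding \<kappa>_def m(1)[symmetric]
      by (rule conjunct2)
    also have "\<dots> \<le> ennreal C * 1 + ennreal (c0 / 2)"
      by (intro add_right_mono mult_left_mono int_v l) simp
    also have "\<dots> = ennreal (C + c0 / 2)"
      using C c0 by (simp add: ennreal_plus[symmetric] del: ennreal_plus)
    finally have "\<kappa> * m \<le> C + c0 / 2"
      using \<kappa> m C c0 by (simp add: ennreal_mult[symmetric] del: ennreal_plus)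
    then have "\<kappa> * m \<le> 2 * C"
      using C c0 by linarith
    then have "(c0 / 2) * (\<kappa> * m) \<le> (c0 / 2) * (2 * C)"
      using c0 by (intro mult_left_mono) auto
    also have "\<dots> \<le> (C * \<kappa> * e) * (2 * C)"
      using lower C by (intro mult_right_mono) auto
    finally have "\<kappa> * (c0 * m) \<le> \<kappa> * (4 * C\<^sup>2 * e)"
      by (simp add: power2_eq_square mult_ac)
    then have "c0 * m \<le> 4 * C\<^sup>2 * e"
      using \<kappa> by simp
    then have "\<epsilon> * m \<le> e"
      using C2 C by (simp add: \<epsilon>_def pos_divide_le_eq mult.commute)
    then show "ennreal \<epsilon> * emeasure mass (cube a l) \<le> emeasure mass E"
      using m e \<epsilon> by (simp add: ennreal_mult[symmetric] ennreal_leI)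
  qed
  then show ?thesis ..
qed

text \<open>
  The polynomial growth of the mass of centred cubes implies the same for their norms. The maximum with
  \<open>1\<close> is harmless as the norms of the centred cubes of radius at least \<open>1\<close> are bounded below.
\<close>

lemma cnorm_growth: "\<exists>\<delta>>0. \<exists>c>0. \<forall>R\<ge>1. c * R powr \<delta> \<le> cnorm R"
proof -
  obtain \<epsilon> where "fat_weight (\<lambda>x. v x powr u x) \<epsilon>"
    using exists_fat by blast
  then interpret fat_weight "\<lambda>x. v x powr u x" \<epsilon> .
  obtain \<gamma> c where \<gamma>: "0 < \<gamma>" and c: "0 < c"
    and growth: "\<And>R. 1 \<le> R \<Longrightarrow> c * R powr \<gamma> \<le> measure mass (ccube R)"
    using mass_ccube_growth by blast
  define c1 where "c1 = min 1 (portion 1 * cnorm 1)"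
  have c1: "0 < c1" "c1 \<le> 1"
    using portion_pos[of 1] cnorm_pos[of 1] by (auto simp: c1_def)
  have "c1 * c powr (1 / U) * R powr (\<gamma> / U) \<le> cnorm R" if R: "1 \<le> R" for R
  proof -
    have "emeasure mass (ccube R) \<le> ennreal (max 1 (cnorm R) powr U)"
      unfolding ccube_def cnorm_def using R by (intro mass_cube_le) simp
    then have "measure mass (ccube R) \<le> max 1 (cnorm R) powr U"
      unfolding measure_def by (intro enn2real_leI) auto
    then have "c * R powr \<gamma> \<le> max 1 (cnorm R) powr U"
      using growth[OF R] by linarith
    then have "(c * R powr \<gamma>) powr (1 / U) \<le> (max 1 (cnorm R) powr U) powr (1 / U)"
      using c U by (intro powr_mono2) auto
    also have "\<dots> = max 1 (cnorm R)"
      using U by (simp add: powr_powr)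
    also have "(c * R powr \<gamma>) powr (1 / U) = c powr (1 / U) * R powr (\<gamma> / U)"
      using c by (simp add: powr_mult powr_powr)
    finally have "c1 * (c powr (1 / U) * R powr (\<gamma> / U)) \<le> c1 * max 1 (cnorm R)"
      using c1 by (intro mult_left_mono) auto
    also have "c1 * max 1 (cnorm R) \<le> cnorm R"
    proof (cases "1 \<le> cnorm R")
      case True
      then show ?thesis using c1 by (simp add: max_def mult_left_le_one_le)
    next
      case False
      have "c1 \<le> portion 1 * cnorm 1" by (simp add: c1_def)
      also have "\<dots> \<le> cnorm R" using R by (intro cnorm_ge_cnorm) auto
      finally show ?thesis using False by (simp add: max_def)
    qed
    finally show ?thesis by (simp add: mult.assoc)
  qed
  moreover have "0 < c1 * c powr (1 / U)" "0 < \<gamma> / U"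
    using c1 c \<gamma> U by auto
  ultimately show ?thesis
    by blast
qed

lemma lam_growth:
  "\<exists>\<delta>>0. \<exists>c>0. \<forall>a l x. 1 \<le> l \<longrightarrow> x \<in> cube a l \<longrightarrow> c * (exp 1 + norm x) powr - growth_exp * l powr \<delta> \<le> lam a l"
proof -
  obtain \<delta> c1 where \<delta>: "0 < \<delta>" and c1: "0 < c1" "\<And>R. 1 \<le> R \<Longrightarrow> c1 * R powr \<delta> \<le> cnorm R"
    using cnorm_growth by blast
  obtain c where c: "0 < c" "\<And>a l x. 0 < l \<Longrightarrow> x \<in> cube a l \<Longrightarrow>
    c * (l / (l + 1 + norm x)) powr growth_exp * cnorm (l + 1 + norm x) \<le> lam a l"
    using lam_lower by blast
  have "c * c1 * (exp 1 + norm x) powr - growth_exp * l powr \<delta> \<le> lam a l" if l: "1 \<le> l" and x: "x \<in> cube a l" for a l x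
  proof -
    define R where "R = l + 1 + norm x"
    have R: "1 \<le> R" "l \<le> R" using l by (simp_all add: R_def)
    have "0 < exp 1 + norm x" by (intro add_pos_nonneg) auto
    then have "(exp 1 + norm x) powr - growth_exp = (1 / (exp 1 + norm x)) powr growth_exp"
      by (simp add: powr_divide powr_minus_divide)
    also have "\<dots> \<le> (l / R) powr growth_exp"
      unfolding R_def using growth_exp_pos inverse_position_le_ratio[OF l, of "norm x"]
      by (intro powr_mono2) (auto simp: add_pos_nonneg less_imp_le)
    finally have "(exp 1 + norm x) powr - growth_exp * (c1 * l powr \<delta>) \<le> (l / R) powr growth_exp * (c1 * R powr \<delta>)"
      using R l \<delta> c1(1) by (intro mult_mono mult_left_mono powr_mono2) auto
    also have "\<dots> \<le> (l / R) powr growth_exp * cnorm R"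
      using c1(2)[OF R(1)] by (intro mult_left_mono) auto
    finally have "c * ((exp 1 + norm x) powr - growth_exp * (c1 * l powr \<delta>)) \<le> c * ((l / R) powr growth_exp * cnorm R)"
      using c(1) by (intro mult_left_mono) auto
    also have "\<dots> \<le> lam a l"
      using c(2)[of l x a] l x by (simp add: R_def mult.assoc)
    finally show ?thesis by (simp add: mult_ac)
  qed
  moreover have "0 < c * c1" using c c1 by simp
  ultimately show ?thesis
    using \<delta> by blast
qed

text \<open>
  Large cubes near the origin have norms that grow like a power of the side, so division by a smaller power
  of the side does not make them too small.
\<close>

lemma tame_scaled:
  "\<exists>\<delta>>0. \<exists>A\<ge>0. \<forall>a l \<theta>. 0 < l \<longrightarrow> 0 \<le> \<theta> \<longrightarrow> \<theta> \<le> \<delta> \<longrightarrow> tame A a l (lam a l * l powr - \<theta>)"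
proof -
  obtain \<delta> c where \<delta>: "0 < \<delta>" and c: "0 < c"
    and growth: "\<And>a l x. 1 \<le> l \<Longrightarrow> x \<in> cube a l \<Longrightarrow> c * (exp 1 + norm x) powr - growth_exp * l powr \<delta> \<le> lam a l"
    using lam_growth by blast
  obtain A where A: "0 \<le> A" "\<And>a l. 0 < l \<Longrightarrow> tame A a l (lam a l)"
    using tame_lam by blast
  define A' where "A' = A + \<delta> + \<bar>ln c\<bar> + growth_exp"
  have "tame A' a l (lam a l * l powr - \<theta>)" if l: "0 < l" and \<theta>: "0 \<le> \<theta>" "\<theta> \<le> \<delta>" for a l \<theta>
    unfolding tame_def
  proof (intro conjI ballI)
    show "0 < lam a l * l powr - \<theta>"
      using lam[OF l, of a] l by simp
    fix x assume x: "x \<in> cube a l"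
    define y where "y = ln (exp 1 + norm x)"
    have y: "1 \<le> y" by (simp add: y_def one_le_ln_exp_1_add)
    have lnb: "ln (lam a l * l powr - \<theta>) = ln (lam a l) - \<theta> * ln l"
      using lam[OF l, of a] l by (simp add: ln_mult_pos)
    show "if l \<le> 1 then \<bar>ln (lam a l * l powr - \<theta>)\<bar> \<le> A' * (\<bar>ln l\<bar> + ln (exp 1 + norm x))
        else - A' * ln (exp 1 + norm x) \<le> ln (lam a l * l powr - \<theta>)"
    proof (cases "l \<le> 1")
      case True
      have "\<bar>ln (lam a l)\<bar> \<le> A * (\<bar>ln l\<bar> + y)"
        using A(2)[OF l, of a] True x by (auto simp: tame_def y_def)
      moreover have "\<bar>\<theta> * ln l\<bar> = \<theta> * \<bar>ln l\<bar>"
        using \<theta> by (simp add: abs_mult)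
      moreover have "\<theta> * \<bar>ln l\<bar> \<le> \<delta> * (\<bar>ln l\<bar> + y)"
        using \<theta> y by (intro mult_mono) auto
      moreover have "(A + \<delta>) * (\<bar>ln l\<bar> + y) \<le> A' * (\<bar>ln l\<bar> + y)"
        using y growth_exp_pos by (intro mult_right_mono) (auto simp: A'_def)
      ultimately have "\<bar>ln (lam a l) - \<theta> * ln l\<bar> \<le> A' * (\<bar>ln l\<bar> + y)"
        unfolding distrib_right[of A \<delta>] by linarith
      then show ?thesis
        using True unfolding lnb y_def by simp
    next
      case False
      have epos: "0 < exp 1 + norm x" by (intro add_pos_nonneg) auto
      have "ln (c * (exp 1 + norm x) powr - growth_exp * l powr \<delta>) \<le> ln (lam a l)"
        using growth[of l x a] False x c epos by (intro ln_mono) auto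
      moreover have "ln (c * (exp 1 + norm x) powr - growth_exp * l powr \<delta>) = ln c - growth_exp * y + \<delta> * ln l"
        using c epos l unfolding y_def by (simp add: ln_mult_pos)
      moreover have "\<theta> * ln l \<le> \<delta> * ln l"
        using False \<theta> by (intro mult_right_mono) auto
      moreover have "\<bar>ln c\<bar> * 1 \<le> \<bar>ln c\<bar> * y"
        using y by (intro mult_left_mono) auto
      moreover have "(\<bar>ln c\<bar> + growth_exp) * y \<le> A' * y"
        using y A \<delta> by (intro mult_right_mono) (auto simp: A'_def)
      ultimately have "- (A' * y) \<le> ln (lam a l) - \<theta> * ln l"
        unfolding distrib_right by linarith
      then show ?thesis
        using False unfolding lnb y_def by simp
    qed
  qed
  moreover have "0 \<le> A'"
    using A \<delta> growth_exp_pos by (simp add: A'_def)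
  ultimately show ?thesis
    using \<delta> by blast
qed

end

section \<open>Norms in the new exponents\<close>

context log_Hoelder_norms
begin

lemma decay_volume: "\<exists>N\<ge>0. (\<integral>\<^sup>+x. ennreal (decay N (x :: real ^ 'n)) * 1 \<partial>lebesgue) < \<infinity>"
proof (intro exI conjI)
  show "(\<integral>\<^sup>+x. ennreal (decay (real CARD('n) + 2) (x :: real ^ 'n)) * 1 \<partial>lebesgue) < \<infinity>"
  proof (rule decay_integral_finite)
    fix k :: nat assume "1 \<le> k"
    then show "(\<integral>\<^sup>+x\<in>(ccube (real k) :: (real ^ 'n) set). 1 \<partial>lebesgue) \<le> ennreal (2 ^ CARD('n) * real k powr real CARD('n))"
      by (simp add: emeasure_ccube power_mult_distrib powr_realpow)
  qed auto
qed simp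

lemma tame_volume:
  assumes l: "0 < l"
  shows "tame (real CARD('n)) a l (l powr (real CARD('n) / ref_exp a l))"
  unfolding tame_def
proof (intro conjI ballI)
  fix x :: "real ^ 'n"
  have ln1: "0 \<le> ln (exp 1 + norm x)"
    using one_le_ln_exp_1_add[of "norm x"] by simp
  have e: "0 \<le> real CARD('n) / ref_exp a l" "real CARD('n) / ref_exp a l \<le> real CARD('n)"
    using ref_exp_ge_1[of a l] by (auto simp: divide_le_eq)
  show "if l \<le> 1 then \<bar>ln (l powr (real CARD('n) / ref_exp a l))\<bar> \<le> real CARD('n) * (\<bar>ln l\<bar> + ln (exp 1 + norm x))
    else - real CARD('n) * ln (exp 1 + norm x) \<le> ln (l powr (real CARD('n) / ref_exp a l))"
  proof (cases "l \<le> 1")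
    case True
    have "\<bar>ln (l powr (real CARD('n) / ref_exp a l))\<bar> = (real CARD('n) / ref_exp a l) * \<bar>ln l\<bar>"
      using ref_exp_ge_1[of a l] by (simp add: abs_mult)
    also have "\<dots> \<le> real CARD('n) * (\<bar>ln l\<bar> + ln (exp 1 + norm x))"
      using e ln1 by (intro mult_mono) auto
    finally show ?thesis using True by simp
  next
    case False
    then have "0 \<le> (real CARD('n) / ref_exp a l) * ln l"
      using e(1) by (intro mult_nonneg_nonneg) auto
    moreover have "0 \<le> real CARD('n) * ln (exp 1 + norm x)"
      using ln1 by simp
    ultimately show ?thesis
      using False by simp
  qed
qed (use l in simp)

text \<open>
  The norm of \<open>1 / v\<close> in the new exponent is compared with \<open>mu\<close> times \<open>l\<close> to this power, that of \<open>v\<close> with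
  \<open>lam\<close> divided by the same factor, so that the product of the norms is preserved. The factor stands for the
  norm of the characteristic function of the cube in the exponent \<open>t\<close> with \<open>1 / t = (1 - 1 / s) / u\<close>.
\<close>

definition shrink :: "real \<Rightarrow> real ^ 'n \<Rightarrow> real \<Rightarrow> real"
  where "shrink s a l = real CARD('n) * (1 - 1 / s) / ref_exp a l"

text \<open>
  Young's inequality with the weights \<open>q / p\<close> and \<open>q * (1 - 1 / s) / u\<close>, which add up to \<open>1\<close>.
\<close>

lemma powr_mu_le:
  assumes l: "0 < l" and s: "1 \<le> s" and q: "1 / q = 1 - 1 / (s * u x)"
  shows "(1 / (v x * (mu a l * l powr shrink s a l))) powr q \<le>
    (1 / (v x * mu a l)) powr p x + (l powr (real CARD('n) / ref_exp a l)) powr - u x"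
proof -
  define A where "A = 1 / (v x * mu a l)"
  define \<beta> where "\<beta> = l powr (real CARD('n) / ref_exp a l)"
  have A: "0 < A" using v[of x] mu[OF l, of a] by (simp add: A_def)
  have \<beta>: "0 < \<beta>" using l by (simp add: \<beta>_def)
  have "1 * 1 < s * u x"
    using s u(1)[of x] by (intro mult_le_less_imp_less) auto
  then have "1 / (s * u x) < 1"
    by simp
  then have "0 < 1 / q"
    unfolding q by simp
  then have q0: "0 < q"
    by simp
  have pinv: "1 / p x = 1 - 1 / u x"
    using p(2)[of x] by linarith
  define \<alpha> where "\<alpha> = q / p x"
  define \<alpha>' where "\<alpha>' = q * ((1 - 1 / s) / u x)"
  have "\<alpha> + \<alpha>' = q * (1 / p x + (1 - 1 / s) / u x)"
    by (simp add: \<alpha>_def \<alpha>'_def distrib_left)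
  also have "1 / p x + (1 - 1 / s) / u x = 1 / q"
    unfolding pinv q using s u(1)[of x] by (simp add: field_simps)
  finally have sum: "\<alpha> + \<alpha>' = 1"
    using q0 by simp
  have nonneg: "0 \<le> \<alpha>" "0 \<le> \<alpha>'"
    using q0 p(1)[of x] u(1)[of x] s by (auto simp: \<alpha>_def \<alpha>'_def)
  have eq1: "(A powr p x) powr \<alpha> = A powr q"
    using p(1)[of x] by (simp add: powr_powr \<alpha>_def)
  have eq2: "(\<beta> powr - u x) powr \<alpha>' = l powr - (shrink s a l * q)"
    using u(1)[of x] by (simp add: powr_powr \<alpha>'_def \<beta>_def shrink_def mult_ac)
  have "(A powr p x) powr \<alpha> * (\<beta> powr - u x) powr \<alpha>' \<le> \<alpha> * A powr p x + \<alpha>' * \<beta> powr - u x"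
    using nonneg sum A \<beta> by (intro Youngs_inequality_0) auto
  moreover have "\<alpha> * A powr p x \<le> 1 * A powr p x" "\<alpha>' * \<beta> powr - u x \<le> 1 * \<beta> powr - u x"
    using sum nonneg by (intro mult_right_mono; simp)+
  moreover have "(1 / (v x * (mu a l * l powr shrink s a l))) powr q = A powr q * l powr - (shrink s a l * q)"
  proof -
    have "1 / (v x * (mu a l * l powr shrink s a l)) = A * l powr - shrink s a l"
      by (simp add: A_def powr_minus_divide)
    then show ?thesis
      using A by (simp add: powr_mult powr_powr)
  qed
  ultimately show ?thesis
    unfolding A_def[symmetric] \<beta>_def[symmetric] eq1 eq2 by linarith
qed

lemma volume_powr: "0 < l \<Longrightarrow> (l powr (real CARD('n) / ref_exp a l)) powr - ref_exp a l = l powr - real CARD('n)"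
  using ref_exp_ge_1[of a l] by (simp add: powr_powr)

lemma integral_mu_bounded:
  assumes s: "1 \<le> s" and [measurable]: "q \<in> borel_measurable lebesgue" and q: "\<And>x. 1 / q x = 1 - 1 / (s * u x)"
  shows "\<exists>C. \<forall>a l. 0 < l \<longrightarrow>
    (\<integral>\<^sup>+x\<in>cube a l. ennreal ((1 / (v x * (mu a l * l powr shrink s a l))) powr q x) \<partial>lebesgue) \<le> ennreal C"
proof -
  obtain N where N: "0 \<le> N" "(\<integral>\<^sup>+x. ennreal (decay N (x :: real ^ 'n)) * 1 \<partial>lebesgue) < \<infinity>"
    using decay_volume by blast
  obtain D where D: "(\<integral>\<^sup>+x. ennreal (decay N (x :: real ^ 'n)) * 1 \<partial>lebesgue) = ennreal D" "0 \<le> D"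
    using N(2) by (cases "\<integral>\<^sup>+x. ennreal (decay N (x :: real ^ 'n)) * 1 \<partial>lebesgue") auto
  obtain C where C: "1 \<le> C" and compare: "\<forall>a l \<beta> x. 0 < l \<longrightarrow> tame (real CARD('n)) a l \<beta> \<longrightarrow> x \<in> cube a l \<longrightarrow>
    \<beta> powr - (1 * u x) \<le> C * \<beta> powr - (1 * ref_exp a l) + decay N x \<and>
    \<beta> powr - (1 * ref_exp a l) \<le> C * \<beta> powr - (1 * u x) + decay N x"
    using tame_compare[of "real CARD('n)" N 1] N(1) by auto
  have "(\<integral>\<^sup>+x\<in>cube a l. ennreal ((1 / (v x * (mu a l * l powr shrink s a l))) powr q x) \<partial>lebesgue) \<le> ennreal (1 + (C + D))"
    if l: "0 < l" for a l
  proof -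
    define \<beta> where "\<beta> = l powr (real CARD('n) / ref_exp a l)"
    have "(\<integral>\<^sup>+x\<in>cube a l. ennreal ((1 / (v x * (mu a l * l powr shrink s a l))) powr q x) \<partial>lebesgue) \<le>
      (\<integral>\<^sup>+x. ennreal ((1 / (v x * mu a l)) powr p x) * indicator (cube a l) x +
        ennreal (\<beta> powr - u x) * 1 * indicator (cube a l) x \<partial>lebesgue)"
    proof (rule nn_integral_mono)
      fix x
      show "ennreal ((1 / (v x * (mu a l * l powr shrink s a l))) powr q x) * indicator (cube a l) x \<le>
        ennreal ((1 / (v x * mu a l)) powr p x) * indicator (cube a l) x +
        ennreal (\<beta> powr - u x) * 1 * indicator (cube a l) x"
        using ennreal_leI[OF powr_mu_le[OF l s q, of x a]]
        by (auto simp: indicator_def \<beta>_def)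
    qed
    also have "\<dots> = (\<integral>\<^sup>+x\<in>cube a l. ennreal ((1 / (v x * mu a l)) powr p x) \<partial>lebesgue) +
        (\<integral>\<^sup>+x\<in>cube a l. ennreal (\<beta> powr - u x) * 1 \<partial>lebesgue)"
      by (rule nn_integral_add) measurable
    also have "\<dots> \<le> 1 + ennreal (C + D)"
    proof (rule add_mono[OF int_w[OF l]])
      have "(\<integral>\<^sup>+x\<in>cube a l. ennreal (\<beta> powr - u x) * 1 \<partial>lebesgue) \<le>
          ennreal C * (\<integral>\<^sup>+x\<in>cube a l. ennreal (\<beta> powr - ref_exp a l) * 1 \<partial>lebesgue) +
          (\<integral>\<^sup>+x. ennreal (decay N (x :: real ^ 'n)) * 1 \<partial>lebesgue)"
      proof (rule set_nn_integral_compare)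
        fix x assume "x \<in> cube a l"
        then show "\<beta> powr - u x \<le> C * \<beta> powr - ref_exp a l + decay N x"
          using compare[rule_format, OF l tame_volume[OF l]] unfolding \<beta>_def by simp
      qed (use C in auto)
      also have "(\<integral>\<^sup>+x\<in>cube a l. ennreal (\<beta> powr - ref_exp a l) * 1 \<partial>lebesgue) = 1"
        using l unfolding \<beta>_def volume_powr[OF l]
        by (simp add: nn_integral_cmult_indicator emeasure_cube ennreal_mult[symmetric] powr_minus powr_realpow)
      finally show "(\<integral>\<^sup>+x\<in>cube a l. ennreal (\<beta> powr - u x) * 1 \<partial>lebesgue) \<le> ennreal (C + D)"
        using C D by simp
    qed
    also have "\<dots> = ennreal (1 + (C + D))"
      using C D by simp
    finally show ?thesis .
  qed
  then show ?thesis
    by blast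
qed

lemma powr_shrink:
  assumes "0 < l" "1 \<le> s"
  shows "(lam a l * l powr - shrink s a l) powr - (s * ref_exp a l) =
    (lam a l powr - ref_exp a l) powr s * (l ^ CARD('n)) powr (s - 1)"
proof -
  have "shrink s a l * (s * ref_exp a l) = real CARD('n) * (s - 1)"
    using assms ref_exp_ge_1[of a l] by (simp add: shrink_def field_simps)
  then have "(l powr - shrink s a l) powr - (s * ref_exp a l) = l powr (real CARD('n) * (s - 1))"
    by (simp add: powr_powr)
  also have "\<dots> = (l ^ CARD('n)) powr (s - 1)"
    using assms by (simp add: powr_powr[symmetric] powr_realpow)
  finally show ?thesis
    using assms lam[of l a] by (simp add: powr_mult powr_powr mult.commute)
qed

text \<open>
  With the constant exponent in place of \<open>u\<close>, and up to a remainder, the integral is a power of the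
  normalising constant times the integral of \<open>W powr s\<close>. The reverse Hoelder inequality turns the latter into
  the \<open>s\<close>-th power of the mass of the cube, and the powers of the volume cancel.
\<close>

lemma integral_lam_bounded:
  "\<exists>r>1. \<forall>s\<in>{1..r}. \<exists>C. \<forall>a l. 0 < l \<longrightarrow>
    (\<integral>\<^sup>+x\<in>cube a l. ennreal ((v x / (lam a l * l powr - shrink s a l)) powr (s * u x)) \<partial>lebesgue) \<le> ennreal C"
proof -
  obtain \<epsilon> where "fat_weight (\<lambda>x. v x powr u x) \<epsilon>"
    using exists_fat by blast
  then interpret fat_weight "\<lambda>x. v x powr u x" \<epsilon> .
  obtain r0 Crh where r0: "1 < r0" and Crh: "0 < Crh" and
    RH: "\<And>s a l. s \<in> {1..r0} \<Longrightarrow> 0 < l \<Longrightarrow> (\<integral>\<^sup>+x\<in>cube a l. ennreal ((v x powr u x) powr s) \<partial>lebesgue) \<le>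
      ennreal (Crh * (l ^ CARD('n)) powr (1 - s) * measure mass (cube a l) powr s)"
    using reverse_Hoelder by blast
  obtain \<delta> A where \<delta>: "0 < \<delta>" and A: "0 \<le> A"
    and tame: "\<And>a l \<theta>. 0 < l \<Longrightarrow> 0 \<le> \<theta> \<Longrightarrow> \<theta> \<le> \<delta> \<Longrightarrow> tame A a l (lam a l * l powr - \<theta>)"
    using tame_scaled by blast
  obtain C1 where C1: "1 \<le> C1" and compare1: "\<forall>a l E. 0 < l \<longrightarrow> E \<in> sets lebesgue \<longrightarrow> E \<subseteq> cube a l \<longrightarrow>
    (\<integral>\<^sup>+x\<in>E. ennreal ((v x / lam a l) powr u x) \<partial>lebesgue) \<le>
      ennreal C1 * (ennreal (lam a l powr - ref_exp a l) * emeasure mass E) + ennreal 1 \<and>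
    ennreal (lam a l powr - ref_exp a l) * emeasure mass E \<le>
      ennreal C1 * (\<integral>\<^sup>+x\<in>E. ennreal ((v x / lam a l) powr u x) \<partial>lebesgue) + ennreal 1"
    using ref_exp_mass_compare[of 1] by auto
  \<comment> \<open>As \<open>1 - 1 / s \<le> s - 1\<close>, this keeps \<open>shrink s a l\<close> below \<open>\<delta>\<close>.\<close>
  define r where "r = 1 + min (r0 - 1) (\<delta> / real CARD('n))"
  have r: "1 < r" "r \<le> r0" "real CARD('n) * (r - 1) \<le> \<delta>"
    using r0 \<delta> by (auto simp: r_def min_def field_simps)
  have "\<exists>C. \<forall>a l. 0 < l \<longrightarrow>
    (\<integral>\<^sup>+x\<in>cube a l. ennreal ((v x / (lam a l * l powr - shrink s a l)) powr (s * u x)) \<partial>lebesgue) \<le> ennreal C"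
    if s: "s \<in> {1..r}" for s
  proof -
    have s1: "1 \<le> s" and sr0: "s \<in> {1..r0}" using s r by auto
    let ?f = "\<lambda>x. ennreal ((v x powr u x) powr s)"
    have mass_fin: "emeasure mass (cube a l) = ennreal (measure mass (cube a l))" if "0 < l" for a l
      using mass_finite[OF that, of a] by (intro emeasure_eq_ennreal_measure) auto
    obtain G m where G: "0 \<le> G" and m: "0 \<le> m"
      and growth: "\<And>k. 1 \<le> k \<Longrightarrow> emeasure mass (ccube (real k)) \<le> ennreal (G * real k powr m)"
      using mass_ccube_le_powr by blast
    have "(\<integral>\<^sup>+x. ennreal (decay (m * s + 2) x) * ?f x \<partial>lebesgue) < \<infinity>"
    proof (rule decay_integral_finite)
      fix k :: nat assume k: "1 \<le> k"
      let ?a = "(\<chi> i. - real k) :: real ^ 'n" and ?l = "2 * real k"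
      have "measure mass (cube ?a ?l) \<le> G * real k powr m"
        using growth[OF k] G mass_fin[of ?l ?a] k by (simp add: ccube_def)
      then have "measure mass (cube ?a ?l) powr s \<le> (G * real k powr m) powr s"
        using s1 by (intro powr_mono2) auto
      moreover have "(?l ^ CARD('n)) powr (1 - s) \<le> 1"
      proof -
        have "1 \<le> ?l ^ CARD('n)"
          by (rule one_le_power) (use k in simp)
        then have "(?l ^ CARD('n)) powr (1 - s) \<le> (?l ^ CARD('n)) powr 0"
          using s1 by (intro powr_mono) auto
        then show ?thesis
          using k by simp
      qed
      ultimately have "Crh * (?l ^ CARD('n)) powr (1 - s) * measure mass (cube ?a ?l) powr s \<le>
          Crh * 1 * (G * real k powr m) powr s"
        using Crh by (intro mult_mono mult_left_mono) auto
      also have "\<dots> = (Crh * G powr s) * real k powr (m * s)"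
        using G by (simp add: powr_mult powr_powr)
      finally show "(\<integral>\<^sup>+x\<in>ccube (real k). ?f x \<partial>lebesgue) \<le> ennreal ((Crh * G powr s) * real k powr (m * s))"
        using RH[OF sr0, of ?l ?a] k unfolding ccube_def by (auto intro: order_trans ennreal_leI)
    qed (use Crh m s1 in auto)
    then obtain D where D: "(\<integral>\<^sup>+x. ennreal (decay (m * s + 2) x) * ?f x \<partial>lebesgue) = ennreal D" "0 \<le> D"
      by (cases "\<integral>\<^sup>+x. ennreal (decay (m * s + 2) x) * ?f x \<partial>lebesgue") auto
    have N: "0 \<le> m * s + 2" using m s1 by simp
    obtain C where C: "1 \<le> C" and compare: "\<forall>a l \<beta> x. 0 < l \<longrightarrow> tame A a l \<beta> \<longrightarrow> x \<in> cube a l \<longrightarrow>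
      \<beta> powr - (s * u x) \<le> C * \<beta> powr - (s * ref_exp a l) + decay (m * s + 2) x \<and>
      \<beta> powr - (s * ref_exp a l) \<le> C * \<beta> powr - (s * u x) + decay (m * s + 2) x"
      using tame_compare[OF A N s1] by blast
    have "(\<integral>\<^sup>+x\<in>cube a l. ennreal ((v x / (lam a l * l powr - shrink s a l)) powr (s * u x)) \<partial>lebesgue)
        \<le> ennreal (C * (Crh * (C1 + 1) powr s) + D)" if l: "0 < l" for a l
    proof -
      define \<beta> where "\<beta> = lam a l * l powr - shrink s a l"
      have \<beta>: "0 < \<beta>" using lam[OF l, of a] l by (simp add: \<beta>_def)
      have sh: "0 \<le> shrink s a l" "shrink s a l \<le> \<delta>"
      proof -
        have s2: "0 \<le> 1 - 1 / s" "1 - 1 / s \<le> s - 1"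
        proof -
          show "0 \<le> 1 - 1 / s" using s1 by simp
          have "0 \<le> (s - 1) * (s - 1) / s" using s1 by simp
          also have "\<dots> = (s - 1) - (1 - 1 / s)" using s1 by (simp add: field_simps)
          finally show "1 - 1 / s \<le> s - 1" by simp
        qed
        then show "0 \<le> shrink s a l"
          using ref_exp_ge_1[of a l] by (simp add: shrink_def)
        have "shrink s a l \<le> real CARD('n) * (1 - 1 / s) / 1"
          unfolding shrink_def using ref_exp_ge_1[of a l] s2 by (intro divide_left_mono) auto
        also have "\<dots> \<le> real CARD('n) * (r - 1)"
          using s2 s by (simp add: mult_left_mono)
        finally show "shrink s a l \<le> \<delta>" using r by linarith
      qed
      have "(v x / \<beta>) powr (s * u x) = \<beta> powr - (s * u x) * (v x powr u x) powr s" for x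
        using v[of x] \<beta> by (simp add: powr_divide powr_minus_divide powr_powr mult.commute)
      then have "(\<integral>\<^sup>+x\<in>cube a l. ennreal ((v x / \<beta>) powr (s * u x)) \<partial>lebesgue) =
          (\<integral>\<^sup>+x\<in>cube a l. ennreal (\<beta> powr - (s * u x)) * ?f x \<partial>lebesgue)"
        by (simp add: ennreal_mult)
      also have "\<dots> \<le> ennreal C * (\<integral>\<^sup>+x\<in>cube a l. ennreal (\<beta> powr - (s * ref_exp a l)) * ?f x \<partial>lebesgue) +
          (\<integral>\<^sup>+x. ennreal (decay (m * s + 2) x) * ?f x \<partial>lebesgue)"
      proof (rule set_nn_integral_compare)
        fix x assume "x \<in> cube a l"
        then show "\<beta> powr - (s * u x) \<le> C * \<beta> powr - (s * ref_exp a l) + decay (m * s + 2) x"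
          using compare[rule_format, OF l tame[OF l sh]] unfolding \<beta>_def by simp
      qed (use C in auto)
      also have "\<dots> = ennreal C * (ennreal (\<beta> powr - (s * ref_exp a l)) * (\<integral>\<^sup>+x\<in>cube a l. ?f x \<partial>lebesgue)) + ennreal D"
        unfolding D(1) mult.assoc by (simp add: nn_integral_cmult)
      also have "\<dots> \<le> ennreal C * ennreal (Crh * (C1 + 1) powr s) + ennreal D"
      proof (intro add_right_mono mult_left_mono)
        define \<kappa> where "\<kappa> = lam a l powr - ref_exp a l"
        define \<mu> where "\<mu> = measure mass (cube a l)"
        have "ennreal \<kappa> * ennreal \<mu> \<le> ennreal C1 * (\<integral>\<^sup>+x\<in>cube a l. ennreal ((v x / lam a l) powr u x) \<partial>lebesgue) + ennreal 1"
          using compare1[rule_format, OF l cube_lebesgue order_refl]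
          unfolding \<kappa>_def \<mu>_def mass_fin[OF l, symmetric] by (rule conjunct2)
        also have "\<dots> \<le> ennreal C1 * 1 + ennreal 1"
          by (intro add_right_mono mult_left_mono int_v l) simp
        also have "\<dots> = ennreal (C1 + 1)"
          using C1 by simp
        finally have km: "\<kappa> * \<mu> \<le> C1 + 1"
          using C1 by (simp add: \<kappa>_def \<mu>_def ennreal_mult[symmetric] del: ennreal_1 ennreal_plus)
        define L where "L = l ^ CARD('n)"
        have L: "0 < L" using l by (simp add: L_def)
        have "ennreal (\<beta> powr - (s * ref_exp a l)) * (\<integral>\<^sup>+x\<in>cube a l. ?f x \<partial>lebesgue) \<le>
            ennreal (\<kappa> powr s * L powr (s - 1)) * ennreal (Crh * L powr (1 - s) * \<mu> powr s)"
          unfolding \<beta>_def powr_shrink[OF l s1] \<kappa>_def L_def \<mu>_def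
          by (intro mult_left_mono RH sr0 l) simp
        also have "\<dots> = ennreal ((\<kappa> powr s * L powr (s - 1)) * (Crh * L powr (1 - s) * \<mu> powr s))"
          using Crh by (simp add: ennreal_mult)
        also have "(\<kappa> powr s * L powr (s - 1)) * (Crh * L powr (1 - s) * \<mu> powr s) =
            Crh * (\<kappa> * \<mu>) powr s * (L powr (s - 1) * L powr (1 - s))"
          by (simp add: powr_mult \<kappa>_def \<mu>_def)
        also have "L powr (s - 1) * L powr (1 - s) = 1"
          using L by (simp add: powr_add[symmetric])
        also have "Crh * (\<kappa> * \<mu>) powr s * 1 \<le> Crh * (C1 + 1) powr s"
          using km s1 Crh by (simp add: \<kappa>_def \<mu>_def powr_mono2)
        finally show "ennreal (\<beta> powr - (s * ref_exp a l)) * (\<integral>\<^sup>+x\<in>cube a l. ?f x \<partial>lebesgue) \<le> ennreal (Crh * (C1 + 1) powr s)"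
          by (simp add: ennreal_leI)
      qed simp
      also have "\<dots> = ennreal (C * (Crh * (C1 + 1) powr s) + D)"
        using C Crh D by (simp add: ennreal_mult)
      finally show ?thesis
        by (simp add: \<beta>_def)
    qed
    then show ?thesis by blast
  qed
  then show ?thesis
    using r(1) by blast
qed

end

section \<open>Norms with finite exponents\<close>

lemma esssup_empty:
  assumes "space M = {}"
  shows "esssup M f = (0 :: ennreal)"
proof -
  have "f \<in> borel_measurable M"
    using assms by (simp add: measurable_def)
  then have "esssup M f \<le> 0"
    by (rule esssup_I) (rule AE_I2, use assms in simp)
  then show ?thesis by simp
qed

lemma modular_real_exponent:
  fixes r g :: "real ^ 'n \<Rightarrow> real" and f :: "real ^ 'n \<Rightarrow> ennreal"
  assumes r: "\<And>x. 1 \<le> r x" and g: "\<And>x. 0 \<le> g x" and l: "0 < l"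
    and fg: "AE x in lebesgue. f x = ennreal (g x)"
  shows "modular (\<lambda>x. ennreal (r x)) (\<lambda>x. f x * indicator Q x / ennreal l) =
    (\<integral>\<^sup>+x\<in>Q. ennreal ((g x / l) powr r x) \<partial>lebesgue)"
proof -
  have "esssup (restrict_space lebesgue {x. ennreal (r x) = \<infinity>}) (\<lambda>x. f x * indicator Q x / ennreal l) = 0"
    by (rule esssup_empty) (simp add: space_restrict_space)
  moreover have "(\<integral>\<^sup>+x\<in>{x. ennreal (r x) \<noteq> \<infinity>}.
      ennreal_powr (f x * indicator Q x / ennreal l) (enn2real (ennreal (r x))) \<partial>lebesgue) =
    (\<integral>\<^sup>+x\<in>Q. ennreal ((g x / l) powr r x) \<partial>lebesgue)"
  proof (rule nn_integral_cong_AE)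
    show "AE x in lebesgue. ennreal_powr (f x * indicator Q x / ennreal l) (enn2real (ennreal (r x))) *
        indicator {x. ennreal (r x) \<noteq> \<infinity>} x = ennreal ((g x / l) powr r x) * indicator Q x"
      using fg
    proof eventually_elim
      case (elim x)
      have "0 \<le> r x" "r x \<noteq> 0" using r[of x] by linarith+
      then show ?case
        using elim l g[of x] by (cases "x \<in> Q") (simp_all add: divide_ennreal ennreal_powr_def)
    qed
  qed
  ultimately show ?thesis
    by (simp add: modular_def)
qed

lemma Lp_norm_le:
  fixes r g :: "real ^ 'n \<Rightarrow> real" and f :: "real ^ 'n \<Rightarrow> ennreal"
  assumes r: "\<And>x. 1 \<le> r x" and [measurable]: "r \<in> borel_measurable lebesgue" "g \<in> borel_measurable lebesgue"
    "Q \<in> sets lebesgue"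
    and g: "\<And>x. 0 \<le> g x" and fg: "AE x in lebesgue. f x = ennreal (g x)" and L: "0 < L"
    and le: "(\<integral>\<^sup>+x\<in>Q. ennreal ((g x / L) powr r x) \<partial>lebesgue) \<le> ennreal C"
  shows "Lp_norm (\<lambda>x. ennreal (r x)) (\<lambda>x. f x * indicator Q x) \<le> ennreal (max 1 C * L)"
proof -
  define D where "D = max 1 C"
  have D: "1 \<le> D" "C \<le> D" by (simp_all add: D_def)
  have DL: "0 < D * L" using D L by simp
  have "modular (\<lambda>x. ennreal (r x)) (\<lambda>x. f x * indicator Q x / ennreal (D * L)) =
      (\<integral>\<^sup>+x\<in>Q. ennreal ((g x / (D * L)) powr r x) \<partial>lebesgue)"
    by (rule modular_real_exponent[OF r g DL fg])
  also have "\<dots> \<le> (\<integral>\<^sup>+x. ennreal (1 / D) * (ennreal ((g x / L) powr r x) * indicator Q x) \<partial>lebesgue)"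
  proof (rule nn_integral_mono)
    fix x
    have "(1 / D) powr r x \<le> (1 / D) powr 1"
      using D r[of x] by (intro powr_mono') auto
    then have "(1 / D) powr r x * (g x / L) powr r x \<le> 1 / D * (g x / L) powr r x"
      using D by (intro mult_right_mono) auto
    moreover have "(g x / (D * L)) powr r x = (1 / D) powr r x * (g x / L) powr r x"
      using D L g[of x] by (simp add: powr_mult[symmetric])
    ultimately have "ennreal ((g x / (D * L)) powr r x) \<le> ennreal (1 / D) * ennreal ((g x / L) powr r x)"
      using D by (simp add: ennreal_mult[symmetric] ennreal_leI)
    then show "ennreal ((g x / (D * L)) powr r x) * indicator Q x \<le>
        ennreal (1 / D) * (ennreal ((g x / L) powr r x) * indicator Q x)"
      by (auto simp: indicator_def)
  qed
  also have "\<dots> = ennreal (1 / D) * (\<integral>\<^sup>+x\<in>Q. ennreal ((g x / L) powr r x) \<partial>lebesgue)"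
    by (rule nn_integral_cmult) measurable
  also have "\<dots> \<le> ennreal (1 / D) * ennreal D"
    using le D by (intro mult_left_mono order_trans[OF le]) (auto intro: ennreal_leI)
  also have "\<dots> = 1"
    using D by (simp add: ennreal_mult[symmetric])
  finally show ?thesis
    unfolding Lp_norm_def D_def[symmetric] using DL by (intro Inf_lower) blast
qed

text \<open>
  If the norm vanished, the modular of \<open>f / l\<close> would stay bounded as \<open>l\<close> tends to \<open>0\<close>, although it is at least
  \<open>1 / l\<close> times the modular of \<open>f\<close>. This excludes that a finite product of norms arises as \<open>0 * \<infinity>\<close>.
\<close>

lemma Lp_norm_nonzero:
  fixes r g :: "real ^ 'n \<Rightarrow> real" and f :: "real ^ 'n \<Rightarrow> ennreal"
  assumes r: "\<And>x. 1 \<le> r x" and [measurable]: "r \<in> borel_measurable lebesgue" "g \<in> borel_measurable lebesgue"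
    "Q \<in> sets lebesgue"
    and g: "\<And>x. 0 < g x" and fg: "AE x in lebesgue. f x = ennreal (g x)" and Q: "emeasure lebesgue Q \<noteq> 0"
  shows "Lp_norm (\<lambda>x. ennreal (r x)) (\<lambda>x. f x * indicator Q x) \<noteq> 0"
proof
  assume 0: "Lp_norm (\<lambda>x. ennreal (r x)) (\<lambda>x. f x * indicator Q x) = 0"
  have approx: "(\<integral>\<^sup>+x\<in>Q. ennreal (g x powr r x) \<partial>lebesgue) \<le> 0 + ennreal e" if e: "0 < e" for e
  proof -
    have "Lp_norm (\<lambda>x. ennreal (r x)) (\<lambda>x. f x * indicator Q x) < ennreal (min 1 e)"
      using e 0 by simp
    then obtain l where l: "0 < l" "ennreal l < ennreal (min 1 e)"
      "modular (\<lambda>x. ennreal (r x)) (\<lambda>x. f x * indicator Q x / ennreal l) \<le> 1"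
      unfolding Lp_norm_def Inf_less_iff by blast
    then have l1: "l < 1" "l < e"
      by (simp_all add: ennreal_less_iff)
    have "(\<integral>\<^sup>+x\<in>Q. ennreal (g x powr r x) \<partial>lebesgue) \<le>
        (\<integral>\<^sup>+x. ennreal l * (ennreal ((g x / l) powr r x) * indicator Q x) \<partial>lebesgue)"
    proof (rule nn_integral_mono)
      fix x
      have "l powr r x \<le> l powr 1"
        using l l1 r[of x] by (intro powr_mono') auto
      then have "l powr r x * (g x / l) powr r x \<le> l * (g x / l) powr r x"
        using l by (intro mult_right_mono) auto
      moreover have "g x powr r x = l powr r x * (g x / l) powr r x"
        using l g[of x] by (simp add: powr_mult[symmetric])
      ultimately have "ennreal (g x powr r x) \<le> ennreal l * ennreal ((g x / l) powr r x)"
        using l by (simp add: ennreal_mult[symmetric] ennreal_leI)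
      then show "ennreal (g x powr r x) * indicator Q x \<le>
          ennreal l * (ennreal ((g x / l) powr r x) * indicator Q x)"
        by (auto simp: indicator_def)
    qed
    also have "\<dots> = ennreal l * (\<integral>\<^sup>+x\<in>Q. ennreal ((g x / l) powr r x) \<partial>lebesgue)"
      by (rule nn_integral_cmult) measurable
    also have "\<dots> \<le> ennreal l * 1"
      using l(3) modular_real_exponent[OF r less_imp_le[OF g] l(1) fg, where Q = Q] by (intro mult_left_mono) auto
    also have "\<dots> \<le> 0 + ennreal e"
      using l1 by (simp add: ennreal_leI)
    finally show ?thesis .
  qed
  have "(\<integral>\<^sup>+x\<in>Q. ennreal (g x powr r x) \<partial>lebesgue) \<le> 0"
    by (rule ennreal_le_epsilon) (rule approx)
  then have null: "(\<integral>\<^sup>+x\<in>Q. ennreal (g x powr r x) \<partial>lebesgue) = 0"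
    by simp
  interpret weight "\<lambda>x. g x powr r x"
    by standard (use less_imp_neq[OF g] in \<open>simp_all add: less_le\<close>)
  show False
    using mass_pos[OF _ Q] null by (simp add: mass_eq)
qed

section \<open>Conjugates of log-Hoelder exponents\<close>

lemma conj_exponent_real:
  assumes "1 < t x"
  shows "conj_exponent (\<lambda>x. ennreal (t x)) x = ennreal (t x / (t x - 1))"
proof -
  have "inverse (ennreal (t x)) = ennreal (inverse (t x))"
    using assms by (intro inverse_ennreal) simp
  moreover have "1 - ennreal (inverse (t x)) = ennreal (1 - inverse (t x))"
    using assms ennreal_minus[of "inverse (t x)" 1] by simp
  moreover have "0 < 1 - inverse (t x)"
    using assms by (simp add: inverse_less_1_iff)
  then have "inverse (ennreal (1 - inverse (t x))) = ennreal (inverse (1 - inverse (t x)))"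
    by (rule inverse_ennreal)
  moreover have "inverse (1 - inverse (t x)) = t x / (t x - 1)"
    using assms by (simp add: field_simps)
  ultimately show ?thesis
    by (simp add: conj_exponent_def)
qed

text \<open>A log-Hoelder continuous function is continuous, so an essential lower bound holds everywhere.\<close>

lemma LH_ess_lower_bound:
  fixes p :: "real ^ 'n \<Rightarrow> real"
  assumes p: "p \<in> LH" and z: "AE x in lebesgue. z \<le> p x"
  shows "z \<le> p x0"
proof (rule ccontr)
  assume "\<not> z \<le> p x0"
  then have gap: "0 < z - p x0" by simp
  obtain C where C: "\<And>x y. norm (x - y) < 1 / 2 \<Longrightarrow> \<bar>p x - p y\<bar> \<le> C / - ln (norm (x - y))"
    using p unfolding LH_def by blast
  \<comment> \<open>On the ball of radius \<open>exp (- T - 1)\<close> the oscillation is at most \<open>\<bar>C\<bar> / T\<close>, which is below the gap.\<close>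
  define T where "T = (\<bar>C\<bar> + 1) / (z - p x0)"
  have T: "0 < T" "\<bar>C\<bar> < T * (z - p x0)"
    using gap by (auto simp: T_def)
  have "p x < z" if x: "x \<in> ball x0 (exp (- T - 1))" for x
  proof (cases "x = x0")
    case False
    have d: "0 < norm (x - x0)" "norm (x - x0) < exp (- T - 1)"
      using False x by (auto simp: dist_norm norm_minus_commute)
    then have "ln (norm (x - x0)) < ln (exp (- T - 1))"
      by (intro ln_less_cancel_iff[THEN iffD2]) auto
    then have lnd: "T < - ln (norm (x - x0))"
      by simp
    have "exp (- T - 1) < exp (- 1 :: real)"
      using T by simp
    also have "exp (- 1 :: real) \<le> 1 / 2"
      using exp_ge_add_one_self[of 1] by (simp add: exp_minus inverse_eq_divide divide_le_eq)
    finally have "\<bar>p x - p x0\<bar> \<le> C / - ln (norm (x - x0))"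
      using d by (intro C) linarith
    also have "\<dots> \<le> \<bar>C\<bar> / T"
      using lnd T by (intro frac_le) auto
    also have "\<dots> < z - p x0"
      using T by (simp add: pos_divide_less_eq mult.commute)
    finally show ?thesis by linarith
  qed (use gap in simp)
  then have "ball x0 (exp (- T - 1)) \<subseteq> {x \<in> space lebesgue. \<not> z \<le> p x}"
    by (auto simp: not_le)
  moreover obtain N where "{x \<in> space lebesgue. \<not> z \<le> p x} \<subseteq> N" "N \<in> null_sets lebesgue"
    using z by (rule AE_E3) auto
  ultimately have "negligible (ball x0 (exp (- T - 1)))"
    by (meson negligible_iff_null_sets negligible_subset order_trans)
  then show False
    using open_not_negligible[of "ball x0 (exp (- T - 1))"] by simp
qed

lemma LH_limit_ge:
  fixes p :: "real ^ 'n \<Rightarrow> real"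
  assumes lim: "\<And>x. \<bar>p x - c\<bar> \<le> C / ln (exp 1 + norm x)" and z: "\<And>x. z \<le> p x"
  shows "z \<le> c"
proof (rule ccontr)
  assume "\<not> z \<le> c"
  then have gap: "0 < z - c" by simp
  define T where "T = (\<bar>C\<bar> + 1) / (z - c)"
  have T: "0 < T" "\<bar>C\<bar> < T * (z - c)"
    using gap by (auto simp: T_def)
  obtain x :: "real ^ 'n" where x: "norm x = exp T"
    using vector_choose_size[of "exp T"] by auto
  have "ln (exp T) \<le> ln (exp 1 + norm x)"
    unfolding x by (intro ln_mono) auto
  then have "C / ln (exp 1 + norm x) \<le> \<bar>C\<bar> / T"
    using T by (intro frac_le) auto
  also have "\<dots> < z - c"
    using T by (simp add: pos_divide_less_eq mult.commute)
  finally show False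
    using lim[of x] z[of x] by linarith
qed

lemma conjugate_diff_le:
  fixes s t z :: real
  assumes "1 < z" "z \<le> s" "z \<le> t"
  shows "\<bar>s / (s - 1) - t / (t - 1)\<bar> \<le> \<bar>s - t\<bar> / (z - 1)\<^sup>2"
proof -
  have "s / (s - 1) - t / (t - 1) = (t - s) / ((s - 1) * (t - 1))"
    using assms by (simp add: field_simps)
  then have "\<bar>s / (s - 1) - t / (t - 1)\<bar> = \<bar>s - t\<bar> / ((s - 1) * (t - 1))"
    using assms by (simp add: abs_mult abs_minus_commute)
  also have "\<dots> \<le> \<bar>s - t\<bar> / (z - 1)\<^sup>2"
    using assms unfolding power2_eq_square by (intro divide_left_mono mult_mono) auto
  finally show ?thesis .
qed

section \<open>Stability of the Muckenhoupt condition\<close>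

lemma obtain_admissible:
  assumes N: "Lp_norm r f \<noteq> 0" "Lp_norm r f < \<infinity>"
  obtains l where "0 < l" "ennreal l \<le> 2 * Lp_norm r f" "modular r (\<lambda>x. f x / ennreal l) \<le> 1"
proof -
  obtain c where c: "Lp_norm r f = ennreal c" "0 \<le> c"
    using N(2) by (cases "Lp_norm r f") auto
  have "c \<noteq> 0" using N(1) c by auto
  then have "Lp_norm r f < ennreal (2 * c)"
    using c by (simp add: ennreal_less_iff)
  then obtain l where l: "0 < l" "ennreal l < ennreal (2 * c)" "modular r (\<lambda>x. f x / ennreal l) \<le> 1"
    unfolding Lp_norm_def Inf_less_iff by blast
  moreover have "ennreal (2 * c) = 2 * Lp_norm r f"
    using c by (simp add: ennreal_mult)
  ultimately show ?thesis
    using that[of l] by (simp add: less_imp_le)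
qed

text \<open>
  Twice the norm is admissible for the modular, which costs a factor \<open>4\<close> in the Muckenhoupt constant.
\<close>

lemma A_class_dual_norms:
  fixes p u v :: "real ^ 'n \<Rightarrow> real" and w :: "real ^ 'n \<Rightarrow> ennreal"
  assumes [measurable]: "u \<in> borel_measurable lebesgue" "p \<in> borel_measurable lebesgue"
      "v \<in> borel_measurable lebesgue"
    and u: "\<And>x. 1 < u x" "\<And>x. u x \<le> U" and p: "\<And>x. 1 < p x" "\<And>x. 1 / u x + 1 / p x = 1"
    and v: "\<And>x. 0 < v x"
    and w: "AE x in lebesgue. w x = ennreal (1 / v x)" "AE x in lebesgue. inverse (w x) = ennreal (v x)"
    and conj: "conj_exponent (\<lambda>x. ennreal (p x)) = (\<lambda>x. ennreal (u x))"
    and A: "A_const (\<lambda>x. ennreal (p x)) w < \<infinity>"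
  shows "\<exists>K lam mu. dual_norms u p v U K lam mu"
proof -
  let ?Nw = "\<lambda>a l. Lp_norm (\<lambda>x. ennreal (p x)) (\<lambda>x. w x * indicator (cube a l) x)"
  let ?Nv = "\<lambda>a l. Lp_norm (\<lambda>x. ennreal (u x)) (\<lambda>x. inverse (w x) * indicator (cube a l) x)"
  obtain B where B: "A_const (\<lambda>x. ennreal (p x)) w = ennreal B" "0 \<le> B"
    using A by (cases "A_const (\<lambda>x. ennreal (p x)) w") auto
  define K where "K = max 1 (4 * B)"
  define good where "good a l lm \<longleftrightarrow> 0 < fst lm \<and> 0 < snd lm \<and>
      (\<integral>\<^sup>+x\<in>cube a l. ennreal ((v x / fst lm) powr u x) \<partial>lebesgue) \<le> 1 \<and>
      (\<integral>\<^sup>+x\<in>cube a l. ennreal ((1 / (v x * snd lm)) powr p x) \<partial>lebesgue) \<le> 1 \<and>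
      fst lm * snd lm \<le> K * l ^ CARD('n)" for a :: "real ^ 'n" and l and lm :: "real \<times> real"
  have ex_good: "\<exists>lm. good a l lm" if l: "0 < l" for a l
  proof -
    have cpos: "emeasure lebesgue (cube a l) \<noteq> 0"
      using l by (simp add: emeasure_cube)
    have u1: "1 \<le> u x" and p1: "1 \<le> p x" and v0: "0 \<le> v x" "0 \<le> 1 / v x" "0 < 1 / v x" for x
      using u(1)[of x] p(1)[of x] v[of x] by simp_all
    have nw: "?Nw a l \<noteq> 0"
      using p1 v0 w(1) cpos by (intro Lp_norm_nonzero[where g = "\<lambda>x. 1 / v x"]) auto
    have nv: "?Nv a l \<noteq> 0"
      using u1 v w(2) cpos by (intro Lp_norm_nonzero[where g = v]) auto
    have "inverse (emeasure lebesgue (cube a l)) * ?Nw a l * ?Nv a l \<le> ennreal B"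
      unfolding B(1)[symmetric] A_const_def conj using l by (intro SUP_upper) (auto simp: cubes_eq)
    then have le: "ennreal (inverse (l ^ CARD('n))) * (?Nw a l * ?Nv a l) \<le> ennreal B"
      using l by (simp add: emeasure_cube inverse_ennreal mult.assoc)
    then have "?Nw a l * ?Nv a l < \<infinity>"
      using l by (auto simp: ennreal_mult_eq_top_iff less_top ennreal_top_mult ennreal_mult_less_top dest!: neq_top_trans[rotated])
    then have fin: "?Nw a l < \<infinity>" "?Nv a l < \<infinity>"
      using nw nv by (auto simp: ennreal_mult_less_top)
    obtain lw where lw: "0 < lw" "ennreal lw \<le> 2 * ?Nw a l"
      "modular (\<lambda>x. ennreal (p x)) (\<lambda>x. w x * indicator (cube a l) x / ennreal lw) \<le> 1"
      using obtain_admissible[OF nw fin(1)] by blast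
    obtain lv where lv: "0 < lv" "ennreal lv \<le> 2 * ?Nv a l"
      "modular (\<lambda>x. ennreal (u x)) (\<lambda>x. inverse (w x) * indicator (cube a l) x / ennreal lv) \<le> 1"
      using obtain_admissible[OF nv fin(2)] by blast
    have "ennreal (lv * lw) \<le> 2 * ?Nv a l * (2 * ?Nw a l)"
      using lv lw by (simp add: ennreal_mult mult_mono)
    also have "\<dots> = 4 * (?Nw a l * ?Nv a l)"
      by (simp add: mult_ac)
    finally have "ennreal (inverse (l ^ CARD('n))) * ennreal (lv * lw) \<le>
        ennreal (inverse (l ^ CARD('n))) * (4 * (?Nw a l * ?Nv a l))"
      by (rule mult_left_mono) simp
    also have "\<dots> = 4 * (ennreal (inverse (l ^ CARD('n))) * (?Nw a l * ?Nv a l))"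
      by (simp add: mult_ac)
    also have "\<dots> \<le> 4 * ennreal B"
      by (intro mult_left_mono le) simp
    also have "\<dots> = ennreal (4 * B)"
      using B by (simp add: ennreal_mult)
    finally have "inverse (l ^ CARD('n)) * (lv * lw) \<le> 4 * B"
      using l lv lw B by (simp add: ennreal_mult[symmetric] del: ennreal_mult')
    also have "\<dots> \<le> K" by (simp add: K_def)
    finally have "lv * lw \<le> K * l ^ CARD('n)"
      using l by (simp add: field_simps)
    moreover have "(\<integral>\<^sup>+x\<in>cube a l. ennreal ((v x / lv) powr u x) \<partial>lebesgue) \<le> 1"
      using lv(3) modular_real_exponent[OF u1 v0(1) lv(1) w(2), where Q = "cube a l"] by simp
    moreover have "(\<integral>\<^sup>+x\<in>cube a l. ennreal ((1 / (v x * lw)) powr p x) \<partial>lebesgue) \<le> 1"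
      using lw(3) modular_real_exponent[OF p1 v0(2) lw(1) w(1), where Q = "cube a l"] by simp
    ultimately show ?thesis
      using lv lw unfolding good_def by (intro exI[of _ "(lv, lw)"]) simp
  qed
  define lm where "lm a l = (SOME lm. good a l lm)" for a l
  have lm: "good a l (lm a l)" if "0 < l" for a l
    unfolding lm_def using ex_good[OF that] by (rule someI_ex)
  have "dual_norms u p v U K (\<lambda>a l. fst (lm a l)) (\<lambda>a l. snd (lm a l))"
    by standard (use u p v lm in \<open>simp_all add: K_def good_def\<close>)
  then show ?thesis
    by blast
qed

lemma scaled_conj_exponent:
  fixes q :: "real ^ 'n \<Rightarrow> ennreal" and u :: "real ^ 'n \<Rightarrow> real"
  assumes q: "q \<in> exponents" and conj: "\<forall>x. conj_exponent q x = ennreal s * ennreal (u x)"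
    and s: "1 \<le> s" and u: "\<And>x. 1 < u x"
  shows "q = (\<lambda>x. ennreal (s * u x / (s * u x - 1)))" and "1 < s * u x"
    and "1 / (s * u x / (s * u x - 1)) = 1 - 1 / (s * u x)" and "1 \<le> s * u x / (s * u x - 1)"
proof -
  have su: "1 < s * u x" for x
    using mult_le_less_imp_less[of 1 s 1 "u x"] s u[of x] by simp
  have "conj_exponent q = (\<lambda>x. ennreal (s * u x))"
    using conj s by (auto simp: ennreal_mult')
  moreover have "q x = conj_exponent (conj_exponent q) x" for x
    using q by (simp add: conj_exponent_conj_exponent exponents_def)
  ultimately show "q = (\<lambda>x. ennreal (s * u x / (s * u x - 1)))"
    using conj_exponent_real[of "\<lambda>x. s * u x", OF su] by auto
  show "1 < s * u x" by (rule su)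
  have "1 / (c / (c - 1)) = 1 - 1 / c" "1 \<le> c / (c - 1)" if "1 < c" for c :: real
    using that by (simp_all add: field_simps)
  from this[OF su] show "1 / (s * u x / (s * u x - 1)) = 1 - 1 / (s * u x)" "1 \<le> s * u x / (s * u x - 1)" .
qed

theorem corollary1p4:
  fixes p :: "real ^ 'n \<Rightarrow> real" and w :: "real ^ 'n \<Rightarrow> ennreal"
  assumes "(\<lambda>x. ennreal (p x)) \<in> exponents"
    and "p \<in> LH"
    and "1 < ess_inf lebesgue (\<lambda>x. ennreal (p x))"
    and "w \<in> A_class (\<lambda>x. ennreal (p x))"
  shows "\<exists>r>1. \<forall>s\<in>{1..r}. \<forall>q\<in>exponents.
    (\<forall>x. conj_exponent q x = ennreal s * conj_exponent (\<lambda>x. ennreal (p x)) x) \<longrightarrow> w \<in> A_class q"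
proof -
  have pp: "1 \<le> p x" for x
    using assms(1) by (auto simp: exponents_def dest!: spec[of _ x])
  have [measurable]: "p \<in> borel_measurable lebesgue"
  proof -
    have "(\<lambda>x. enn2real (ennreal (p x))) \<in> borel_measurable lebesgue"
      using assms(1) by (auto simp: exponents_def)
    moreover have "enn2real (ennreal (p x)) = p x" for x
      using pp[of x] by (intro enn2real_ennreal) linarith
    ultimately show ?thesis by simp
  qed
  obtain z' where z': "1 < z'" "AE x in lebesgue. z' \<le> ennreal (p x)"
    using assms(3) by (auto simp: ess_inf_def less_Sup_iff)
  obtain z where z: "1 < z" "\<And>x. z \<le> p x"
  proof -
    have "z' \<noteq> top"
    proof
      assume "z' = top"
      then have "AE x in (lebesgue :: (real ^ 'n) measure). False"
        using z'(2) by (simp add: top_unique)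
      then have "emeasure lebesgue (UNIV :: (real ^ 'n) set) = 0"
        by (simp add: ae_filter_eq_bot_iff eventually_False)
      then show False
        using emeasure_mono[of "cube 0 1" "UNIV :: (real ^ 'n) set" lebesgue]
          emeasure_cube[of 1 "0 :: real ^ 'n"] by simp
    qed
    then obtain z where z: "z' = ennreal z" "0 \<le> z"
      by (cases z') auto
    have "1 < z"
      using z'(1) z by simp
    moreover have "AE x in lebesgue. z \<le> p x"
      using z'(2) pp unfolding z(1) by (auto elim!: eventually_mono simp: ennreal_le_iff2) (smt (verit) pp)
    then have "z \<le> p x" for x
      by (rule LH_ess_lower_bound[OF assms(2)])
    ultimately show ?thesis by (rule that)
  qed
  obtain C where C: "\<And>x y. norm (x - y) < 1 / 2 \<Longrightarrow> \<bar>p x - p y\<bar> \<le> C / - ln (norm (x - y))"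
    using assms(2) unfolding LH_def by blast
  obtain Cinf pinf where Cinf: "\<And>x. \<bar>p x - pinf\<bar> \<le> Cinf / ln (exp 1 + norm x)"
    using assms(2) unfolding LH_def by blast
  have pinf: "z \<le> pinf"
    by (rule LH_limit_ge[OF Cinf z(2)])
  define u where "u x = p x / (p x - 1)" for x
  define U where "U = z / (z - 1)"
  have p1: "1 < p x" for x
    using z(1) z(2)[of x] by linarith
  have u1: "1 < u x" for x
    using p1[of x] by (simp add: u_def)
  have uU: "u x \<le> U" for x
  proof -
    have eq: "c / (c - 1) = 1 + 1 / (c - 1)" if "1 < c" for c :: real
      using that by (simp add: field_simps)
    have "1 / (p x - 1) \<le> 1 / (z - 1)"
      using z(1) z(2)[of x] by (intro frac_le) auto
    then show ?thesis
      unfolding u_def U_def eq[OF p1] eq[OF z(1)] by simp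
  qed
  have up: "1 / u x + 1 / p x = 1" for x
    using p1[of x] by (simp add: u_def field_simps)
  have [measurable]: "u \<in> borel_measurable lebesgue"
    unfolding u_def by measurable
  have conj: "conj_exponent (\<lambda>x. ennreal (p x)) = (\<lambda>x. ennreal (u x))"
    using conj_exponent_real[of p] p1 by (auto simp: u_def)
  have w: "w \<in> borel_measurable lebesgue" "AE x in lebesgue. 0 < w x \<and> w x < \<infinity>"
    "w \<in> weights" "A_const (\<lambda>x. ennreal (p x)) w < \<infinity>"
    using assms(4) by (auto simp: A_class_def weights_def)
  note [measurable] = w(1)
  \<comment> \<open>The value \<open>1\<close> on a null set makes \<open>v\<close> positive everywhere.\<close>
  define v where "v x = (if 0 < w x \<and> w x < \<infinity> then enn2real (inverse (w x)) else 1)" for x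
  have [measurable]: "v \<in> borel_measurable lebesgue"
    unfolding v_def by measurable
  have vw: "0 < v x \<and> (0 < w x \<and> w x < \<infinity> \<longrightarrow> inverse (w x) = ennreal (v x) \<and> w x = ennreal (1 / v x))" for x
    by (cases "w x") (auto simp: v_def inverse_ennreal inverse_eq_divide)
  have v0: "0 < v x" for x using vw by blast
  have wv: "AE x in lebesgue. w x = ennreal (1 / v x)" "AE x in lebesgue. inverse (w x) = ennreal (v x)"
    by (rule eventually_mono[OF w(2)], use vw in blast)+
  obtain K lam mu where "dual_norms u p v U K lam mu"
    using A_class_dual_norms[OF _ _ _ u1 uU p1 up v0 wv conj w(4)] by auto
  then interpret dual_norms u p v U K lam mu .
  interpret log_Hoelder_norms u p v U K lam mu "pinf / (pinf - 1)" "C / (z - 1)\<^sup>2" "Cinf / (z - 1)\<^sup>2"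
  proof
    show "1 \<le> pinf / (pinf - 1)"
      using pinf z by simp
    show "\<bar>u x - u y\<bar> \<le> C / (z - 1)\<^sup>2 / - ln (norm (x - y))" if "norm (x - y) < 1 / 2" for x y
    proof -
      have "\<bar>u x - u y\<bar> \<le> \<bar>p x - p y\<bar> / (z - 1)\<^sup>2"
        unfolding u_def by (rule conjugate_diff_le[OF z(1) z(2) z(2)])
      also have "\<dots> \<le> (C / - ln (norm (x - y))) / (z - 1)\<^sup>2"
        by (intro divide_right_mono C that) simp
      finally show ?thesis by (simp add: mult.commute)
    qed
    show "\<bar>u x - pinf / (pinf - 1)\<bar> \<le> Cinf / (z - 1)\<^sup>2 / ln (exp 1 + norm x)" for x
    proof -
      have "\<bar>u x - pinf / (pinf - 1)\<bar> \<le> \<bar>p x - pinf\<bar> / (z - 1)\<^sup>2"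
        unfolding u_def by (rule conjugate_diff_le[OF z(1) z(2) pinf])
      also have "\<dots> \<le> (Cinf / ln (exp 1 + norm x)) / (z - 1)\<^sup>2"
        by (intro divide_right_mono Cinf) simp
      finally show ?thesis by (simp add: mult.commute)
    qed
  qed
  obtain r where r: "1 < r" and lam_bound: "\<And>s. s \<in> {1..r} \<Longrightarrow> \<exists>C. \<forall>a l. 0 < l \<longrightarrow>
    (\<integral>\<^sup>+x\<in>cube a l. ennreal ((v x / (lam a l * l powr - shrink s a l)) powr (s * u x)) \<partial>lebesgue) \<le> ennreal C"
    using integral_lam_bounded by blast
  have "w \<in> A_class q"
    if s: "s \<in> {1..r}" and q: "q \<in> exponents"
      and q': "\<forall>x. conj_exponent q x = ennreal s * conj_exponent (\<lambda>x. ennreal (p x)) x" for s q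
  proof -
    have s1: "1 \<le> s" using s by simp
    define t where "t x = s * u x / (s * u x - 1)" for x
    note scaled = scaled_conj_exponent[OF q q'[unfolded conj] s1 u1]
    have qt: "q = (\<lambda>x. ennreal (t x))"
      unfolding t_def by (rule scaled(1))
    have cq: "conj_exponent q = (\<lambda>x. ennreal (s * u x))"
      using q' s1 unfolding conj by (auto simp: ennreal_mult')
    have su: "1 < s * u x" and t: "1 \<le> t x" "1 / t x = 1 - 1 / (s * u x)" for x
      unfolding t_def by (rule scaled)+
    have [measurable]: "t \<in> borel_measurable lebesgue"
      unfolding t_def by measurable
    obtain C1 where C1: "\<And>a l. 0 < l \<Longrightarrow>
      (\<integral>\<^sup>+x\<in>cube a l. ennreal ((v x / (lam a l * l powr - shrink s a l)) powr (s * u x)) \<partial>lebesgue) \<le> ennreal C1"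
      using lam_bound[OF s] by blast
    obtain C2 where C2: "\<And>a l. 0 < l \<Longrightarrow>
      (\<integral>\<^sup>+x\<in>cube a l. ennreal ((1 / (v x * (mu a l * l powr shrink s a l))) powr t x) \<partial>lebesgue) \<le> ennreal C2"
      using integral_mu_bounded[OF s1 _ t(2)] by auto
    have "inverse (emeasure lebesgue (cube a l)) * Lp_norm q (\<lambda>x. w x * indicator (cube a l) x) *
        Lp_norm (conj_exponent q) (\<lambda>x. inverse (w x) * indicator (cube a l) x)
        \<le> ennreal (max 1 C1 * max 1 C2 * K)" if l: "0 < l" for a l
    proof -
      define L1 where "L1 = lam a l * l powr - shrink s a l"
      define L2 where "L2 = mu a l * l powr shrink s a l"
      have L: "0 < L1" "0 < L2"
        using lam[OF l, of a] mu[OF l, of a] l by (simp_all add: L1_def L2_def)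
      have "L1 * L2 = lam a l * mu a l * (l powr - shrink s a l * l powr shrink s a l)"
        by (simp add: L1_def L2_def)
      also have "l powr - shrink s a l * l powr shrink s a l = 1"
        using l by (simp add: powr_add[symmetric])
      finally have L12: "L1 * L2 \<le> K * l ^ CARD('n)"
        using lam_mu[OF l, of a] by simp
      have n1: "Lp_norm q (\<lambda>x. w x * indicator (cube a l) x) \<le> ennreal (max 1 C2 * L2)"
        unfolding qt
      proof (rule Lp_norm_le[where g = "\<lambda>x. 1 / v x"])
        show "(\<integral>\<^sup>+x\<in>cube a l. ennreal ((1 / v x / L2) powr t x) \<partial>lebesgue) \<le> ennreal C2"
          using C2[OF l, of a] by (simp add: L2_def)
      qed (use t L wv v0 in \<open>auto simp: less_imp_le\<close>)
      have n2: "Lp_norm (conj_exponent q) (\<lambda>x. inverse (w x) * indicator (cube a l) x) \<le> ennreal (max 1 C1 * L1)"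
        unfolding cq
      proof (rule Lp_norm_le[where g = v])
        show "(\<integral>\<^sup>+x\<in>cube a l. ennreal ((v x / L1) powr (s * u x)) \<partial>lebesgue) \<le> ennreal C1"
          using C1[OF l, of a] by (simp add: L1_def)
      qed (use su L wv v0 in \<open>auto simp: less_imp_le\<close>)
      have "inverse (emeasure lebesgue (cube a l)) * Lp_norm q (\<lambda>x. w x * indicator (cube a l) x) *
          Lp_norm (conj_exponent q) (\<lambda>x. inverse (w x) * indicator (cube a l) x)
          \<le> ennreal (inverse (l ^ CARD('n))) * ennreal (max 1 C2 * L2) * ennreal (max 1 C1 * L1)"
        using l by (intro mult_mono n1 n2) (simp_all add: emeasure_cube inverse_ennreal)
      also have "\<dots> = ennreal (max 1 C1 * max 1 C2 * (inverse (l ^ CARD('n)) * (L1 * L2)))"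
        using l L by (simp add: ennreal_mult[symmetric] mult_ac)
      also have "\<dots> \<le> ennreal (max 1 C1 * max 1 C2 * K)"
      proof (intro ennreal_leI mult_left_mono)
        show "inverse (l ^ CARD('n)) * (L1 * L2) \<le> K"
          using L12 l by (simp add: field_simps)
      qed simp
      finally show ?thesis .
    qed
    then have "A_const q w \<le> ennreal (max 1 C1 * max 1 C2 * K)"
      unfolding A_const_def by (intro SUP_least) (auto simp: cubes_eq)
    then show ?thesis
      using w(3) by (auto simp: A_class_def intro: le_less_trans)
  qed
  then show ?thesis
    using r by blast
qed

end
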